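(* Let $n\ge2$ and $a=(a_1,\dots,a_n)$ with $a_j>1$ for every $j$. Assume that $f\in H_{n/4}(\mathbb{R}^n)$ and that $f$ has compact support. Then $$\lim_{t\to0}T_tf(x)=f(x)$$ for almost every $x\in\mathbb{R}^n$, where the limit is taken over $t=(t_1,\dots,t_n)$ with $0<t_j<1$ for all $j$.
   Context: The Fourier transform is $\widehat f(\xi)=\int_{\mathbb{R}^n}e^{-ix\cdot\xi}f(x)\,dx$ (extended to tempered distributions), and $H_s(\mathbb{R}^n)$ is the space of tempered distributions $f$ with $\|f\|_{H_s}=\left(\int_{\mathbb{R}^n}(1+|\xi|^2)^s|\widehat f(\xi)|^2\,d\xi\right)^{1/2}<\infty$. For each $j$, let $K^j$ be the Fourier transform of the function $\xi_j\mapsto e^{i|\xi_j|^{a_j}}$ on $\mathbb{R}$; it is known that $K^j\in C^\infty(\mathbb{R})$. For $0<t_j<1$ set $K^j_{t_j}(x_j)=t_j^{-1/a_j}K^j\left(x_j/t_j^{1/a_j}\right)$, which is the Fourier transform of $e^{it_j|\xi_j|^{a_j}}$. For $t=(t_1,\dots,t_n)$ with $0<t_j<1$ set $$K_t(x)=K^1_{t_1}(x_1)K^2_{t_2}(x_2)\cdots K^n_{t_n}(x_n),\qquad x\in\mathbb{R}^n,$$ so that $K_t\in C^\infty\cap\mathcal{S}'$ is the Fourier transform of $e^{it_1|\xi_1|^{a_1}}\cdots e^{it_n|\xi_n|^{a_n}}$. For $f\in L^2(\mathbb{R}^n)$ with compact support, $T_tf(x)=(2\pi)^{-n}\,(K_t*f)(x)$.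 *)

theory Defs
  imports "HOL-Analysis.Analysis"
begin

text \<open>
  Tempered distributions, the Fourier transform and Sobolev spaces over a Euclidean space.
  The Fourier transform is normalised as the integral of \<open>e\<^sup>-\<^sup>i\<^sup>x\<^sup>\<xi> f(x)\<close>, without a factor in front.
\<close>

text \<open>A multi-index is given by a list of basis vectors, the directions of differentiation.\<close>

definition iter_deriv :: "'a::euclidean_space list \<Rightarrow> ('a \<Rightarrow> complex) \<Rightarrow> 'a \<Rightarrow> complex" where
  "iter_deriv bs f = foldr (\<lambda>b g x. frechet_derivative g (at x) b) bs f"

definition smooth :: "('a::euclidean_space \<Rightarrow> complex) \<Rightarrow> bool" where
  "smooth f \<longleftrightarrow> (\<forall>bs x. set bs \<subseteq> Basis \<longrightarrow> iter_deriv bs f differentiable (at x))"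

definition schwartz :: "('a::euclidean_space \<Rightarrow> complex) set" where
  "schwartz = {\<phi>. smooth \<phi> \<and>
     (\<forall>k bs. set bs \<subseteq> Basis \<longrightarrow>
        bdd_above (range (\<lambda>x. (1 + norm x) ^ k * norm (iter_deriv bs \<phi> x))))}"

definition schwartz_seminorm ::
    "nat \<Rightarrow> 'a::euclidean_space list \<Rightarrow> ('a \<Rightarrow> complex) \<Rightarrow> real" where
  "schwartz_seminorm k bs \<phi> = (SUP x. (1 + norm x) ^ k * norm (iter_deriv bs \<phi> x))"

text \<open>
  A distribution is a total function on all of \<open>'a \<Rightarrow> complex\<close>, but only its values on
  \<open>schwartz\<close> are meaningful. The last conjunct is continuity for the Schwartz topology.
\<close>

definition tempered :: "(('a::euclidean_space \<Rightarrow> complex) \<Rightarrow> complex) \<Rightarrow> bool" where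
  "tempered u \<longleftrightarrow>
     (\<forall>\<phi>\<in>schwartz. \<forall>\<psi>\<in>schwartz. u (\<lambda>x. \<phi> x + \<psi> x) = u \<phi> + u \<psi>) \<and>
     (\<forall>c. \<forall>\<phi>\<in>schwartz. u (\<lambda>x. c * \<phi> x) = c * u \<phi>) \<and>
     (\<exists>C N. \<forall>\<phi>\<in>schwartz.
        norm (u \<phi>) \<le> C * (\<Sum>bs\<in>{bs. set bs \<subseteq> Basis \<and> length bs \<le> N}. schwartz_seminorm N bs \<phi>))"

text \<open>The distribution \<open>u\<close> is the function \<open>f\<close>.\<close>

definition induces ::
    "('a::euclidean_space \<Rightarrow> complex) \<Rightarrow> (('a \<Rightarrow> complex) \<Rightarrow> complex) \<Rightarrow> bool" where
  "induces f u \<longleftrightarrow> f \<in> borel_measurable lebesgue \<and>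
     (\<forall>\<phi>\<in>schwartz. integrable lebesgue (\<lambda>x. f x * \<phi> x) \<and>
        u \<phi> = integral\<^sup>L lebesgue (\<lambda>x. f x * \<phi> x))"

definition fourier :: "('a::euclidean_space \<Rightarrow> complex) \<Rightarrow> 'a \<Rightarrow> complex" where
  "fourier f \<xi> = integral\<^sup>L lebesgue (\<lambda>x. exp (- \<i> * of_real (x \<bullet> \<xi>)) * f x)"

definition fourier_dist ::
    "(('a::euclidean_space \<Rightarrow> complex) \<Rightarrow> complex) \<Rightarrow> ('a \<Rightarrow> complex) \<Rightarrow> complex" where
  "fourier_dist u \<phi> = u (fourier \<phi>)"

definition sobolev_dist :: "real \<Rightarrow> (('a::euclidean_space \<Rightarrow> complex) \<Rightarrow> complex) set" where
  "sobolev_dist s = {u. tempered u \<and>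
     (\<exists>g. induces g (fourier_dist u) \<and>
        integrable lebesgue (\<lambda>\<xi>. (1 + (norm \<xi>)\<^sup>2) powr s * (norm (g \<xi>))\<^sup>2))}"

text \<open>
  The functions belonging to \<open>H\<^sub>s\<close>. For \<open>s \<ge> 0\<close> every element of \<open>H\<^sub>s\<close> is a function
  (in fact in \<open>L\<^sup>2\<close>, by Plancherel), so nothing is lost compared to \<open>sobolev_dist\<close>.
\<close>

definition sobolev :: "real \<Rightarrow> ('a::euclidean_space \<Rightarrow> complex) set" where
  "sobolev s = {f. \<exists>u\<in>sobolev_dist s. induces f u}"

text \<open>
  The kernel for exponent \<open>a\<close>: the Fourier transform, in the sense of tempered distributions, of
  \<open>\<xi> \<mapsto> exp(i|\<xi>|\<^sup>a)\<close>. The smooth representative is unique, being continuous, and it exists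
  for \<open>a > 1\<close>.
\<close>

definition osc_kernel :: "real \<Rightarrow> real \<Rightarrow> complex" where
  "osc_kernel a = (SOME K. smooth K \<and>
     (\<exists>u. induces (\<lambda>\<xi>. exp (\<i> * of_real (\<bar>\<xi>\<bar> powr a))) u \<and> induces K (fourier_dist u)))"

definition kernel :: "real^'n \<Rightarrow> real^'n \<Rightarrow> real^'n \<Rightarrow> complex" where
  "kernel a t x = (\<Prod>j\<in>UNIV. of_real ((t $ j) powr (- 1 / a $ j)) *
      osc_kernel (a $ j) (x $ j / (t $ j) powr (1 / a $ j)))"

definition T_op :: "real^'n \<Rightarrow> real^'n \<Rightarrow> (real^'n \<Rightarrow> complex) \<Rightarrow> real^'n \<Rightarrow> complex" where
  "T_op a t f x = of_real (1 / (2 * pi) ^ CARD('n)) *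
      integral\<^sup>L lebesgue (\<lambda>y. kernel a t (x - y) * f y)"

end

theory Submission
  imports
    Defs
    "HOL-Probability.Characteristic_Functions"
    "HOL-Probability.Sinc_Integral"
    "HOL-Complex_Analysis.Cauchy_Integral_Theorem"
    "HOL-Real_Asymp.Real_Asymp"
begin

text \<open>
  Since \<open>(1 + \<bar>\<xi>\<bar>\<^sup>2)\<^sup>n\<^sup>/\<^sup>4\<close> dominates \<open>\<Prod>\<^sub>j \<bar>\<xi>\<^sub>j\<bar>\<^sup>1\<^sup>/\<^sup>2\<close>, it suffices to control functions whose Fourier
  transform is square integrable against this product weight. Linearise the supremum over \<open>t\<close>
  by a measurable function \<open>t(x)\<close> and apply the \<open>T T\<^sup>*\<close> method: the resulting kernel is a product of
  the one-dimensional integrals of \<open>\<bar>s\<bar>\<^sup>-\<^sup>1\<^sup>/\<^sup>2 e\<^sup>i\<^sup>(\<^sup>x\<^sup>s\<^sup>+\<^sup>t\<^sup>|\<^sup>s\<^sup>|\<^sup>a\<^sup>)\<close>, each bounded by \<open>C \<bar>x\<bar>\<^sup>-\<^sup>1\<^sup>/\<^sup>2\<close> uniformly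
  in \<open>t\<close> by van der Corput's lemma. As \<open>\<bar>x\<bar>\<^sup>-\<^sup>1\<^sup>/\<^sup>2\<close> is locally integrable, Schur's test bounds the
  maximal function on cubes. Damping the Fourier transform of \<open>f\<close> by \<open>e\<^sup>-\<^sup>\<epsilon>\<^sup>|\<^sup>\<xi>\<^sup>|\<^sup>2\<close> gives functions continuous
  in \<open>t\<close> up to \<open>t = 0\<close>; by the maximal bound they converge uniformly in \<open>t\<close> along a sequence \<open>\<epsilon>\<^sub>k \<rightarrow> 0\<close>, for
  almost every \<open>x\<close>. For \<open>t > 0\<close> the limit is \<open>T_op a t f x\<close>, because the damped kernels converge locally
  boundedly to the kernel, and for \<open>t = 0\<close> it is \<open>f x\<close>.
\<close>

section \<open>Oscillatory integrals with a stationary phase\<close>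

text \<open>The power 1/2 on each coordinate is the scale-invariant one. Dilating the stationary
  point of the phase to 1 leaves a single parameter L and a decay L^(-1/2), and the powers of the
  dilation cancel, so that no trace of the time survives. The bound has to hold for times of either
  sign, because only differences t(x) - t(y) enter the kernel of the composed operator.

  Two obstacles shape the rest. The kernel is a choice from a distributional characterisation, while
  the integral that should define it does not converge absolutely. So an explicit function must be
  shown to qualify, by contour rotation, and to be the only one, by testing against Gaussians.
  Secondly, the Fourier transform of f is bounded and square integrable against the weight but need
  not be integrable, so integrals are exchanged for damped symbols only, with constants independent
  of the damping.

  The value at time 0 is identified with f by integrating over boxes: there the Gaussian mean can be
  moved from f onto the indicator of the box.\<close>

lemma second_mean_value_bound:
  fixes f g :: "real \<Rightarrow> real"
  assumes f: "f integrable_on {p..q}" and pq: "p \<le> q"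
    and g: "mono_on {p..q} g \<or> antimono_on {p..q} g"
    and gB: "\<And>x. x \<in> {p..q} \<Longrightarrow> \<bar>g x\<bar> \<le> B"
    and F: "\<And>c. c \<in> {p..q} \<Longrightarrow> \<bar>integral {p..c} f\<bar> \<le> A \<and> \<bar>integral {c..q} f\<bar> \<le> A"
  shows "\<bar>integral {p..q} (\<lambda>x. g x * f x)\<bar> \<le> 2 * A * B"
proof -
  have *: "\<bar>integral {p..q} (\<lambda>x. h x * f x)\<bar> \<le> 2 * A * B"
    if h: "mono_on {p..q} h" and hB: "\<And>x. x \<in> {p..q} \<Longrightarrow> \<bar>h x\<bar> \<le> B" for h
  proof -
    obtain c where c: "c \<in> {p..q}" and
      eq: "integral {p..q} (\<lambda>x. h x * f x) = h p * integral {p..c} f + h q * integral {c..q} f"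
      using second_mean_value_theorem[OF f pq, of h] h by (auto simp: monotone_on_def)
    have "\<bar>h p * integral {p..c} f\<bar> \<le> B * A" "\<bar>h q * integral {c..q} f\<bar> \<le> B * A"
      unfolding abs_mult using pq hB F[OF c] by (auto intro!: mult_mono order_trans[OF abs_ge_zero])
    moreover have "2 * A * B = B * A + B * A" by simp
    ultimately show ?thesis unfolding eq by linarith
  qed
  from g show ?thesis
  proof
    assume "antimono_on {p..q} g"
    then have "mono_on {p..q} (\<lambda>x. - g x)" by (auto simp: monotone_on_def)
    from *[OF this] gB show ?thesis by (simp add: integral_neg)
  qed (use * gB in blast)
qed

text \<open>Dividing and multiplying by \<open>\<phi>'\<close> leaves the exact derivative of \<open>sin \<phi>\<close>
  times a monotone factor.\<close>

lemma van_der_Corput_cos: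
  fixes \<phi> \<phi>' :: "real \<Rightarrow> real"
  assumes pq: "p \<le> q"
    and D: "\<And>x. x \<in> {p..q} \<Longrightarrow> (\<phi> has_real_derivative \<phi>' x) (at x within {p..q})"
    and mono: "mono_on {p..q} \<phi>'" and l: "\<mu> > 0"
    and lb: "(\<forall>x\<in>{p..q}. \<mu> \<le> \<phi>' x) \<or> (\<forall>x\<in>{p..q}. \<phi>' x \<le> - \<mu>)"
  shows "\<bar>integral {p..q} (\<lambda>x. cos (\<phi> x))\<bar> \<le> 4 / \<mu>"
proof -
  have FTC: "((\<lambda>x. \<phi>' x * cos (\<phi> x)) has_integral (sin (\<phi> d) - sin (\<phi> c))) {c..d}"
    if "c \<in> {p..q}" "d \<in> {p..q}" "c \<le> d" for c d
  proof (rule fundamental_theorem_of_calculus)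
    fix x assume x: "x \<in> {c..d}"
    have "((\<lambda>x. sin (\<phi> x)) has_real_derivative cos (\<phi> x) * \<phi>' x) (at x within {c..d})"
      using x that by (intro DERIV_chain2[OF DERIV_sin] DERIV_subset[OF D]) auto
    then show "((\<lambda>x. sin (\<phi> x)) has_vector_derivative \<phi>' x * cos (\<phi> x)) (at x within {c..d})"
      by (simp add: has_real_derivative_iff_has_vector_derivative mult.commute)
  qed fact
  have nz: "\<phi>' x \<noteq> 0" if "x \<in> {p..q}" for x using lb l that by fastforce
  have inv: "\<bar>inverse (\<phi>' x)\<bar> \<le> 1 / \<mu>" if "x \<in> {p..q}" for x
  proof -
    have "\<mu> \<le> \<bar>\<phi>' x\<bar>" using lb that by fastforce
    then show ?thesis using l by (simp add: abs_inverse inverse_eq_divide frac_le)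
  qed
  have "antimono_on {p..q} (\<lambda>x. inverse (\<phi>' x))"
  proof (rule monotone_onI)
    fix x y assume xy: "x \<in> {p..q}" "y \<in> {p..q}" "x \<le> y"
    then have "\<phi>' x \<le> \<phi>' y" using mono by (auto simp: monotone_on_def)
    moreover from lb have "0 < \<phi>' x \<or> \<phi>' y < 0" using xy l by fastforce
    ultimately show "inverse (\<phi>' x) \<ge> inverse (\<phi>' y)"
      by (auto intro: le_imp_inverse_le le_imp_inverse_le_neg)
  qed
  moreover have "\<bar>integral {p..c} (\<lambda>x. \<phi>' x * cos (\<phi> x))\<bar> \<le> 2 \<and> \<bar>integral {c..q} (\<lambda>x. \<phi>' x * cos (\<phi> x))\<bar> \<le> 2"
    if c: "c \<in> {p..q}" for c
  proof -
    have le2: "\<bar>sin u - sin v\<bar> \<le> 2" for u v :: real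
      using abs_sin_le_one[of u] abs_sin_le_one[of v] by linarith
    show ?thesis
      using integral_unique[OF FTC[of p c]] integral_unique[OF FTC[of c q]] c pq le2 by auto
  qed
  ultimately have "\<bar>integral {p..q} (\<lambda>x. inverse (\<phi>' x) * (\<phi>' x * cos (\<phi> x)))\<bar> \<le> 2 * 2 * (1 / \<mu>)"
    using FTC[of p q] pq inv
    by (intro second_mean_value_bound) (auto simp: has_integral_integrable)
  also have "integral {p..q} (\<lambda>x. inverse (\<phi>' x) * (\<phi>' x * cos (\<phi> x))) = integral {p..q} (\<lambda>x. cos (\<phi> x))"
    by (intro integral_cong) (use nz in auto)
  finally show ?thesis by simp
qed

text \<open>The bound \<open>4 / \<mu>\<close> holds on every subinterval and a decreasing amplitude
  is at most \<open>m p\<close>, so the second mean value theorem combines the two. The amplitude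
  enters the constant through its left-end value and not through a derivative.\<close>

lemma van_der_Corput_amplitude_cos:
  fixes \<phi> \<phi>' m :: "real \<Rightarrow> real"
  assumes pq: "p \<le> q"
    and D: "\<And>x. x \<in> {p..q} \<Longrightarrow> (\<phi> has_real_derivative \<phi>' x) (at x within {p..q})"
    and mono: "mono_on {p..q} \<phi>'" and l: "\<mu> > 0"
    and lb: "(\<forall>x\<in>{p..q}. \<mu> \<le> \<phi>' x) \<or> (\<forall>x\<in>{p..q}. \<phi>' x \<le> - \<mu>)"
    and m: "antimono_on {p..q} m" "\<And>x. x \<in> {p..q} \<Longrightarrow> 0 \<le> m x"
  shows "\<bar>integral {p..q} (\<lambda>x. m x * cos (\<phi> x))\<bar> \<le> 8 * m p / \<mu>"
proof -
  have sub: "\<bar>integral {c..d} (\<lambda>x. cos (\<phi> x))\<bar> \<le> 4 / \<mu>" if "c \<in> {p..q}" "d \<in> {p..q}" "c \<le> d" for c d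
    using that by (intro van_der_Corput_cos[of _ _ _ \<phi>'] DERIV_subset[OF D] l monotone_on_subset[OF mono])
      (use lb in auto)
  have cont: "continuous_on {p..q} \<phi>"
    using D by (meson DERIV_continuous continuous_on_eq_continuous_within)
  have "\<bar>integral {p..q} (\<lambda>x. m x * cos (\<phi> x))\<bar> \<le> 2 * (4 / \<mu>) * m p"
    using m pq sub
    by (intro second_mean_value_bound integrable_continuous_real continuous_intros cont)
       (auto simp: monotone_on_def)
  then show ?thesis by (simp add: field_simps)
qed

text \<open>The sine part is the cosine part for the phase shifted by pi/2, which has the same
  derivative; hence twice the constant of the real case.\<close>

lemma van_der_Corput_amplitude:
  fixes \<phi> \<phi>' m :: "real \<Rightarrow> real"
  assumes pq: "p \<le> q"
    and D: "\<And>x. x \<in> {p..q} \<Longrightarrow> (\<phi> has_real_derivative \<phi>' x) (at x within {p..q})"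
    and mono: "mono_on {p..q} \<phi>'" and l: "\<mu> > 0"
    and lb: "(\<forall>x\<in>{p..q}. \<mu> \<le> \<phi>' x) \<or> (\<forall>x\<in>{p..q}. \<phi>' x \<le> - \<mu>)"
    and m: "antimono_on {p..q} m" "\<And>x. x \<in> {p..q} \<Longrightarrow> 0 \<le> m x" "continuous_on {p..q} m"
  shows "norm (integral {p..q} (\<lambda>x. of_real (m x) * cis (\<phi> x))) \<le> 16 * m p / \<mu>"
proof -
  have cont: "continuous_on {p..q} \<phi>"
    using D by (meson DERIV_continuous continuous_on_eq_continuous_within)
  have int: "(\<lambda>x. of_real (m x) * cis (\<phi> x)) integrable_on {p..q}"
    by (intro integrable_continuous_real continuous_intros cont m)
  have "\<bar>integral {p..q} (\<lambda>x. m x * cos (\<phi> x))\<bar> \<le> 8 * m p / \<mu>"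
    by (intro van_der_Corput_amplitude_cos[of _ _ _ \<phi>'] assms)
  moreover have "\<bar>integral {p..q} (\<lambda>x. m x * cos (\<phi> x - pi/2))\<bar> \<le> 8 * m p / \<mu>"
  proof (intro van_der_Corput_amplitude_cos[of _ _ _ \<phi>'] assms)
    fix x assume "x \<in> {p..q}"
    from DERIV_diff[OF D[OF this] DERIV_const, of "pi/2"]
    show "((\<lambda>x. \<phi> x - pi / 2) has_real_derivative \<phi>' x) (at x within {p..q})" by simp
  qed
  moreover have "cos (\<phi> x - pi/2) = sin (\<phi> x)" for x by (simp add: cos_diff)
  moreover have "Re (integral {p..q} (\<lambda>x. of_real (m x) * cis (\<phi> x))) = integral {p..q} (\<lambda>x. m x * cos (\<phi> x))"
    using integral_linear[OF int bounded_linear_Re] by (simp add: o_def)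
  moreover have "Im (integral {p..q} (\<lambda>x. of_real (m x) * cis (\<phi> x))) = integral {p..q} (\<lambda>x. m x * sin (\<phi> x))"
    using integral_linear[OF int bounded_linear_Im] by (simp add: o_def)
  ultimately show ?thesis
    using cmod_le[of "integral {p..q} (\<lambda>x. of_real (m x) * cis (\<phi> x))"] by simp
qed

lemma van_der_Corput_Icc:
  fixes \<phi> \<phi>' m :: "real \<Rightarrow> real"
  assumes pq: "p \<le> q"
    and D: "\<And>x. x \<in> {p..q} \<Longrightarrow> (\<phi> has_real_derivative \<phi>' x) (at x within {p..q})"
    and mono: "mono_on {p..q} \<phi>'" and l: "\<mu> > 0"
    and lb: "(\<forall>x\<in>{p..q}. \<mu> \<le> \<phi>' x) \<or> (\<forall>x\<in>{p..q}. \<phi>' x \<le> - \<mu>)"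
    and m: "antimono_on {p..q} m" "\<And>x. x \<in> {p..q} \<Longrightarrow> 0 \<le> m x" "continuous_on {p..q} m"
  shows "norm (LINT x:{p..q}|lborel. of_real (m x) * cis (\<phi> x)) \<le> 16 * m p / \<mu>"
proof -
  have cont: "continuous_on {p..q} \<phi>"
    using D by (meson DERIV_continuous continuous_on_eq_continuous_within)
  have "set_integrable lborel {p..q} (\<lambda>x. of_real (m x) * cis (\<phi> x))"
    by (intro borel_integrable_atLeastAtMost' continuous_intros cont m)
  then show ?thesis
    using van_der_Corput_amplitude[OF assms] by (simp add: set_borel_integral_eq_integral)
qed

text \<open>The bound on \<open>{p..y}\<close> does not involve \<open>y\<close>, so it survives the
  limit; integrability identifies that limit with the integral over the half-line.\<close>

lemma van_der_Corput_Ici: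
  fixes \<phi> \<phi>' m :: "real \<Rightarrow> real"
  assumes D: "\<And>x. x \<in> {p..} \<Longrightarrow> (\<phi> has_real_derivative \<phi>' x) (at x within {p..})"
    and mono: "mono_on {p..} \<phi>'" and l: "\<mu> > 0"
    and lb: "(\<forall>x\<in>{p..}. \<mu> \<le> \<phi>' x) \<or> (\<forall>x\<in>{p..}. \<phi>' x \<le> - \<mu>)"
    and m: "antimono_on {p..} m" "\<And>x. x \<in> {p..} \<Longrightarrow> 0 \<le> m x" "continuous_on {p..} m"
    and int: "set_integrable lborel {p..} (\<lambda>x. of_real (m x) * cis (\<phi> x))"
  shows "norm (LINT x:{p..}|lborel. of_real (m x) * cis (\<phi> x)) \<le> 16 * m p / \<mu>"
proof -
  let ?f = "\<lambda>x. indicator {p..} x *\<^sub>R (complex_of_real (m x) * cis (\<phi> x))"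
  have "((\<lambda>y. norm (LINT x|lborel. indicator {..y} x *\<^sub>R ?f x)) \<longlongrightarrow> norm (LINT x|lborel. ?f x)) at_top"
    using int by (intro tendsto_norm tendsto_integral_at_top) (auto simp: set_integrable_def)
  moreover have "eventually (\<lambda>y. norm (LINT x|lborel. indicator {..y} x *\<^sub>R ?f x) \<le> 16 * m p / \<mu>) at_top"
    using eventually_ge_at_top[of p]
  proof eventually_elim
    case (elim y)
    have "(LINT x|lborel. indicator {..y} x *\<^sub>R ?f x) = (LINT x:{p..y}|lborel. of_real (m x) * cis (\<phi> x))"
      unfolding set_lebesgue_integral_def
      by (intro Bochner_Integration.integral_cong) (auto simp: indicator_def)
    moreover have "norm (LINT x:{p..y}|lborel. of_real (m x) * cis (\<phi> x)) \<le> 16 * m p / \<mu>"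
      by (intro van_der_Corput_Icc[of _ _ _ \<phi>'] DERIV_subset[OF D] elim l monotone_on_subset[OF mono]
        monotone_on_subset[OF m(1)] continuous_on_subset[OF m(3)] m(2)) (use lb in auto)
    ultimately show ?case by simp
  qed
  ultimately show ?thesis
    unfolding set_lebesgue_integral_def by (rule tendsto_upperbound) auto
qed

section \<open>The half-line integral, uniformly in time\<close>

text \<open>A class of amplitudes that contains the Gaussian-damped s^(-1/2) for every damping and
  is invariant under the dilations m(s) -> sqrt r m(r s). Constants proved for the whole class
  therefore depend neither on the damping nor on the scale.\<close>

definition amp :: "(real \<Rightarrow> real) \<Rightarrow> bool" where
  "amp m \<longleftrightarrow> antimono_on {0<..} m \<and> continuous_on {0<..} m \<and> (\<forall>s>0. 0 \<le> m s \<and> m s \<le> 1 / sqrt s)"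

lemma norm_LINT_near_zero:
  fixes f :: "real \<Rightarrow> complex"
  assumes int: "set_integrable lborel {0<..v} f" and v: "v > 0"
    and f: "\<And>s. s > 0 \<Longrightarrow> norm (f s) \<le> 1 / sqrt s"
  shows "norm (LINT s:{0<..v}|lborel. f s) \<le> 2 * sqrt v"
proof -
  have "((\<lambda>s. s powr (-1/2)) has_integral v powr (-1/2+1) / (-1/2+1)) {0..v}"
    by (rule has_integral_powr_from_0) (use v in auto)
  then have I: "((\<lambda>s. s powr (-1/2)) has_integral 2 * sqrt v) {0..v}"
    using v by (simp add: powr_half_sqrt mult.commute)
  have "ennreal (norm (LINT s:{0<..v}|lborel. f s)) \<le> (\<integral>\<^sup>+s. norm (indicator {0<..v} s *\<^sub>R f s) \<partial>lborel)"
    using int unfolding set_lebesgue_integral_def set_integrable_def by (rule integral_norm_bound_ennreal)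
  also have "\<dots> \<le> (\<integral>\<^sup>+s. indicator {0..v} s * ennreal (s powr (-1/2)) \<partial>lborel)"
    using f by (intro nn_integral_mono) (auto simp: indicator_def powr_minus_divide powr_half_sqrt)
  also have "\<dots> = (\<integral>\<^sup>+s. ennreal (s powr (-1/2)) * indicator {0..v} s \<partial>lborel)"
    by (simp add: mult.commute)
  also have "\<dots> = ennreal (2 * sqrt v)"
    by (rule nn_integral_has_integral_lebesgue'[OF _ I]) auto
  finally show ?thesis using v by simp
qed

lemma norm_LINT_split0:
  fixes f :: "real \<Rightarrow> complex"
  assumes "set_integrable lborel {0<..} f" "p > 0"
  shows "norm (LINT s:{0<..}|lborel. f s) \<le> norm (LINT s:{0<..p}|lborel. f s) + norm (LINT s:{p..}|lborel. f s)"
proof -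
  have "(LINT s:{0<..p} \<union> {p..}|lborel. f s) = (LINT s:{0<..p}|lborel. f s) + (LINT s:{p..}|lborel. f s)"
    by (intro set_integral_Un_AE AE_I'[of "{p}"] set_integrable_subset[OF assms(1)]) (use assms in auto)
  moreover have "{0<..p} \<union> {p..} = {0<..}" using assms by auto
  ultimately show ?thesis by (metis norm_triangle_ineq)
qed

lemma norm_LINT_split:
  fixes f :: "real \<Rightarrow> complex"
  assumes "set_integrable lborel {0<..} f" "p > 0" "p \<le> q"
  shows "norm (LINT s:{p..}|lborel. f s) \<le> norm (LINT s:{p..q}|lborel. f s) + norm (LINT s:{q..}|lborel. f s)"
proof -
  have "(LINT s:{p..q} \<union> {q..}|lborel. f s) = (LINT s:{p..q}|lborel. f s) + (LINT s:{q..}|lborel. f s)"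
    by (intro set_integral_Un_AE AE_I'[of "{q}"] set_integrable_subset[OF assms(1)]) (use assms in auto)
  moreover have "{p..q} \<union> {q..} = {p..}" using assms by auto
  ultimately show ?thesis by (metis norm_triangle_ineq)
qed

lemma norm_LINT_subset_Icc_le:
  fixes f :: "real \<Rightarrow> complex"
  assumes int: "set_integrable lborel A f" and A: "A \<subseteq> {p..q}" "p \<le> q"
    and B: "\<And>s. s \<in> A \<Longrightarrow> norm (f s) \<le> B" "0 \<le> B"
  shows "norm (LINT s:A|lborel. f s) \<le> B * (q - p)"
proof -
  have "norm (LINT s:A|lborel. f s) \<le> (LINT s|lborel. B * indicator {p..q} s)"
    unfolding set_lebesgue_integral_def
  proof (rule Bochner_Integration.integral_norm_bound_integral)
    show "integrable lborel (\<lambda>s. indicator A s *\<^sub>R f s)" using int by (simp add: set_integrable_def)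
    show "integrable lborel (\<lambda>s. B * indicator {p..q} s)"
      by (intro integrable_mult_right integrable_real_indicator) (auto simp: emeasure_lborel_Icc_eq)
  qed (use A B in \<open>auto simp: indicator_def\<close>)
  then show ?thesis using A by simp
qed

text \<open>For an exponent at most 1 the power lies below its tangent at 1, which is the weighted
  inequality between geometric and arithmetic mean; since \<open>s \<le> 1\<close>, the exponent
  \<open>b\<close> may first be lowered to \<open>min 1 b\<close>.\<close>

lemma one_minus_powr_ge:
  fixes s b :: real
  assumes "0 < s" "s \<le> 1" "b > 0"
  shows "min 1 b * (1 - s) \<le> 1 - s powr b"
proof -
  define \<beta> where "\<beta> = min 1 b"
  have \<beta>: "0 < \<beta>" "\<beta> \<le> 1" "\<beta> \<le> b" using assms by (auto simp: \<beta>_def)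
  have "s powr b \<le> s powr \<beta>" using \<beta> assms by (intro powr_mono') auto
  also have "s powr \<beta> * 1 powr (1 - \<beta>) \<le> \<beta> * s + (1 - \<beta>) * 1"
    using \<beta> assms by (intro Youngs_inequality_0) auto
  then have "s powr \<beta> \<le> \<beta> * s + (1 - \<beta>)" by simp
  finally show ?thesis by (simp add: \<beta>_def[symmetric] algebra_simps)
qed

text \<open>With \<open>b = a - 1\<close> this measures how fast the derivative of the model phase
  leaves its zero at 1. Beyond 1 the inversion u = 1/s reduces to the previous case; the cap at 1
  and the factor 1/2 pay for replacing 1 - 1/s by s - 1.\<close>

lemma abs_powr_minus_one_ge:
  fixes s b :: real
  assumes "0 < s" "b > 0"
  shows "min 1 b / 2 * min 1 \<bar>s - 1\<bar> \<le> \<bar>s powr b - 1\<bar>"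
proof (cases "s \<le> 1")
  case True
  have "min 1 b / 2 * min 1 \<bar>s - 1\<bar> \<le> min 1 b * (1 - s)"
    using True assms by (auto simp: min_def)
  also have "\<dots> \<le> 1 - s powr b" by (rule one_minus_powr_ge) (use assms True in auto)
  finally show ?thesis by linarith
next
  case False
  define u where "u = 1 / s"
  have u: "0 < u" "u \<le> 1" using False by (auto simp: u_def)
  have "min 1 \<bar>s - 1\<bar> / 2 \<le> 1 - u"
    using False mult_nonneg_nonneg[of "s - 1" "2 - s"] unfolding u_def
    by (cases "s \<le> 2") (auto simp: field_simps min_def)
  then have "min 1 b * (min 1 \<bar>s - 1\<bar> / 2) \<le> min 1 b * (1 - u)"
    using assms by (intro mult_left_mono) auto
  also have "\<dots> \<le> 1 - u powr b" by (rule one_minus_powr_ge) (use assms u in auto)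
  also have "\<dots> \<le> s powr b * (1 - u powr b)"
  proof -
    have "1 \<le> s powr b" using False assms by (simp add: ge_one_powr_ge_zero)
    moreover have "0 \<le> 1 - u powr b" using u assms by (simp add: powr_le1)
    ultimately show ?thesis by (metis mult_right_mono mult_1)
  qed
  also have "\<dots> = s powr b - 1"
    using False by (simp add: u_def powr_divide algebra_simps)
  also have "\<dots> \<le> \<bar>s powr b - 1\<bar>" by (rule abs_ge_self)
  finally show ?thesis by simp
qed

text \<open>This is the normal form of a phase whose two terms compete: its derivative L (s^(a-1) -
  1) is increasing and vanishes at 1 only. The constant is allowed to depend on \<open>a\<close>
  alone, since \<open>L\<close> and \<open>m\<close> will carry the space, time and damping
  parameters.\<close>

lemma osc_model:
  fixes a :: real
  assumes a: "a > 1"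
  obtains C where "C > 0" and "\<And>L m. L > 0 \<Longrightarrow> amp m \<Longrightarrow>
    set_integrable lborel {0<..} (\<lambda>s. of_real (m s) * cis (L * (s powr a / a - s))) \<Longrightarrow>
    norm (LINT s:{0<..}|lborel. of_real (m s) * cis (L * (s powr a / a - s))) \<le> C / sqrt L"
proof
  define c where "c = min 1 (a - 1) / 2"
  have c: "c > 0" using a by (auto simp: c_def)
  \<comment> \<open>The 6 is 2 + 4 from the trivial bounds near 0 and near 1, and 80 is 32 + 32 + 16
    from the three van der Corput pieces for \<open>L > 4\<close>. Small \<open>L\<close> leads to 6
    + 16 / c.\<close>
  show "6 + 80 / c > 0" using c by (simp add: add_pos_pos)
  fix L :: real and m assume L: "L > 0" and m: "amp m"
  define \<phi> where "\<phi> = (\<lambda>s. L * (s powr a / a - s))"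
  define \<phi>' where "\<phi>' = (\<lambda>s. L * (s powr (a - 1) - 1))"
  let ?f = "\<lambda>s. of_real (m s) * cis (\<phi> s)"
  assume "set_integrable lborel {0<..} (\<lambda>s. of_real (m s) * cis (L * (s powr a / a - s)))"
  then have int: "set_integrable lborel {0<..} ?f" by (simp add: \<phi>_def)
  have D: "(\<phi> has_real_derivative \<phi>' s) (at s within S)" if "s > 0" for s S
    unfolding \<phi>_def \<phi>'_def using that a
    by (auto intro!: derivative_eq_intros simp: field_simps)
  have mono: "mono_on {0<..} \<phi>'"
    using L a by (auto simp: monotone_on_def \<phi>'_def intro!: powr_mono2)
  have m0: "0 \<le> m s" and mle: "m s \<le> 1 / sqrt s" if "s > 0" for s
    using m that by (auto simp: amp_def)
  have anti: "antimono_on S m" and cont: "continuous_on S m" if "S \<subseteq> {0<..}" for S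
    using m that unfolding amp_def by (auto intro: monotone_on_subset continuous_on_subset)
  have lower: "L * (c * min 1 \<bar>s - 1\<bar>) \<le> \<bar>\<phi>' s\<bar>" if "s > 0" for s
    unfolding \<phi>'_def abs_mult using L abs_powr_minus_one_ge[of s "a - 1"] that a
    by (intro mult_mono) (auto simp: c_def)
  have pos: "\<phi>' s \<ge> 0" if "s \<ge> 1" for s
    using that L a by (simp add: \<phi>'_def ge_one_powr_ge_zero)
  have neg: "\<phi>' s \<le> 0" if "s \<le> 1" "s > 0" for s
    using that L a by (simp add: \<phi>'_def powr_le1 mult_le_0_iff)
  have near0: "norm (LINT s:{0<..v}|lborel. ?f s) \<le> 2 * sqrt v" if "v > 0" for v
    using that int mle m0
    by (intro norm_LINT_near_zero set_integrable_subset[OF int]) (auto simp: norm_mult)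
  have tail: "norm (LINT s:{p..}|lborel. ?f s) \<le> 16 * m p / (L * (c * r))"
    if "p > 1" "r > 0" "r \<le> 1" "r \<le> p - 1" for p r
  proof (rule van_der_Corput_Ici[of _ _ \<phi>'])
    show "(\<forall>s\<in>{p..}. L * (c * r) \<le> \<phi>' s) \<or> (\<forall>s\<in>{p..}. \<phi>' s \<le> - (L * (c * r)))"
    proof (intro disjI1 ballI)
      fix s assume s: "s \<in> {p..}"
      then have "L * (c * r) \<le> L * (c * min 1 \<bar>s - 1\<bar>)"
        using that c L by (intro mult_left_mono) auto
      also have "\<dots> \<le> \<phi>' s" using lower[of s] pos[of s] s that by auto
      finally show "L * (c * r) \<le> \<phi>' s" .
    qed
  qed (use that c L in \<open>auto intro!: D m0 anti cont monotone_on_subset[OF mono] set_integrable_subset[OF int]\<close>)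
  have left: "norm (LINT s:{p..q}|lborel. ?f s) \<le> 16 * m p / (L * (c * r))"
    if "p > 0" "p \<le> q" "r > 0" "r \<le> 1 - q" for p q r
  proof (rule van_der_Corput_Icc[of _ _ _ \<phi>'])
    show "(\<forall>s\<in>{p..q}. L * (c * r) \<le> \<phi>' s) \<or> (\<forall>s\<in>{p..q}. \<phi>' s \<le> - (L * (c * r)))"
    proof (intro disjI2 ballI)
      fix s assume s: "s \<in> {p..q}"
      then have "L * (c * r) \<le> L * (c * min 1 \<bar>s - 1\<bar>)"
        using that c L by (intro mult_left_mono) auto
      also have "\<dots> \<le> - \<phi>' s" using lower[of s] neg[of s] s that by auto
      finally show "\<phi>' s \<le> - (L * (c * r))" by simp
    qed
  qed (use that c L in \<open>auto intro!: D m0 anti cont monotone_on_subset[OF mono]\<close>)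
  have sq: "sqrt L > 0" "sqrt L * sqrt L = L" using L by auto
  text \<open>The phase is stationary only at \<open>s = 1\<close>; cutting at distance \<open>L\<^sup>-\<^sup>1\<^sup>/\<^sup>2\<close> from it balances the
    trivial bound inside against van der Corput outside.\<close>
  have "norm (LINT s:{0<..}|lborel. ?f s) \<le> (6 + 80 / c) / sqrt L"
  proof (cases "L \<le> 4")
    case True
    \<comment> \<open>For small \<open>L\<close> the stationary point can be swallowed by the
      trivial bound: integrating s^(-1/2) up to 8/L already gives the order L^(-1/2), and 8/L is at
      least 2, so the tail stays at distance 1 from the stationary point.\<close>
    define p where "p = 8 / L"
    have p: "p > 0" "p \<ge> 2" using L True by (auto simp: p_def field_simps)
    have "norm (LINT s:{0<..}|lborel. ?f s) \<le> 2 * sqrt p + 16 * m p / (L * (c * 1))"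
      using norm_LINT_split0[OF int p(1)] near0[OF p(1)] tail[of p 1] p by linarith
    also have "sqrt p \<le> 3 / sqrt L"
    proof -
      have "sqrt 8 \<le> 3" by (rule real_le_lsqrt) auto
      then show ?thesis using sq by (simp add: p_def real_sqrt_divide divide_right_mono)
    qed
    also have "16 * m p / (L * (c * 1)) \<le> 16 * sqrt L / (L * (c * 1))"
    proof -
      have "m p \<le> 1 / sqrt p" using mle p by auto
      also have "\<dots> = sqrt L / sqrt 8" using L by (simp add: p_def real_sqrt_divide)
      also have "\<dots> \<le> sqrt L / 1" by (intro divide_left_mono) (use L in auto)
      finally show ?thesis using L c by (intro divide_right_mono) auto
    qed
    also have "16 * sqrt L / (L * (c * 1)) = 16 / c / sqrt L"
      using L c sq by (simp add: field_simps)
    also have "2 * (3 / sqrt L) + 16 / c / sqrt L \<le> (6 + 80 / c) / sqrt L"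
      using sq c by (simp add: add_divide_distrib divide_right_mono)
    finally show ?thesis by simp
  next
    case False
    define \<delta> where "\<delta> = 1 / sqrt L"
    have s2: "sqrt L > 2" using False by (simp add: real_less_rsqrt)
    have d: "0 < \<delta>" "\<delta> < 1/2" using s2 L by (simp_all add: \<delta>_def divide_less_eq)
    have p1: "1 / L > 0" "1 / L \<le> 1/2" using False by (auto simp: field_simps)
    \<comment> \<open>The cuts are 1/L, 1/2, 1 - \<open>\<delta>\<close> and 1 +
      \<open>\<delta>\<close>. At 1/L the trivial bound \<open>2 * sqrt (1 / L)\<close> balances an
      amplitude of at most \<open>sqrt L\<close> over a derivative of order \<open>L\<close>; the
      cut at 1/2 separates the large amplitude near 0 from the small derivative near 1.\<close>
    have "norm (LINT s:{0<..}|lborel. ?f s) \<le> 2 * sqrt (1 / L) + 16 * m (1 / L) / (L * (c * (1/2)))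
        + 16 * m (1/2) / (L * (c * \<delta>)) + norm (LINT s:{1-\<delta>..1+\<delta>}|lborel. ?f s) + 16 * m (1+\<delta>) / (L * (c * \<delta>))"
      using norm_LINT_split0[OF int p1(1)] near0[OF p1(1)] norm_LINT_split[OF int p1] left[OF p1, of "1/2"]
        norm_LINT_split[OF int, of "1/2" "1-\<delta>"] left[of "1/2" "1-\<delta>" \<delta>] d
        norm_LINT_split[OF int, of "1-\<delta>" "1+\<delta>"] tail[of "1+\<delta>" \<delta>]
      by linarith
    also have "norm (LINT s:{1-\<delta>..1+\<delta>}|lborel. ?f s) \<le> 2 * ((1 + \<delta>) - (1 - \<delta>))"
    proof (rule norm_LINT_subset_Icc_le)
      fix s assume s: "s \<in> {1-\<delta>..1+\<delta>}"
      have "sqrt s \<ge> 1/2" using s d by (intro real_le_rsqrt) (auto simp: power2_eq_square)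
      moreover have "sqrt s > 0" using s d by auto
      ultimately have "1 / sqrt s \<le> 2" by (simp add: field_simps)
      with mle[of s] m0[of s] s d show "norm (?f s) \<le> 2" by (auto simp: norm_mult)
    qed (use d in \<open>auto intro: set_integrable_subset[OF int]\<close>)
    also have "2 * ((1 + \<delta>) - (1 - \<delta>)) = 4 / sqrt L" by (simp add: \<delta>_def)
    also have "2 * sqrt (1 / L) = 2 / sqrt L" by (simp add: real_sqrt_divide)
    also have "16 * m (1 / L) / (L * (c * (1/2))) \<le> 16 * sqrt L / (L * (c * (1/2)))"
      using mle[of "1 / L"] L c by (intro divide_right_mono) (auto simp: real_sqrt_divide)
    also have "16 * sqrt L / (L * (c * (1/2))) = 32 / c / sqrt L"
      using sq c by (simp add: field_simps)
    also have "16 * m (1/2) / (L * (c * \<delta>)) \<le> 16 * 2 / (L * (c * \<delta>))"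
    proof -
      have "sqrt (1/2) \<ge> 1/2" by (intro real_le_rsqrt) (auto simp: power2_eq_square)
      then have "1 / sqrt (1/2) \<le> 2" by (simp add: field_simps)
      with mle[of "1/2"] have "m (1/2) \<le> 2" by simp
      then show ?thesis using L c d by (intro divide_right_mono) auto
    qed
    also have "16 * 2 / (L * (c * \<delta>)) = 32 / c / sqrt L"
      using sq c by (simp add: field_simps \<delta>_def)
    also have "16 * m (1+\<delta>) / (L * (c * \<delta>)) \<le> 16 * 1 / (L * (c * \<delta>))"
    proof -
      have "1 / sqrt (1+\<delta>) \<le> 1" using d by (simp add: field_simps)
      moreover have "m (1+\<delta>) \<le> 1 / sqrt (1+\<delta>)" using mle d by simp
      ultimately have "m (1+\<delta>) \<le> 1" by linarith
      then show ?thesis using L c d by (intro divide_right_mono) auto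
    qed
    also have "16 * 1 / (L * (c * \<delta>)) = 16 / c / sqrt L"
      using sq c by (simp add: field_simps \<delta>_def)
    also have "2 / sqrt L + 32 / c / sqrt L + 32 / c / sqrt L + 4 / sqrt L + 16 / c / sqrt L = (6 + 80 / c) / sqrt L"
      by (simp add: add_divide_distrib)
    finally show ?thesis by simp
  qed
  then show "norm (LINT s:{0<..}|lborel. of_real (m s) * cis (L * (s powr a / a - s))) \<le> (6 + 80 / c) / sqrt L"
    by (simp add: \<phi>_def)
qed
lemma amp_scale:
  assumes m: "amp m" and r: "r > 0"
  shows "amp (\<lambda>s. sqrt r * m (r * s))"
  unfolding amp_def
proof (intro conjI allI impI)
  show "antimono_on {0<..} (\<lambda>s. sqrt r * m (r * s))"
  proof (rule monotone_onI)
    fix u v :: real assume uv: "u \<in> {0<..}" "v \<in> {0<..}" "u \<le> v"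
    have "antimono_on {0<..} m" using m by (simp add: amp_def)
    then have "m (r * v) \<le> m (r * u)"
      by (rule monotone_onD) (use uv r in auto)
    then show "sqrt r * m (r * u) \<ge> sqrt r * m (r * v)" using r by simp
  qed
  have "continuous_on {0<..} m" using m by (simp add: amp_def)
  then have "continuous_on {0<..} (\<lambda>s. m (r * s))"
    by (rule continuous_on_compose2) (use r in \<open>auto intro!: continuous_intros\<close>)
  then show "continuous_on {0<..} (\<lambda>s. sqrt r * m (r * s))"
    by (intro continuous_intros)
  fix s :: real assume s: "s > 0"
  with r have rs: "r * s > 0" by simp
  with m have *: "0 \<le> m (r * s)" "m (r * s) \<le> 1 / sqrt (r * s)" unfolding amp_def by blast+
  show "0 \<le> sqrt r * m (r * s)" using * r by simp
  have "sqrt r * m (r * s) \<le> sqrt r * (1 / sqrt (r * s))" using * r by (intro mult_left_mono) auto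
  also have "\<dots> = 1 / sqrt s" using r by (simp add: real_sqrt_mult)
  finally show "sqrt r * m (r * s) \<le> 1 / sqrt s" .
qed

lemma norm_LINT_amp_cis_uminus:
  "norm (LINT s:A|lborel. of_real (m s) * cis (- \<phi> s)) = norm (LINT s:A|lborel. of_real (m s) * cis (\<phi> s))"
proof -
  have "(LINT s:A|lborel. of_real (m s) * cis (- \<phi> s)) = cnj (LINT s:A|lborel. of_real (m s) * cis (\<phi> s))"
    unfolding set_lebesgue_integral_def
    by (simp flip: Bochner_Integration.integral_cnj add: cis_cnj)
  then show ?thesis by simp
qed

text \<open>Both terms of the phase increase, so its derivative is at least \<open>x\<close> and
  there is no stationary point. Cutting at 1/x balances the trivial bound 2 x^(-1/2) with van der
  Corput, whose amplitude there is at most sqrt x.\<close>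

lemma osc_monotone:
  assumes a: "a > 1" and x: "x > 0" and t: "t \<ge> 0" and m: "amp m"
    and int: "set_integrable lborel {0<..} (\<lambda>s. of_real (m s) * cis (x * s + t * s powr a))"
  shows "norm (LINT s:{0<..}|lborel. of_real (m s) * cis (x * s + t * s powr a)) \<le> 18 / sqrt x"
proof -
  let ?f = "\<lambda>s. of_real (m s) * cis (x * s + t * s powr a)"
  have "1 / x > 0" using x by simp
  then have gt: "s > 0" if "1 / x \<le> s" for s using that by (rule less_le_trans)
  then have sub: "{1/x..} \<subseteq> {0<..}" by auto
  have m0: "0 \<le> m s" and mle: "m s \<le> 1 / sqrt s" if "s > 0" for s
    using m that by (auto simp: amp_def)
  have anti: "antimono_on S m" and cont: "continuous_on S m" if "S \<subseteq> {0<..}" for S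
    using m that unfolding amp_def by (auto intro: monotone_on_subset continuous_on_subset)
  have "norm (LINT s:{0<..1/x}|lborel. ?f s) \<le> 2 * sqrt (1 / x)"
    using x mle m0
    by (intro norm_LINT_near_zero set_integrable_subset[OF int]) (auto simp: norm_mult)
  moreover have "norm (LINT s:{1/x..}|lborel. ?f s) \<le> 16 * m (1/x) / x"
  proof (rule van_der_Corput_Ici[of _ _ "\<lambda>s. x + t * (a * s powr (a - 1))"])
    fix s assume "s \<in> {1/x..}"
    then have "s > 0" using gt by simp
    then show "((\<lambda>s. x * s + t * s powr a) has_real_derivative x + t * (a * s powr (a - 1))) (at s within {1/x..})"
      by (auto intro!: derivative_eq_intros)
  next
    show "mono_on {1 / x..} (\<lambda>s. x + t * (a * s powr (a - 1)))"
    proof (rule monotone_onI)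
      fix r s assume "r \<in> {1/x..}" "r \<le> s"
      then have "r powr (a - 1) \<le> s powr (a - 1)" using a gt[of r] by (intro powr_mono2) auto
      then show "x + t * (a * r powr (a - 1)) \<le> x + t * (a * s powr (a - 1))"
        using t a by (intro add_left_mono mult_left_mono) auto
    qed
    show "(\<forall>s\<in>{1 / x..}. x \<le> x + t * (a * s powr (a - 1))) \<or> (\<forall>s\<in>{1 / x..}. x + t * (a * s powr (a - 1)) \<le> - x)"
      using t a by auto
  next
    from anti[OF sub] cont[OF sub] show "antimono_on {1/x..} m" "continuous_on {1/x..} m" by auto
    show "set_integrable lborel {1/x..} ?f" by (rule set_integrable_subset[OF int]) (use sub in auto)
    fix s assume "s \<in> {1/x..}"
    with sub m0 show "0 \<le> m s" by auto
  qed (use x in auto)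
  moreover have "16 * m (1/x) / x \<le> 16 / sqrt x"
  proof -
    have "m (1/x) \<le> sqrt x" using mle[of "1/x"] x by (simp add: real_sqrt_divide)
    then have "16 * m (1/x) / x \<le> 16 * sqrt x / x" using x by (intro divide_right_mono) auto
    also have "\<dots> = 16 / sqrt x" using x by (simp add: real_div_sqrt field_simps)
    finally show ?thesis .
  qed
  ultimately show ?thesis
    using norm_LINT_split0[OF int, of "1/x"] x by (simp add: real_sqrt_divide)
qed
text \<open>Conjugation changes the signs of \<open>x\<close> and \<open>t\<close> together, so
  \<open>t > 0\<close>, or \<open>t = 0\<close> with \<open>x > 0\<close>, may be assumed. Equal
  signs are the monotone case. For opposite signs a dilation by \<open>r\<close> produces the model
  phase with L = |x| r; the factor \<open>sqrt r\<close> from the substitution and the amplitude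
  cancels against that in C / sqrt L, and with it every dependence on \<open>t\<close>.\<close>

lemma osc_half_line:
  fixes a :: real
  assumes a: "a > 1"
  obtains C where "C > 0" and "\<And>x t m. x \<noteq> 0 \<Longrightarrow> amp m \<Longrightarrow>
    set_integrable lborel {0<..} (\<lambda>s. complex_of_real (m s)) \<Longrightarrow>
    norm (LINT s:{0<..}|lborel. of_real (m s) * cis (x * s + t * s powr a)) \<le> C / sqrt \<bar>x\<bar>"
proof -
  have cis_int: "set_integrable lborel {0<..} (\<lambda>s. of_real (m s) * cis (x * s + t * s powr a))"
    if "set_integrable lborel {0<..} (\<lambda>s. complex_of_real (m s))" for x t m
  proof (rule set_integrable_bound[OF that])
    have [measurable]: "cis \<in> borel_measurable borel"
      by (intro borel_measurable_continuous_onI continuous_intros)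
    have [measurable]: "(\<lambda>s. indicator {0<..} s *\<^sub>R complex_of_real (m s)) \<in> borel_measurable lborel"
      using that by (auto simp: set_integrable_def)
    have "(\<lambda>s. (indicator {0<..} s *\<^sub>R complex_of_real (m s)) * cis (x * s + t * s powr a)) \<in> borel_measurable lborel"
      by measurable
    then show "set_borel_measurable lborel {0<..} (\<lambda>s. of_real (m s) * cis (x * s + t * s powr a))"
      by (simp add: set_borel_measurable_def scaleR_conv_of_real mult.assoc)
  qed (auto simp: norm_mult)
  obtain C where C: "C > 0" and model: "\<And>L m. L > 0 \<Longrightarrow> amp m \<Longrightarrow>
    set_integrable lborel {0<..} (\<lambda>s. of_real (m s) * cis (L * (s powr a / a - s))) \<Longrightarrow>
    norm (LINT s:{0<..}|lborel. of_real (m s) * cis (L * (s powr a / a - s))) \<le> C / sqrt L"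
    by (rule osc_model[OF a], rule that)
  have pos: "norm (LINT s:{0<..}|lborel. of_real (m s) * cis (x * s + t * s powr a)) \<le> max C 18 / sqrt \<bar>x\<bar>"
    if x: "x \<noteq> 0" and t: "t > 0 \<or> t = 0 \<and> x > 0" and m: "amp m"
      and int: "set_integrable lborel {0<..} (\<lambda>s. complex_of_real (m s))" for x t m
  proof (cases "x > 0")
    case True
    have "norm (LINT s:{0<..}|lborel. of_real (m s) * cis (x * s + t * s powr a)) \<le> 18 / sqrt x"
      using t by (intro osc_monotone a True m cis_int int) auto
    also have "\<dots> \<le> max C 18 / sqrt \<bar>x\<bar>" using True by (simp add: divide_right_mono)
    finally show ?thesis .
  next
    case False
    with x t have x': "x < 0" and t': "t > 0" by auto
    \<comment> \<open>The stationary point of the phase, that is, the solution of a t r^(a-1) = |x|;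
      dilation by it moves the stationary point to 1.\<close>
    define r where "r = (\<bar>x\<bar> / (a * t)) powr (1 / (a - 1))"
    have r: "r > 0" using x' t' a by (simp add: r_def)
    have "r powr (a - 1) = \<bar>x\<bar> / (a * t)" using a x' t' by (simp add: r_def powr_powr)
    then have ra: "t * r powr a = \<bar>x\<bar> * r / a"
      using r a t' by (simp add: powr_diff field_simps)
    define L where "L = \<bar>x\<bar> * r"
    have L: "L > 0" using r x' by (simp add: L_def mult_neg_pos)
    have ph: "x * (r * s) + t * (r * s) powr a = L * (s powr a / a - s)" if "s > 0" for s
    proof -
      have "t * (r * s) powr a = (t * r powr a) * s powr a" using that r by (simp add: powr_mult)
      then show ?thesis unfolding ra L_def using x' by (simp add: algebra_simps)
    qed
    have ind: "indicat_real {0<..} (r * s) = indicat_real {0<..} s" for s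
      using r by (auto simp: indicator_def zero_less_mult_iff)
    let ?m = "\<lambda>s. sqrt r * m (r * s)"
    have int': "set_integrable lborel {0<..} (\<lambda>s. complex_of_real (?m s))"
    proof -
      have "integrable lborel (\<lambda>s. indicator {0<..} (0 + r * s) *\<^sub>R complex_of_real (m (0 + r * s)))"
        using int r by (intro lborel_integrable_real_affine) (auto simp: set_integrable_def)
      then have "integrable lborel (\<lambda>s. of_real (sqrt r) * (indicator {0<..} s *\<^sub>R complex_of_real (m (r * s))))"
        by (intro integrable_mult_right) (simp add: ind)
      also have "(\<lambda>s. of_real (sqrt r) * (indicator {0<..} s *\<^sub>R complex_of_real (m (r * s))))
          = (\<lambda>s. indicator {0<..} s *\<^sub>R complex_of_real (?m s))"
        by (auto simp: fun_eq_iff indicator_def)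
      finally show ?thesis unfolding set_integrable_def .
    qed
    have "(LINT s:{0<..}|lborel. of_real (m s) * cis (x * s + t * s powr a)) =
        r *\<^sub>R (LINT s:{0<..}|lborel. of_real (m (r * s)) * cis (x * (r * s) + t * (r * s) powr a))"
      unfolding set_lebesgue_integral_def
      using r by (subst lborel_integral_real_affine[of r _ 0]) (auto simp: ind)
    also have "(LINT s:{0<..}|lborel. of_real (m (r * s)) * cis (x * (r * s) + t * (r * s) powr a))
        = (LINT s:{0<..}|lborel. of_real (1 / sqrt r) * (of_real (?m s) * cis (L * (s powr a / a - s))))"
      using r by (intro set_lebesgue_integral_cong) (auto simp: ph)
    also have "\<dots> = of_real (1 / sqrt r) * (LINT s:{0<..}|lborel. of_real (?m s) * cis (L * (s powr a / a - s)))"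
      by (rule set_integral_mult_right)
    finally have eq: "(LINT s:{0<..}|lborel. of_real (m s) * cis (x * s + t * s powr a)) =
        r *\<^sub>R (of_real (1 / sqrt r) * (LINT s:{0<..}|lborel. of_real (?m s) * cis (L * (s powr a / a - s))))" .
    have "norm (r *\<^sub>R (complex_of_real (1 / sqrt r) * Z)) = sqrt r * norm Z" for Z
    proof -
      have "norm (r *\<^sub>R (complex_of_real (1 / sqrt r) * Z)) = (r / sqrt r) * norm Z"
        using r by (simp add: norm_mult norm_divide)
      then show ?thesis using r by (simp add: real_div_sqrt)
    qed
    then have "norm (LINT s:{0<..}|lborel. of_real (m s) * cis (x * s + t * s powr a)) =
        sqrt r * norm (LINT s:{0<..}|lborel. of_real (?m s) * cis (L * (s powr a / a - s)))"
      unfolding eq .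
    also have "\<dots> \<le> sqrt r * (C / sqrt L)"
    proof (intro mult_left_mono model L amp_scale m r)
      have "set_integrable lborel {0<..} (\<lambda>s. of_real (?m s) * cis ((- L) * s + (L / a) * s powr a))"
        by (rule cis_int[OF int'])
      then show "set_integrable lborel {0<..} (\<lambda>s. of_real (?m s) * cis (L * (s powr a / a - s)))"
        by (simp add: algebra_simps)
    qed (use r in auto)
    also have "\<dots> = C / sqrt \<bar>x\<bar>" using r by (simp add: L_def real_sqrt_mult)
    also have "\<dots> \<le> max C 18 / sqrt \<bar>x\<bar>" by (simp add: divide_right_mono)
    finally show ?thesis .
  qed
  show thesis
  proof (rule that)
    show "max C 18 > 0" by simp
    fix x t :: real and m assume H: "x \<noteq> 0" "amp m" "set_integrable lborel {0<..} (\<lambda>s. complex_of_real (m s))"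
    show "norm (LINT s:{0<..}|lborel. of_real (m s) * cis (x * s + t * s powr a)) \<le> max C 18 / sqrt \<bar>x\<bar>"
    proof (cases "t > 0 \<or> t = 0 \<and> x > 0")
      case False
      then have "- t > 0 \<or> - t = 0 \<and> - x > 0" using H by auto
      from pos[OF _ this H(2,3)] H(1) norm_LINT_amp_cis_uminus[of "{0<..}" m "\<lambda>s. x * s + t * s powr a"]
      show ?thesis by simp
    qed (use pos H in auto)
  qed
qed
lemma LINT_split_half_lines:
  fixes f :: "real \<Rightarrow> complex"
  assumes "integrable lborel f"
  shows "(LINT x|lborel. f x) = (LINT x:{0<..}|lborel. f x) + (LINT x:{0<..}|lborel. f (- x))"
proof -
  have si: "set_integrable lborel A f" if "A \<in> sets lborel" for A
    unfolding set_integrable_def using integrable_mult_indicator[OF that assms] .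
  have "(LINT x|lborel. f x) = (LINT x:{..<0} \<union> {0..}|lborel. f x)"
  proof -
    have "{..<0} \<union> {0..} = (UNIV :: real set)" by auto
    then show ?thesis by (simp add: set_lebesgue_integral_def)
  qed
  also have "\<dots> = (LINT x:{..<0}|lborel. f x) + (LINT x:{0..}|lborel. f x)"
    by (intro set_integral_Un si) auto
  also have "(LINT x:{0..}|lborel. f x) = (LINT x:{0<..}|lborel. f x)"
  proof (rule set_integral_null_delta[OF assms])
    have "sym_diff {0..} {0<..} = {0::real}" by auto
    then show "sym_diff {0..} {0<..} \<in> null_sets (lborel :: real measure)"
      by (simp only:) (rule finite_imp_null_set_lborel, simp)
  qed auto
  also have "(LINT x:{..<0}|lborel. f x) = (LINT x:{0<..}|lborel. f (- x))"
    unfolding set_lebesgue_integral_def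
    by (subst lborel_integral_real_affine[of "-1" _ 0]) (auto simp: indicator_def)
  finally show ?thesis by (simp add: add.commute)
qed

section \<open>The damped weight and the one-dimensional kernel bound\<close>

lemma integrable_gauss:
  fixes e :: real assumes "e > 0"
  shows "integrable lborel (\<lambda>x. exp (- e * x\<^sup>2))"
proof -
  have "integrable lborel (\<lambda>x. sqrt (pi / e) * normal_density 0 (sqrt (1 / (2 * e))) x)"
    by (intro integrable_mult_right integrable_normal_density) (use assms in auto)
  also have "(\<lambda>x. sqrt (pi / e) * normal_density 0 (sqrt (1 / (2 * e))) x) = (\<lambda>x. exp (- e * x\<^sup>2))"
    using assms by (auto simp: normal_density_def fun_eq_iff real_sqrt_divide field_simps)
  finally show ?thesis .
qed

text \<open>The Gaussian makes the critical |s|^(-1/2) integrable at infinity. The damping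
  \<open>e\<close> is removed only after the quadratic form has been estimated.\<close>

definition osc_amp :: "real \<Rightarrow> real \<Rightarrow> real" where
  "osc_amp e s = exp (- e * s\<^sup>2) / sqrt \<bar>s\<bar>"

lemma amp_osc_amp: "e > 0 \<Longrightarrow> amp (osc_amp e)"
  unfolding amp_def osc_amp_def
  by (auto simp: monotone_on_def intro!: continuous_intros frac_le divide_right_mono)

lemma osc_amp_measurable [measurable]: "osc_amp e \<in> borel_measurable borel"
  unfolding osc_amp_def by measurable

lemma set_integrable_osc_amp:
  assumes "e > 0"
  shows "set_integrable lborel {0<..} (osc_amp e)"
proof -
  have "((\<lambda>s::real. s powr (-1/2)) has_integral 1 powr (-1/2+1) / (-1/2+1)) {0..1}"
    by (rule has_integral_powr_from_0) auto
  then have "(\<lambda>s::real. s powr (-1/2)) absolutely_integrable_on {0..1}"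
    by (intro nonnegative_absolutely_integrable_1) (auto simp: has_integral_integrable)
  then have "integrable lborel (\<lambda>s::real. indicator {0..1} s *\<^sub>R (s powr (-1/2)))"
    unfolding set_integrable_def by (subst (asm) integrable_completion) auto
  then have "integrable lborel (\<lambda>s::real. indicator {0..1} s *\<^sub>R (s powr (-1/2)) + exp (- e * s\<^sup>2))"
    using integrable_gauss[OF assms] by (rule Bochner_Integration.integrable_add)
  then show ?thesis unfolding set_integrable_def
  proof (rule Bochner_Integration.integrable_bound)
    have "norm (indicator {0<..} s *\<^sub>R osc_amp e s) \<le>
        norm (indicator {0..1} s *\<^sub>R (s powr (-1/2)) + exp (- e * s\<^sup>2))" for s
    proof (cases "0 < s \<and> s \<le> 1")
      case True
      have "exp (- e * s\<^sup>2) / sqrt s \<le> 1 / sqrt s" using True assms by (intro divide_right_mono) auto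
      then show ?thesis using True
        by (auto simp: osc_amp_def powr_minus_divide powr_half_sqrt abs_of_nonneg intro: order_trans)
    next
      case False
      have "exp (- e * s\<^sup>2) / sqrt s \<le> exp (- e * s\<^sup>2) / 1" if "s > 1"
        using that by (intro divide_left_mono) auto
      then show ?thesis using False by (auto simp: osc_amp_def indicator_def)
    qed
    then show "AE s in lborel. norm (indicator {0<..} s *\<^sub>R osc_amp e s) \<le>
        norm (indicator {0..1} s *\<^sub>R (s powr (-1/2)) + exp (- e * s\<^sup>2))" by simp
  qed auto
qed

lemma integrable_osc_amp:
  assumes "e > 0" shows "integrable lborel (osc_amp e)"
proof -
  have 1: "integrable lborel (\<lambda>s. indicator {0<..} s *\<^sub>R osc_amp e s)"
    using set_integrable_osc_amp[OF assms] by (simp add: set_integrable_def)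
  from lborel_integrable_real_affine[OF this, of "-1" 0]
  have "integrable lborel (\<lambda>s. indicator {0<..} s *\<^sub>R osc_amp e s + indicator {0<..} (- s) *\<^sub>R osc_amp e (- s))"
    using 1 by (intro Bochner_Integration.integrable_add) auto
  also have "(\<lambda>s. indicator {0<..} s *\<^sub>R osc_amp e s + indicator {0<..} (- s) *\<^sub>R osc_amp e (- s)) = osc_amp e"
    by (auto simp: fun_eq_iff indicator_def osc_amp_def)
  finally show ?thesis .
qed

lemma cis_measurable [measurable]: "cis \<in> borel_measurable borel"
  by (intro borel_measurable_continuous_onI continuous_intros)

lemma integrable_mult_cis:
  fixes f :: "'a \<Rightarrow> real"
  assumes "integrable M f" and [measurable]: "g \<in> borel_measurable M"
  shows "integrable M (\<lambda>x. of_real (f x) * cis (g x))"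
proof (rule Bochner_Integration.integrable_bound[OF assms(1)])
  have [measurable]: "f \<in> borel_measurable M" using assms by auto
  show "(\<lambda>x. of_real (f x) * cis (g x)) \<in> borel_measurable M" by measurable
qed (auto simp: norm_mult)

text \<open>The phase term |s|^a is even, so the negative half-line is the positive one with
  \<open>-x\<close> in place of \<open>x\<close>, and the constant doubles. The bound is that of the
  undamped, time-free integral, which is homogeneous of degree -1/2 in \<open>x\<close>.\<close>

theorem osc_kernel_bound:
  fixes a :: real
  assumes a: "a > 1"
  obtains C where "C > 0" and "\<And>x t e. x \<noteq> 0 \<Longrightarrow> e > 0 \<Longrightarrow>
    norm (LINT s|lborel. of_real (osc_amp e s) * cis (x * s + t * \<bar>s\<bar> powr a)) \<le> C / sqrt \<bar>x\<bar>"
proof -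
  obtain C where C: "C > 0" and half: "\<And>x t m. x \<noteq> 0 \<Longrightarrow> amp m \<Longrightarrow>
    set_integrable lborel {0<..} (\<lambda>s. complex_of_real (m s)) \<Longrightarrow>
    norm (LINT s:{0<..}|lborel. of_real (m s) * cis (x * s + t * s powr a)) \<le> C / sqrt \<bar>x\<bar>"
    by (rule osc_half_line[OF a], rule that)
  show thesis
  proof (rule that)
    show "2 * C > 0" using C by simp
    fix x t e :: real assume x: "x \<noteq> 0" and e: "e > 0"
    let ?f = "\<lambda>s. of_real (osc_amp e s) * cis (x * s + t * \<bar>s\<bar> powr a)"
    have si: "set_integrable lborel {0<..} (\<lambda>s. complex_of_real (osc_amp e s))"
    proof -
      have "integrable lborel (\<lambda>s. complex_of_real (indicator {0<..} s *\<^sub>R osc_amp e s))"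
        using set_integrable_osc_amp[OF e] unfolding set_integrable_def by (rule integrable_of_real)
      then show ?thesis by (simp add: set_integrable_def scaleR_conv_of_real)
    qed
    have "(LINT s|lborel. ?f s) = (LINT s:{0<..}|lborel. ?f s) + (LINT s:{0<..}|lborel. ?f (- s))"
      by (intro LINT_split_half_lines integrable_mult_cis integrable_osc_amp e) measurable
    moreover have "(LINT s:{0<..}|lborel. ?f s) = (LINT s:{0<..}|lborel. of_real (osc_amp e s) * cis (x * s + t * s powr a))"
      by (intro set_lebesgue_integral_cong) auto
    moreover have "(LINT s:{0<..}|lborel. ?f (- s)) = (LINT s:{0<..}|lborel. of_real (osc_amp e s) * cis ((- x) * s + t * s powr a))"
      by (intro set_lebesgue_integral_cong) (auto simp: osc_amp_def)
    ultimately show "norm (LINT s|lborel. ?f s) \<le> 2 * C / sqrt \<bar>x\<bar>"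
      using half[OF x amp_osc_amp[OF e] si, of t] half[of "- x", OF _ amp_osc_amp[OF e] si, of t] x
        norm_triangle_ineq[of "LINT s:{0<..}|lborel. ?f s" "LINT s:{0<..}|lborel. ?f (- s)"]
      by simp
  qed
qed

section \<open>The kernel as a rotated contour integral\<close>

text \<open>On the ray through \<open>e\<^sup>i\<^sup>\<pi>\<^sup>/\<^sup>(\<^sup>4\<^sup>a\<^sup>)\<close> the number \<open>i z\<^sup>a\<close> has argument \<open>3\<pi>/4\<close>, so \<open>exp (i z\<^sup>a)\<close> decays fast
  enough to make the integral entire in \<open>x\<close>, while \<open>Re (z\<^sup>2) > 0\<close> since \<open>a > 1\<close>.\<close>

definition rot :: "real \<Rightarrow> complex" where "rot a = cis (pi / (4 * a))"

text \<open>The variable \<open>r\<close> is the modulus of z = r \<open>rot a\<close>, so z^a is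
  r^a \<open>cis (pi/4)\<close> and can be written without a complex power. In this form the
  integral converges also for \<open>e = 0\<close>, when \<open>a > 1\<close>.\<close>

definition ray_integral :: "real \<Rightarrow> real \<Rightarrow> real \<Rightarrow> complex" where
  "ray_integral a e x = (LINT r:{0<..}|lborel. rot a *
     exp (\<i> * of_real (x * r) * rot a + \<i> * of_real (r powr a) * cis (pi/4) - of_real (e * r\<^sup>2) * (rot a)\<^sup>2))"

text \<open>The Fourier transform of the damped multiplier at time \<open>t\<close>; the opposite
  sign in the exponent makes no difference, as the function is even in \<open>x\<close>.\<close>

definition reg_kernel :: "real \<Rightarrow> real \<Rightarrow> real \<Rightarrow> real \<Rightarrow> complex" where
  "reg_kernel a e x t = (LINT s|lborel. of_real (exp (- e * s\<^sup>2)) * cis (x * s + t * \<bar>s\<bar> powr a))"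

text \<open>The holomorphic extension of the half-line integrand at time 1 to the right half-plane,
  with the principal branch of the power.\<close>

definition ray_phase :: "real \<Rightarrow> real \<Rightarrow> real \<Rightarrow> complex \<Rightarrow> complex" where
  "ray_phase a e x z = exp (\<i> * of_real x * z + \<i> * (z powr of_real a) - of_real e * z\<^sup>2)"

lemma integrable_exp_quadratic:
  fixes B c :: real assumes c: "c > 0"
  shows "integrable lborel (\<lambda>r. exp (B * r - c * r\<^sup>2))"
proof -
  have "integrable lborel (\<lambda>r. exp (B\<^sup>2 / (2*c)) * exp (- (c/2) * r\<^sup>2))"
    using c by (intro integrable_mult_right integrable_gauss) auto
  then show ?thesis
  proof (rule Bochner_Integration.integrable_bound)
    have "B * r - c * r\<^sup>2 \<le> B\<^sup>2 / (2*c) + - (c/2) * r\<^sup>2" for r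
    proof -
      have "0 \<le> (B - c * r)\<^sup>2 / (2*c)" using c by simp
      also have "\<dots> = B\<^sup>2 / (2*c) + - (c/2) * r\<^sup>2 - (B * r - c * r\<^sup>2)"
        using c by (simp add: power2_eq_square field_simps)
      finally show ?thesis by simp
    qed
    then show "AE r in lborel. norm (exp (B * r - c * r\<^sup>2)) \<le> norm (exp (B\<^sup>2 / (2*c)) * exp (- (c/2) * r\<^sup>2))"
      by (auto simp: exp_add[symmetric])
  qed auto
qed

lemma integrable_gauss_cis:
  assumes "e > 0" and [measurable]: "g \<in> borel_measurable borel"
  shows "integrable lborel (\<lambda>s. of_real (exp (- e * s\<^sup>2)) * cis (g s))"
  by (intro integrable_mult_cis integrable_gauss assms) auto

context
  fixes a :: real
  assumes a: "a > 1"
begin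

lemma rot_simps: "norm (rot a) = 1" "Re (rot a) = cos (pi/(4*a))" "Im (rot a) = sin (pi/(4*a))"
    "(rot a)\<^sup>2 = cis (pi / (2*a))"
  by (auto simp: rot_def power2_eq_square cis_mult)

lemma rot_angle: "0 < pi / (4 * a)" "pi / (4 * a) < pi / 4" "0 < pi / (2*a)" "pi / (2*a) < pi / 2"
  using a by (auto simp: field_simps)

lemma cos_rot_pos: "cos (pi / (4*a)) > 0" "sin (pi / (4*a)) > 0" "cos (pi / (2*a)) > 0"
  using rot_angle by (auto intro!: cos_gt_zero_pi sin_gt_zero)

text \<open>The real axis and the ray are joined by a chord. On it the argument of z lies between 0
  and pi/(4a), so z^a has nonnegative imaginary part and exp(i z^a) has modulus at most 1. Moreover
  Re z is at least and Im z at most its value at the end on the ray, which bounds Re(z^2) below by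
  r^2 cos(pi/(2a)). Thus the Gaussian alone controls the chord.\<close>

lemma norm_ray_phase_le:
  assumes r: "r > 0" and z: "z \<in> closed_segment (of_real r) (of_real r * rot a)" and e: "e \<ge> 0"
  shows "Re z > 0" "norm (ray_phase a e x z) \<le> exp (\<bar>x\<bar> * r - e * cos (pi/(2*a)) * r\<^sup>2)"
proof -
  let ?th = "pi / (4 * a)"
  obtain u where u: "0 \<le> u" "u \<le> 1" and z': "z = (1 - u) *\<^sub>R of_real r + u *\<^sub>R (of_real r * rot a)"
    using z by (auto simp: closed_segment_def)
  have Rez: "Re z = r * ((1 - u) + u * cos ?th)" and Imz: "Im z = r * (u * sin ?th)"
    by (simp_all add: z' rot_simps algebra_simps)
  have "(1 - u) + u * cos ?th \<ge> (1 - u) * cos ?th + u * cos ?th"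
    using u by (intro add_right_mono) (auto intro: mult_left_le)
  then have "(1 - u) + u * cos ?th \<ge> cos ?th" by (simp add: algebra_simps)
  then have Re_ge: "Re z \<ge> r * cos ?th" unfolding Rez using r by (intro mult_left_mono) auto
  moreover have rc: "r * cos ?th > 0" using r cos_rot_pos by simp
  ultimately show Re_pos: "Re z > 0" by linarith
  have Im0: "Im z \<ge> 0" unfolding Imz using u r cos_rot_pos by simp
  have "u * sin ?th \<le> sin ?th" using u cos_rot_pos by (simp add: mult_left_le_one_le)
  then have Im_le: "Im z \<le> r * sin ?th" unfolding Imz using r by (intro mult_left_mono) auto
  have "Re (\<i> * of_real x * z) = - x * Im z" by simp
  also have "\<dots> \<le> \<bar>x\<bar> * r"
  proof -
    have "- x * Im z \<le> \<bar>x\<bar> * Im z" using Im0 by (intro mult_right_mono) auto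
    also have "\<dots> \<le> \<bar>x\<bar> * r"
      using Im_le r by (intro mult_left_mono) (auto intro: order_trans[OF _ mult_left_le])
    finally show ?thesis .
  qed
  finally have 1: "Re (\<i> * of_real x * z) \<le> \<bar>x\<bar> * r" .
  have 2: "Re (\<i> * (z powr of_real a)) \<le> 0"
  proof -
    have z0: "z \<noteq> 0" using Re_pos by auto
    have "Im z / Re z \<le> tan ?th"
    proof -
      have "Im z / Re z \<le> (r * sin ?th) / (r * cos ?th)"
        using Im_le Re_ge rc Im0 r cos_rot_pos by (intro frac_le) auto
      then show ?thesis using r by (simp add: tan_def)
    qed
    then have "arctan (Im z / Re z) \<le> arctan (tan ?th)" by (rule arctan_monotone')
    also have "arctan (tan ?th) = ?th" using rot_angle by (intro arctan_tan) auto
    finally have A: "arctan (Im z / Re z) \<le> ?th" .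
    have A0: "arctan (Im z / Re z) \<ge> 0" using Im0 Re_pos by simp
    have "z powr of_real a = exp (of_real a * Ln z)" using z0 by (simp add: powr_def)
    then have "Im (z powr of_real a) = exp (a * Re (Ln z)) * sin (a * Im (Ln z))"
      by (simp add: exp_eq_polar Im_exp)
    moreover have "sin (a * Im (Ln z)) \<ge> 0"
    proof (rule sin_ge_zero)
      have Im: "Im (Ln z) = arctan (Im z / Re z)" using Im_Ln_eq[OF z0] Re_pos by simp
      show "0 \<le> a * Im (Ln z)" using A0 a Im by simp
      have "a * Im (Ln z) \<le> a * ?th" unfolding Im using A a by (intro mult_left_mono) auto
      also have "\<dots> \<le> pi" using a by simp
      finally show "a * Im (Ln z) \<le> pi" .
    qed
    ultimately show ?thesis by simp
  qed
  have 3: "Re (- (of_real e * z\<^sup>2)) \<le> - (e * cos (pi/(2*a)) * r\<^sup>2)"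
  proof -
    have "(r * cos ?th)\<^sup>2 \<le> (Re z)\<^sup>2" using Re_ge rc by (intro power_mono) auto
    moreover have "(Im z)\<^sup>2 \<le> (r * sin ?th)\<^sup>2" using Im_le Im0 by (intro power_mono) auto
    moreover have "(r * cos ?th)\<^sup>2 - (r * sin ?th)\<^sup>2 = cos (pi/(2*a)) * r\<^sup>2"
    proof -
      have "cos (pi/(2*a)) = (cos ?th)\<^sup>2 - (sin ?th)\<^sup>2" using cos_double[of ?th] by simp
      then show ?thesis by (simp only: power_mult_distrib) (simp add: algebra_simps)
    qed
    ultimately have "cos (pi/(2*a)) * r\<^sup>2 \<le> (Re z)\<^sup>2 - (Im z)\<^sup>2" by linarith
    then have "e * (cos (pi/(2*a)) * r\<^sup>2) \<le> e * ((Re z)\<^sup>2 - (Im z)\<^sup>2)" using e by (rule mult_left_mono)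
    then show ?thesis by (simp add: power2_eq_square mult.assoc)
  qed
  have "norm (ray_phase a e x z) = exp (Re (\<i> * of_real x * z) + Re (\<i> * (z powr of_real a)) + Re (- (of_real e * z\<^sup>2)))"
    unfolding ray_phase_def norm_exp_eq_Re by simp
  also have "\<dots> \<le> exp (\<bar>x\<bar> * r + 0 + - (e * cos (pi/(2*a)) * r\<^sup>2))"
    unfolding exp_le_cancel_iff using 1 2 3 by linarith
  finally show "norm (ray_phase a e x z) \<le> exp (\<bar>x\<bar> * r - e * cos (pi/(2*a)) * r\<^sup>2)" by simp
qed

lemma ray_phase_rot:
  assumes "r > 0"
  shows "ray_phase a e x (of_real r * rot a) =
    exp (\<i> * of_real (x * r) * rot a + \<i> * of_real (r powr a) * cis (pi/4) - of_real (e * r\<^sup>2) * (rot a)\<^sup>2)"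
proof -
  have "Ln (of_real r * rot a) = of_real (ln r) + \<i> * of_real (pi / (4*a))"
  proof (rule Ln_unique)
    show "exp (of_real (ln r) + \<i> * of_real (pi / (4*a))) = of_real r * rot a"
      using assms by (simp add: exp_add rot_def cis_conv_exp exp_of_real)
  qed (use rot_angle in \<open>auto intro: order.strict_trans\<close>)
  then have "(of_real r * rot a) powr of_real a = exp (of_real a * (of_real (ln r) + \<i> * of_real (pi / (4*a))))"
    using assms by (simp add: powr_def rot_def)
  also have "of_real a * (of_real (ln r) + \<i> * of_real (pi / (4*a))) = of_real (a * ln r) + \<i> * of_real (pi / 4)"
    using a by (simp add: algebra_simps)
  also have "exp \<dots> = of_real (r powr a) * cis (pi/4)"
    using assms by (simp add: exp_add cis_conv_exp exp_of_real powr_def del: of_real_mult)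
  finally show ?thesis
    by (simp add: ray_phase_def power_mult_distrib algebra_simps)
qed

lemma ray_phase_real:
  assumes "r > 0"
  shows "ray_phase a e x (of_real r) = of_real (exp (- e * r\<^sup>2)) * cis (x * r + r powr a)"
  using assms unfolding ray_phase_def cis_conv_exp
  by (simp add: powr_of_real exp_of_real[symmetric] mult_exp_exp algebra_simps)

lemma ray_phase_holomorphic: "ray_phase a e x holomorphic_on {z. 0 < Re z}"
  unfolding ray_phase_def by (intro holomorphic_intros) (auto simp: complex_nonpos_Reals_iff)

text \<open>Cauchy's theorem enters here: the half-plane is convex and the principal power is
  holomorphic on it.\<close>

lemma has_field_derivative_primitive:
  obtains \<Phi> where "\<And>z. Re z > 0 \<Longrightarrow> (\<Phi> has_field_derivative ray_phase a e x z) (at z)"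
proof -
  have op: "open {z. 0 < Re z}" by (rule open_halfspace_Re_gt)
  obtain \<Phi> where "\<And>z. z \<in> {z. 0 < Re z} \<Longrightarrow> (\<Phi> has_field_derivative ray_phase a e x z) (at z within {z. 0 < Re z})"
    using holomorphic_convex_primitive'[OF convex_halfspace_Re_gt op ray_phase_holomorphic] by metis
  then show thesis using that at_within_open[OF _ op] by auto
qed

text \<open>Let \<open>D r\<close> be the increment of a primitive along the chord at radius
  \<open>r\<close>. Its derivative is the difference of the two integrands, so the difference of the
  two integrals is the limit of \<open>D\<close> at infinity minus that at 0. Both limits vanish,
  because \<open>D r\<close> is at most the length of the chord times the bound for the integrand on
  it.\<close>

lemma ray_rotation:
  assumes e: "e > 0"
  shows "(LINT s:{0<..}|lborel. of_real (exp (- e * s\<^sup>2)) * cis (x * s + s powr a)) = ray_integral a e x"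
proof -
  define c where "c = e * cos (pi/(2*a))"
  have c: "c > 0" using e cos_rot_pos by (simp add: c_def)
  obtain \<Phi> where \<Phi>: "\<And>z. Re z > 0 \<Longrightarrow> (\<Phi> has_field_derivative ray_phase a e x z) (at z)"
    by (rule has_field_derivative_primitive[of e x], rule that)
  define F where "F = ray_phase a e x"
  define D where "D r = \<Phi> (of_real r * rot a) - \<Phi> (of_real r)" for r
  define h where "h r = rot a * F (of_real r * rot a) - F (of_real r)" for r
  have seg: "of_real r \<in> closed_segment (of_real r) (of_real r * rot a)"
    "of_real r * rot a \<in> closed_segment (of_real r) (of_real r * rot a)" for r by auto
  have Fle: "norm (F z) \<le> exp (\<bar>x\<bar> * r - c * r\<^sup>2)"
    if "r > 0" "z \<in> closed_segment (of_real r) (of_real r * rot a)" for r z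
    unfolding F_def c_def using norm_ray_phase_le(2)[OF that] e by simp
  have RePos: "Re z > 0"
    if "r > 0" "z \<in> closed_segment (of_real r) (of_real r * rot a)" for r z
    using norm_ray_phase_le(1)[OF that, of e] e by simp
  have Dle: "norm (D r) \<le> exp (\<bar>x\<bar> * r - c * r\<^sup>2) * (2 * r)" if r: "r > 0" for r
  proof -
    have "norm (D r) \<le> exp (\<bar>x\<bar> * r - c * r\<^sup>2) * norm (of_real r * rot a - of_real r)"
      unfolding D_def
    proof (rule field_differentiable_bound[OF convex_closed_segment _ _ seg(2) seg(1)])
      fix z assume z: "z \<in> closed_segment (of_real r) (of_real r * rot a)"
      show "(\<Phi> has_field_derivative F z) (at z within closed_segment (of_real r) (of_real r * rot a))"
        unfolding F_def by (rule has_field_derivative_at_within[OF \<Phi>[OF RePos[OF r z]]])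
      show "norm (F z) \<le> exp (\<bar>x\<bar> * r - c * r\<^sup>2)" by (rule Fle[OF r z])
    qed
    also have "norm (of_real r * rot a - of_real r) \<le> 2 * r"
      using norm_triangle_ineq4[of "of_real r * rot a" "of_real r"] r by (simp add: norm_mult rot_simps)
    finally show ?thesis by (simp add: mult_left_mono)
  qed
  have D': "(D has_vector_derivative h r) (at r within S)" if r: "r > 0" for r S
  proof -
    have "((\<lambda>r. \<Phi> (of_real r * w)) has_vector_derivative w * F (of_real r * w)) (at r)"
      if "Re (of_real r * w) > 0" for w
    proof -
      have 1: "((\<lambda>r. complex_of_real r * w) has_vector_derivative w) (at r)"
        by (auto intro!: derivative_eq_intros)
      show ?thesis
        using field_vector_diff_chain_at[OF 1 \<Phi>[OF that]] by (simp add: o_def F_def mult.commute)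
    qed
    from this[of "rot a"] this[of 1] RePos[OF r seg(2)] r
    have "(D has_vector_derivative h r) (at r)"
      unfolding D_def h_def by (auto intro!: derivative_eq_intros)
    then show ?thesis by (rule has_vector_derivative_at_within)
  qed
  have Fcont: "continuous_on {0<..} (\<lambda>r. F (of_real r * w))" if w: "\<And>r::real. r > 0 \<Longrightarrow> Re (of_real r * w) > 0" for w
    unfolding F_def
  proof (rule continuous_on_compose2[OF holomorphic_on_imp_continuous_on[OF ray_phase_holomorphic]])
    show "continuous_on {0<..} (\<lambda>r. complex_of_real r * w)" by (intro continuous_intros)
    show "(\<lambda>r. complex_of_real r * w) ` {0<..} \<subseteq> {z. 0 < Re z}" using w by blast
  qed
  have Fint: "set_integrable lborel {0<..} (\<lambda>r. F (of_real r * w))"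
    if "w = 1 \<or> w = rot a" for w
    unfolding set_integrable_def
  proof (rule Bochner_Integration.integrable_bound[OF integrable_exp_quadratic[OF c, of "\<bar>x\<bar>"]])
    have "Re (of_real r * w) > 0" if "r > 0" for r :: real
      using \<open>w = 1 \<or> w = rot a\<close> RePos[OF that seg(2)] that by (elim disjE) simp_all
    then have "(\<lambda>r. indicat_real {0<..} r *\<^sub>R F (of_real r * w)) \<in> borel_measurable borel"
      by (intro borel_measurable_continuous_on_indicator Fcont) auto
    then show "(\<lambda>r. indicat_real {0<..} r *\<^sub>R F (of_real r * w)) \<in> borel_measurable lborel" by simp
    show "AE r in lborel. norm (indicat_real {0<..} r *\<^sub>R F (of_real r * w)) \<le> norm (exp (\<bar>x\<bar> * r - c * r\<^sup>2))"
      using that Fle seg by (auto simp: indicator_def)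
  qed
  have hint: "set_integrable lborel {0<..} h"
    unfolding h_def using Fint[of 1] Fint[of "rot a"]
    by (intro set_integral_diff set_integrable_mult_right) auto
  have [measurable]: "(\<lambda>r. indicat_real {0<..} r *\<^sub>R h r) \<in> borel_measurable borel"
    using hint unfolding set_integrable_def by auto
  have "(\<lambda>n. LINT r|lborel. indicator {1/real (Suc n)..real (Suc n)} r *\<^sub>R (indicator {0<..} r *\<^sub>R h r))
      \<longlonglongrightarrow> (LINT r|lborel. indicator {0<..} r *\<^sub>R h r)"
  proof (rule integral_dominated_convergence)
    show "integrable lborel (\<lambda>r. norm (indicator {0<..} r *\<^sub>R h r))"
      using hint unfolding set_integrable_def by (rule integrable_norm)
    show "AE r in lborel. (\<lambda>n. indicator {1/real (Suc n)..real (Suc n)} r *\<^sub>R (indicator {0<..} r *\<^sub>R h r))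
       \<longlonglongrightarrow> indicator {0<..} r *\<^sub>R h r"
    proof (rule AE_I2)
      fix r :: real
      show "(\<lambda>n. indicator {1/real (Suc n)..real (Suc n)} r *\<^sub>R (indicator {0<..} r *\<^sub>R h r)) \<longlonglongrightarrow> indicator {0<..} r *\<^sub>R h r"
      proof (cases "r > 0")
        case True
        have "eventually (\<lambda>n. 1 / real (Suc n) < r) sequentially"
          using order_tendstoD(2)[OF lim_inverse_n' [THEN LIMSEQ_Suc] True] by (simp add: inverse_eq_divide)
        then have "eventually (\<lambda>n. 1 / real (Suc n) < r \<and> r \<le> real (Suc n)) sequentially"
        proof (rule eventually_conj)
          show "eventually (\<lambda>n. r \<le> real (Suc n)) sequentially"
          using filterlim_real_sequentially[THEN filterlim_at_top[THEN iffD1], rule_format, of r]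
          by (rule eventually_mono) simp
        qed
        then show ?thesis
          by (intro tendsto_eventually) (elim eventually_mono, simp add: indicator_def)
      qed auto
    qed
    fix n
    show "AE r in lborel. norm (indicator {1/real (Suc n)..real (Suc n)} r *\<^sub>R (indicator {0<..} r *\<^sub>R h r)) \<le> norm (indicator {0<..} r *\<^sub>R h r)"
      by (auto simp: indicator_def)
  qed measurable
  moreover have "(LINT r|lborel. indicator {1/real (Suc n)..real (Suc n)} r *\<^sub>R (indicator {0<..} r *\<^sub>R h r))
      = D (real (Suc n)) - D (1 / real (Suc n))" for n
  proof -
    have pos: "r > 0" if "1 / real (Suc n) \<le> r" for r using that by (rule less_le_trans[rotated]) simp
    have le: "1 / real (Suc n) \<le> real (Suc n)" by (simp add: field_simps)
    have "(h has_integral (D (real (Suc n)) - D (1 / real (Suc n)))) {1/real (Suc n)..real (Suc n)}"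
      by (rule fundamental_theorem_of_calculus[OF le]) (use D' pos in auto)
    moreover have "set_integrable lborel {1/real (Suc n)..real (Suc n)} h"
      by (rule set_integrable_subset[OF hint]) (use pos in auto)
    moreover have "(LINT r|lborel. indicator {1/real (Suc n)..real (Suc n)} r *\<^sub>R (indicator {0<..} r *\<^sub>R h r))
      = (LINT r:{1/real (Suc n)..real (Suc n)}|lborel. h r)"
      unfolding set_lebesgue_integral_def
      by (intro Bochner_Integration.integral_cong) (use pos in \<open>auto simp: indicator_def\<close>)
    ultimately show ?thesis
      by (simp add: set_borel_integral_eq_integral integral_unique)
  qed
  moreover have "(\<lambda>n. D (real (Suc n)) - D (1 / real (Suc n))) \<longlonglongrightarrow> 0 - 0"
  proof (intro tendsto_diff)
    have *: "((\<lambda>r::real. exp (\<bar>x\<bar> * r - c * r\<^sup>2) * (2 * r)) \<longlongrightarrow> 0) at_top"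
      using c by real_asymp
    have "filterlim (\<lambda>n. real (Suc n)) at_top sequentially"
      by (rule filterlim_compose[OF filterlim_real_sequentially filterlim_Suc])
    from filterlim_compose[OF * this] show "(\<lambda>n. D (real (Suc n))) \<longlonglongrightarrow> 0"
      by (rule Lim_null_comparison[rotated]) (intro always_eventually allI Dle, simp)
    have **: "((\<lambda>r::real. exp (\<bar>x\<bar> * r - c * r\<^sup>2) * (2 * r)) \<longlongrightarrow> exp (\<bar>x\<bar> * 0 - c * 0\<^sup>2) * (2 * 0)) (nhds 0)"
      by (intro tendsto_intros filterlim_ident)
    have "(\<lambda>n. 1 / real (Suc n)) \<longlonglongrightarrow> 0" by real_asymp
    from filterlim_compose[OF ** this]
    have "(\<lambda>n. exp (\<bar>x\<bar> * (1 / real (Suc n)) - c * (1 / real (Suc n))\<^sup>2) * (2 * (1 / real (Suc n)))) \<longlonglongrightarrow> 0" by simp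
    then show "(\<lambda>n. D (1 / real (Suc n))) \<longlonglongrightarrow> 0"
      by (rule Lim_null_comparison[rotated]) (intro always_eventually allI Dle, simp)
  qed
  ultimately have "(LINT r:{0<..}|lborel. h r) = 0"
    unfolding set_lebesgue_integral_def by (simp add: LIMSEQ_unique)
  moreover have "(LINT r:{0<..}|lborel. h r) = (LINT r:{0<..}|lborel. rot a * F (of_real r * rot a)) - (LINT r:{0<..}|lborel. F (of_real r))"
    unfolding h_def using Fint[of 1] Fint[of "rot a"]
    by (intro set_integral_diff set_integrable_mult_right) auto
  moreover have "(LINT r:{0<..}|lborel. rot a * F (of_real r * rot a)) = ray_integral a e x"
    unfolding ray_integral_def F_def by (intro set_lebesgue_integral_cong) (auto simp: ray_phase_rot)
  moreover have "(LINT r:{0<..}|lborel. F (of_real r)) = (LINT s:{0<..}|lborel. of_real (exp (- e * s\<^sup>2)) * cis (x * s + s powr a))"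
    unfolding F_def by (intro set_lebesgue_integral_cong) (auto simp: ray_phase_real)
  ultimately show ?thesis by simp
qed

lemma reg_kernel_one:
  assumes e: "e > 0"
  shows "reg_kernel a e x 1 = ray_integral a e x + ray_integral a e (- x)"
proof -
  let ?f = "\<lambda>s. of_real (exp (- e * s\<^sup>2)) * cis (x * s + 1 * \<bar>s\<bar> powr a)"
  have "reg_kernel a e x 1 = (LINT s:{0<..}|lborel. ?f s) + (LINT s:{0<..}|lborel. ?f (- s))"
    unfolding reg_kernel_def
    by (intro LINT_split_half_lines integrable_gauss_cis e) measurable
  also have "(LINT s:{0<..}|lborel. ?f s) = (LINT s:{0<..}|lborel. of_real (exp (- e * s\<^sup>2)) * cis (x * s + s powr a))"
    by (intro set_lebesgue_integral_cong) auto
  also have "(LINT s:{0<..}|lborel. ?f (- s)) = (LINT s:{0<..}|lborel. of_real (exp (- e * s\<^sup>2)) * cis ((- x) * s + s powr a))"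
    by (intro set_lebesgue_integral_cong) auto
  finally show ?thesis unfolding ray_rotation[OF e] .
qed

end

section \<open>The undamped ray integral: moments, derivatives and smoothness\<close>

lemma linear_minus_powr_bound:
  fixes a B k :: real
  assumes a: "a > 1" and k: "k > 0"
  obtains M where "\<And>r. r \<ge> 0 \<Longrightarrow> B * r - k * r powr a \<le> M - r"
proof
  \<comment> \<open>Beyond \<open>r0\<close> the factor k r^(a-1) exceeds |B| + 1, so the power
    beats the linear term with a unit slope to spare; this is where \<open>a > 1\<close>
    matters.\<close>
  define r0 where "r0 = ((\<bar>B\<bar> + 1) / k) powr (1 / (a - 1))"
  have r0: "r0 \<ge> 0" "r0 powr (a - 1) = (\<bar>B\<bar> + 1) / k" using a k by (auto simp: r0_def powr_powr)
  fix r :: real assume r: "r \<ge> 0"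
  show "B * r - k * r powr a \<le> (\<bar>B\<bar> + 1) * r0 - r"
  proof (cases "r \<le> r0")
    case True
    have "(B + 1) * r \<le> (\<bar>B\<bar> + 1) * r0" using True r by (intro mult_mono) auto
    moreover have "k * r powr a \<ge> 0" using k by simp
    ultimately show ?thesis by (simp add: algebra_simps)
  next
    case False
    have "(\<bar>B\<bar> + 1) / k \<le> r powr (a - 1)"
      using False r0 a by (metis less_eq_real_def not_le powr_mono2 diff_gt_0_iff_gt)
    then have "(\<bar>B\<bar> + 1) * r \<le> k * r powr (a - 1) * r"
      using k r by (intro mult_right_mono) (auto simp: field_simps)
    also have "\<dots> = k * r powr a" using False r0 by (simp add: powr_diff)
    finally have "(\<bar>B\<bar> + 1) * r \<le> k * r powr a" .
    moreover have "(B + 1) * r \<le> (\<bar>B\<bar> + 1) * r" using r by (intro mult_right_mono) auto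
    moreover have "(\<bar>B\<bar> + 1) * r0 \<ge> 0" using r0 by simp
    ultimately show ?thesis by (simp add: algebra_simps)
  qed
qed

lemma set_integrable_exp_neg: "set_integrable lborel {0<..} (\<lambda>r::real. exp (- r))"
proof -
  have "((\<lambda>r::real. exp (- 1 * r)) has_integral exp (- 1 * 0) / 1) {0..}"
    by (rule has_integral_exp_minus_to_infinity) auto
  then have "(\<lambda>r::real. exp (- r)) absolutely_integrable_on {0..}"
    by (intro nonnegative_absolutely_integrable_1) (auto simp: has_integral_integrable)
  then have "set_integrable lborel {0..} (\<lambda>r::real. exp (- r))"
    unfolding set_integrable_def by (subst (asm) integrable_completion) auto
  then show ?thesis by (rule set_integrable_subset) auto
qed

text \<open>The polynomial factor is at most \<open>fact m * exp r\<close>, which merely raises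
  \<open>B\<close> by 1.\<close>

lemma set_integrable_exp_powr:
  fixes a B k :: real
  assumes a: "a > 1" and k: "k > 0"
  shows "set_integrable lborel {0<..} (\<lambda>r. r ^ m * exp (B * r - k * r powr a))"
proof -
  obtain M where M: "\<And>r. r \<ge> 0 \<Longrightarrow> (B + 1) * r - k * r powr a \<le> M - r"
    by (rule linear_minus_powr_bound[OF a k, of "B + 1"], rule that)
  have "set_integrable lborel {0<..} (\<lambda>r. fact m * exp M * exp (- r))"
    using set_integrable_exp_neg by (rule set_integrable_mult_right)
  then show ?thesis
  proof (rule set_integrable_bound)
    show "set_borel_measurable lborel {0<..} (\<lambda>r. r ^ m * exp (B * r - k * r powr a))"
      unfolding set_borel_measurable_def by measurable
    have "norm (r ^ m * exp (B * r - k * r powr a)) \<le> norm (fact m * exp M * exp (- r))" if "r > 0" for r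
    proof -
      have "r ^ m / fact m \<le> exp r"
      proof -
        have "(\<Sum>n\<in>{m}. r ^ n /\<^sub>R fact n) \<le> (\<Sum>n. r ^ n /\<^sub>R fact n)"
          by (rule sum_le_suminf) (use that summable_exp_generic[of r] in auto)
        then show ?thesis by (simp add: exp_def field_simps)
      qed
      then have "r ^ m \<le> fact m * exp r" by (simp add: field_simps)
      then have "r ^ m * exp (B * r - k * r powr a) \<le> fact m * exp r * exp (B * r - k * r powr a)"
        by (rule mult_right_mono) auto
      also have "\<dots> = fact m * exp ((B + 1) * r - k * r powr a)"
        by (simp add: exp_add[symmetric] algebra_simps)
      also have "\<dots> \<le> fact m * exp (M - r)"
        using M[of r] that by (intro mult_left_mono) auto
      finally show ?thesis using that by (simp add: exp_diff exp_minus field_simps)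
    qed
    then show "AE r\<in>{0<..} in lborel. norm (r ^ m * exp (B * r - k * r powr a)) \<le> norm (fact m * exp M * exp (- r))"
      by auto
  qed
qed

lemma has_vector_derivative_quadratic_bound:
  fixes f :: "real \<Rightarrow> complex"
  assumes Q: "\<And>y. \<bar>y - x\<bar> \<le> 1 \<Longrightarrow> norm (f y - f x - of_real (y - x) * d) \<le> Q * (y - x)\<^sup>2"
  shows "(f has_vector_derivative d) (at x)"
  unfolding has_vector_derivative_def has_derivative_iff_norm
proof (intro conjI)
  have lim: "((\<lambda>y. Q * \<bar>y - x\<bar>) \<longlongrightarrow> 0) (at x)"
    by (auto intro!: tendsto_eq_intros)
  have ev: "eventually (\<lambda>y. \<bar>y - x\<bar> \<le> 1 \<and> y \<noteq> x) (at x)"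
    unfolding eventually_at by (intro exI[of _ 1]) (auto simp: dist_real_def)
  show "((\<lambda>y. norm (f y - f x - (y - x) *\<^sub>R d) / norm (y - x)) \<longlongrightarrow> 0) (at x)"
  proof (rule Lim_null_comparison[OF _ lim], rule eventually_mono[OF ev])
    fix y assume y: "\<bar>y - x\<bar> \<le> 1 \<and> y \<noteq> x"
    have "norm (f y - f x - (y - x) *\<^sub>R d) / \<bar>y - x\<bar> \<le> Q * (y - x)\<^sup>2 / \<bar>y - x\<bar>"
      using Q[of y] y by (intro divide_right_mono) (auto simp: scaleR_conv_of_real)
    also have "\<dots> = Q * \<bar>y - x\<bar>" using y by (simp add: power2_eq_square abs_if field_simps)
    finally show "norm (norm (f y - f x - (y - x) *\<^sub>R d) / norm (y - x)) \<le> Q * \<bar>y - x\<bar>" by simp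
  qed
qed (simp add: bounded_linear_scaleR_left)

text \<open>The \<open>m\<close>-th derivative in \<open>x\<close> of the undamped ray integral:
  each differentiation under the integral brings down one factor i r \<open>rot a\<close>.\<close>

definition ray_moment :: "real \<Rightarrow> nat \<Rightarrow> real \<Rightarrow> complex" where
  "ray_moment a m x = (LINT r:{0<..}|lborel. (\<i> * of_real r * rot a) ^ m *
     (rot a * exp (\<i> * of_real (x * r) * rot a + \<i> * of_real (r powr a) * cis (pi/4))))"

lemma norm_ray_exp_le:
  assumes a: "a > 1" and r: "r > 0"
  shows "norm (exp (\<i> * of_real (x * r) * rot a + \<i> * of_real (r powr a) * cis (pi/4)))
    \<le> exp (\<bar>x\<bar> * r - sin (pi/4) * r powr a)"
proof -
  have "- (x * r * sin (pi / (4 * a))) \<le> \<bar>x\<bar> * r"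
  proof -
    have "\<bar>x * r * sin (pi / (4 * a))\<bar> \<le> \<bar>x\<bar> * r * 1"
      unfolding abs_mult using r by (intro mult_mono) auto
    then show ?thesis by linarith
  qed
  then show ?thesis unfolding norm_exp_eq_Re by (simp add: rot_def mult.commute)
qed

lemma sin_pi4_pos: "sin (pi/4 :: real) > 0" by (rule sin_gt_zero) auto

lemma set_integrable_ray_moment:
  assumes a: "a > 1"
  shows "set_integrable lborel {0<..} (\<lambda>r. (\<i> * of_real r * rot a) ^ m *
     (rot a * exp (\<i> * of_real (x * r) * rot a + \<i> * of_real (r powr a) * cis (pi/4))))"
proof (rule set_integrable_bound[OF set_integrable_exp_powr[OF a sin_pi4_pos, of m "\<bar>x\<bar>"]])
  show "AE r\<in>{0<..} in lborel. norm ((\<i> * of_real r * rot a) ^ m *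
     (rot a * exp (\<i> * of_real (x * r) * rot a + \<i> * of_real (r powr a) * cis (pi/4))))
     \<le> norm (r ^ m * exp (\<bar>x\<bar> * r - sin (pi/4) * r powr a))"
    using norm_ray_exp_le[OF a] by (auto simp: norm_mult norm_power rot_simps[OF a] intro!: mult_left_mono)
qed (auto simp: set_borel_measurable_def)

text \<open>With z = i (y - x) r \<open>rot a\<close> the remainder of the difference quotient is
  the integrand times exp z - 1 - z, which is at most |z|^2 exp |z|. The decay exp(-c r^a) on the
  ray absorbs the additional powers and the additional exponential.\<close>

lemma ray_moment_deriv:
  assumes a: "a > 1"
  shows "(ray_moment a m has_vector_derivative ray_moment a (Suc m) x) (at x)"
proof (rule has_vector_derivative_quadratic_bound)
  define G where "G m x r = (\<i> * of_real r * rot a) ^ m *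
     (rot a * exp (\<i> * of_real (x * r) * rot a + \<i> * of_real (r powr a) * cis (pi/4)))" for m x r
  have int: "set_integrable lborel {0<..} (G m x)" for m x
    unfolding G_def by (rule set_integrable_ray_moment[OF a])
  \<comment> \<open>The second-order remainder costs two powers of \<open>r\<close>, and |y - x| at
    most 1 costs one unit in the linear exponent; so \<open>w\<close> does not depend on
    \<open>y\<close>.\<close>
  define w where "w r = r ^ (m + 2) * exp ((\<bar>x\<bar> + 1) * r - sin (pi/4) * r powr a)" for r
  have w: "set_integrable lborel {0<..} w"
    unfolding w_def by (rule set_integrable_exp_powr[OF a sin_pi4_pos])
  fix y assume y: "\<bar>y - x\<bar> \<le> 1"
  have "ray_moment a m y - ray_moment a m x - of_real (y - x) * ray_moment a (Suc m) x =
      (LINT r:{0<..}|lborel. G m y r - G m x r - of_real (y - x) * G (Suc m) x r)"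
    unfolding ray_moment_def G_def[symmetric]
    by (subst set_integral_diff set_integral_mult_right, simp_all add: int set_integral_diff set_integrable_mult_right)+
  also have "norm \<dots> \<le> (LINT r:{0<..}|lborel. norm (G m y r - G m x r - of_real (y - x) * G (Suc m) x r))"
    by (intro set_integral_norm_bound set_integral_diff set_integrable_mult_right int)
  also have "\<dots> \<le> (LINT r:{0<..}|lborel. (y - x)\<^sup>2 * w r)"
  proof (rule set_integral_mono)
    show "set_integrable lborel {0<..} (\<lambda>r. norm (G m y r - G m x r - of_real (y - x) * G (Suc m) x r))"
      by (intro set_integrable_norm set_integral_diff set_integrable_mult_right int)
    show "set_integrable lborel {0<..} (\<lambda>r. (y - x)\<^sup>2 * w r)"
      by (intro set_integrable_mult_right w)
    fix r :: real assume "r \<in> {0<..}"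
    then have r: "r > 0" by simp
    define z where "z = \<i> * of_real ((y - x) * r) * rot a"
    have nz: "norm z = \<bar>y - x\<bar> * r" using r by (simp add: z_def norm_mult rot_simps[OF a] flip: of_real_diff)
    have "exp (\<i> * of_real (y * r) * rot a + \<i> * of_real (r powr a) * cis (pi/4))
       = exp (\<i> * of_real (x * r) * rot a + \<i> * of_real (r powr a) * cis (pi/4)) * exp z"
      by (simp add: z_def exp_add[symmetric] algebra_simps)
    then have "G m y r - G m x r - of_real (y - x) * G (Suc m) x r = G m x r * (exp z - (\<Sum>i\<le>1. z ^ i / fact i))"
      by (simp add: G_def z_def algebra_simps)
    also have "norm \<dots> \<le> (r ^ m * exp (\<bar>x\<bar> * r - sin (pi/4) * r powr a)) * (exp (norm z) * norm z ^ Suc 1 / fact 1)"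
      unfolding norm_mult
    proof (intro mult_mono Taylor_exp_field)
      show "norm (G m x r) \<le> r ^ m * exp (\<bar>x\<bar> * r - sin (pi/4) * r powr a)"
        using norm_ray_exp_le[OF a r, of x] r
        by (auto simp: G_def norm_mult norm_power rot_simps[OF a] intro!: mult_left_mono)
    qed (use r in auto)
    also have "\<dots> = (y - x)\<^sup>2 * (r ^ (m + 2) * exp (\<bar>x\<bar> * r + \<bar>y - x\<bar> * r - sin (pi/4) * r powr a))"
    proof -
      have e1: "exp (\<bar>x\<bar> * r - sin (pi/4) * r powr a) * exp (norm z) = exp (\<bar>x\<bar> * r + \<bar>y - x\<bar> * r - sin (pi/4) * r powr a)"
        by (simp add: exp_add[symmetric] nz)
      have e2: "norm z ^ Suc 1 = (y - x)\<^sup>2 * r\<^sup>2" by (simp add: nz power_mult_distrib flip: power2_eq_square)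
      have assoc: "(r ^ m * E) * (E' * w / fact 1) = r ^ m * (E * E') * w" for E E' w :: real by simp
      show ?thesis unfolding assoc e1 e2 by (simp add: power_add power2_eq_square mult_ac)
    qed
    also have "\<dots> \<le> (y - x)\<^sup>2 * w r"
      unfolding w_def using y r
      by (intro mult_left_mono) (auto simp: algebra_simps intro!: mult_left_le_one_le)
    finally show "norm (G m y r - G m x r - of_real (y - x) * G (Suc m) x r) \<le> (y - x)\<^sup>2 * w r" .
  qed
  also have "\<dots> = (LINT r:{0<..}|lborel. w r) * (y - x)\<^sup>2"
    by (simp add: mult.commute)
  finally show "norm (ray_moment a m y - ray_moment a m x - of_real (y - x) * ray_moment a (Suc m) x)
    \<le> (LINT r:{0<..}|lborel. w r) * (y - x)\<^sup>2" .
qed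

text \<open>The two half-lines of the kernel at time 1 after the damping has been removed; this is
  the explicit candidate for \<open>osc_kernel a\<close>.\<close>

definition lim_kernel :: "real \<Rightarrow> real \<Rightarrow> complex" where
  "lim_kernel a x = ray_moment a 0 x + ray_moment a 0 (- x)"

text \<open>The only basis vector of the real line is 1, so a list of directions amounts to its
  length, and each derivative of the reflected term contributes a sign.\<close>

lemma iter_deriv_lim_kernel:
  assumes a: "a > 1" and bs: "set bs \<subseteq> Basis"
  shows "iter_deriv bs (lim_kernel a) = (\<lambda>x. ray_moment a (length bs) x + (-1) ^ length bs * ray_moment a (length bs) (- x))"
    and "iter_deriv bs (lim_kernel a) differentiable (at x)"
proof -
  have D: "((\<lambda>x. ray_moment a m x + (-1) ^ m * ray_moment a m (- x)) has_derivative
    (\<lambda>h. h *\<^sub>R (ray_moment a (Suc m) x + (-1) ^ Suc m * ray_moment a (Suc m) (- x)))) (at x)" for m x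
  proof -
    have neg: "((\<lambda>x::real. - x) has_vector_derivative - 1) (at x)"
      by (auto intro!: derivative_eq_intros)
    have "((\<lambda>x. ray_moment a m (- x)) has_vector_derivative - ray_moment a (Suc m) (- x)) (at x)"
      using vector_diff_chain_at[OF neg ray_moment_deriv[OF a]] by (simp add: o_def)
    then have "((\<lambda>x. ray_moment a m x + (-1) ^ m * ray_moment a m (- x)) has_vector_derivative
       ray_moment a (Suc m) x + (-1) ^ m * (- ray_moment a (Suc m) (- x))) (at x)"
      by (intro has_vector_derivative_add has_vector_derivative_mult_right ray_moment_deriv a)
    then show ?thesis by (simp add: has_vector_derivative_def)
  qed
  show *: "iter_deriv bs (lim_kernel a) = (\<lambda>x. ray_moment a (length bs) x + (-1) ^ length bs * ray_moment a (length bs) (- x))"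
    using bs
  proof (induction bs)
    case Nil
    then show ?case by (simp add: iter_deriv_def lim_kernel_def fun_eq_iff)
  next
    case (Cons b bs)
    then have b: "b = 1" and IH: "iter_deriv bs (lim_kernel a) =
      (\<lambda>x. ray_moment a (length bs) x + (-1) ^ length bs * ray_moment a (length bs) (- x))" by auto
    have "iter_deriv (b # bs) (lim_kernel a) = (\<lambda>x. frechet_derivative (iter_deriv bs (lim_kernel a)) (at x) 1)"
      by (simp add: iter_deriv_def b)
    also have "\<dots> = (\<lambda>x. ray_moment a (Suc (length bs)) x + (-1) ^ Suc (length bs) * ray_moment a (Suc (length bs)) (- x))"
      unfolding IH using frechet_derivative_at[OF D, symmetric] by (simp add: fun_eq_iff)
    finally show ?case by simp
  qed
  show "iter_deriv bs (lim_kernel a) differentiable (at x)"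
    unfolding * using D by (blast intro: differentiableI)
qed

lemma smooth_lim_kernel: "a > 1 \<Longrightarrow> smooth (lim_kernel a)"
  unfolding smooth_def using iter_deriv_lim_kernel(2) by blast

lemma ray_integral_zero: "ray_integral a 0 x = ray_moment a 0 x"
  by (simp add: ray_integral_def ray_moment_def)

text \<open>On the rotated ray the damping has modulus at most 1, since (rot a)^2 has positive real
  part, and the rest decays on its own; dominated convergence applies. On the real axis the undamped
  integrand has modulus 1 and admits no integrable majorant.\<close>

lemma ray_integral_tendsto:
  assumes a: "a > 1"
  shows "((\<lambda>e. ray_integral a e x) \<longlongrightarrow> ray_integral a 0 x) (at_right 0)"
  unfolding tendsto_at_iff_sequentially
proof (intro allI impI)
  fix X :: "nat \<Rightarrow> real" assume X: "\<forall>i. X i \<in> {0<..} - {0}" and X0: "X \<longlonglongrightarrow> 0"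
  let ?G = "\<lambda>e r. rot a * exp (\<i> * of_real (x * r) * rot a + \<i> * of_real (r powr a) * cis (pi/4) - of_real (e * r\<^sup>2) * (rot a)\<^sup>2)"
  have "(\<lambda>n. LINT r|lborel. indicator {0<..} r *\<^sub>R ?G (X n) r) \<longlonglongrightarrow> (LINT r|lborel. indicator {0<..} r *\<^sub>R ?G 0 r)"
  proof (rule integral_dominated_convergence)
    show "integrable lborel (\<lambda>r. indicator {0<..} r *\<^sub>R (r ^ 0 * exp (\<bar>x\<bar> * r - sin (pi/4) * r powr a)))"
      using set_integrable_exp_powr[OF a sin_pi4_pos] unfolding set_integrable_def .
    show "AE r in lborel. (\<lambda>n. indicator {0<..} r *\<^sub>R ?G (X n) r) \<longlonglongrightarrow> indicator {0<..} r *\<^sub>R ?G 0 r"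
      by (intro AE_I2 tendsto_intros X0)
    fix n
    have "norm (?G (X n) r) \<le> r ^ 0 * exp (\<bar>x\<bar> * r - sin (pi/4) * r powr a)" if r: "r > 0" for r
    proof -
      have "?G (X n) r = rot a * (exp (\<i> * of_real (x * r) * rot a + \<i> * of_real (r powr a) * cis (pi/4)) * exp (- (of_real (X n * r\<^sup>2) * (rot a)\<^sup>2)))"
        by (simp add: exp_add[symmetric])
      also have "norm \<dots> \<le> 1 * (exp (\<bar>x\<bar> * r - sin (pi/4) * r powr a) * 1)"
        unfolding norm_mult rot_simps(1)[OF a]
      proof (intro mult_mono norm_ray_exp_le[OF a r])
        have "X n * (r\<^sup>2 * cos (pi / (2*a))) \<ge> 0"
          using X[rule_format, of n] cos_rot_pos[OF a] by (intro mult_nonneg_nonneg) auto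
        then show "norm (exp (- (of_real (X n * r\<^sup>2) * (rot a)\<^sup>2))) \<le> 1"
          unfolding norm_exp_eq_Re rot_simps(4)[OF a] by (simp add: mult.assoc)
      qed auto
      finally show ?thesis by simp
    qed
    then show "AE r in lborel. norm (indicator {0<..} r *\<^sub>R ?G (X n) r)
       \<le> indicator {0<..} r *\<^sub>R (r ^ 0 * exp (\<bar>x\<bar> * r - sin (pi/4) * r powr a))"
      by (auto simp: indicator_def)
  qed measurable
  then show "((\<lambda>e. ray_integral a e x) \<circ> X) \<longlonglongrightarrow> ray_integral a 0 x"
    unfolding o_def ray_integral_def set_lebesgue_integral_def .
qed

lemma reg_kernel_tendsto:
  assumes a: "a > 1"
  shows "((\<lambda>e. reg_kernel a e x 1) \<longlongrightarrow> lim_kernel a x) (at_right 0)"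
proof -
  have "((\<lambda>e. ray_integral a e x + ray_integral a e (- x)) \<longlongrightarrow> lim_kernel a x) (at_right 0)"
    unfolding lim_kernel_def ray_integral_zero[symmetric] by (intro tendsto_add ray_integral_tendsto a)
  then show ?thesis
    by (rule Lim_transform_eventually) (auto simp: eventually_at_filter reg_kernel_one[OF a])
qed

section \<open>Polynomial growth, uniformly in the damping\<close>

text \<open>The power is the point beyond which s^(a-1) exceeds 2|x| + 1 and the phase has
  derivative at least 1; up to it the integral is bounded trivially, after it by the van der Corput
  constant 16. The factor 2 counts the half-lines.\<close>

definition kernel_growth :: "real \<Rightarrow> real \<Rightarrow> real" where
  "kernel_growth a x = 2 * ((2 * \<bar>x\<bar> + 1) powr (1 / (a - 1)) + 16)"

text \<open>This is estimated on the real axis: the modulus of the rotated integrand would only give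
  a bound exponential in a power of |x|, useless against Schwartz functions. Thus the contour yields
  smoothness and the real axis yields growth.\<close>

lemma norm_reg_half_kernel_le:
  assumes a: "a > 1" and e: "e > 0"
  shows "norm (LINT s:{0<..}|lborel. of_real (exp (- e * s\<^sup>2)) * cis (x * s + s powr a))
    \<le> (2 * \<bar>x\<bar> + 1) powr (1 / (a - 1)) + 16"
proof -
  let ?m = "\<lambda>s. exp (- e * s\<^sup>2)" and ?\<phi> = "\<lambda>s. x * s + s powr a"
  let ?f = "\<lambda>s. of_real (?m s) * cis (?\<phi> s)"
  define p where "p = (2 * \<bar>x\<bar> + 1) powr (1 / (a - 1))"
  have p: "p > 0" by (simp add: p_def)
  have pa: "p powr (a - 1) = 2 * \<bar>x\<bar> + 1" using a by (simp add: p_def powr_powr)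
  have "integrable lborel ?f" by (intro integrable_gauss_cis e) measurable
  then have int: "set_integrable lborel A ?f" if "A \<in> sets lborel" for A
    unfolding set_integrable_def using that by (rule integrable_mult_indicator[rotated])
  have int0: "set_integrable lborel {0<..} ?f" by (rule int) simp
  have "norm (LINT s:{0<..p}|lborel. ?f s) \<le> 1 * (p - 0)"
    using p e by (intro norm_LINT_subset_Icc_le int) (auto simp: norm_mult)
  moreover have "norm (LINT s:{p..}|lborel. ?f s) \<le> 16 * ?m p / 1"
  proof (rule van_der_Corput_Ici[of _ _ "\<lambda>s. x + a * s powr (a - 1)"])
    fix s assume "s \<in> {p..}"
    then show "(?\<phi> has_real_derivative x + a * s powr (a - 1)) (at s within {p..})"
      using p by (auto intro!: derivative_eq_intros)
  next
    have mono: "r powr (a - 1) \<le> s powr (a - 1)" if "p \<le> r" "r \<le> s" for r s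
      using a p that by (intro powr_mono2) auto
    then show "mono_on {p..} (\<lambda>s. x + a * s powr (a - 1))"
      using a by (auto simp: monotone_on_def)
    have "1 \<le> x + a * s powr (a - 1)" if "s \<ge> p" for s
    proof -
      have "2 * \<bar>x\<bar> + 1 \<le> s powr (a - 1)" using mono[of p s] that pa by simp
      moreover have "s powr (a - 1) \<le> a * s powr (a - 1)" using a mult_right_mono[of 1 a "s powr (a - 1)"] by simp
      ultimately show ?thesis by linarith
    qed
    then show "(\<forall>s\<in>{p..}. 1 \<le> x + a * s powr (a - 1)) \<or> (\<forall>s\<in>{p..}. x + a * s powr (a - 1) \<le> - 1)" by auto
  next
    show "antimono_on {p..} ?m" using e p by (auto simp: monotone_on_def intro!: power_mono)
    show "set_integrable lborel {p..} ?f" by (rule int) simp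
  qed (auto intro!: continuous_intros)
  moreover have "16 * ?m p / 1 \<le> 16" using e by simp
  ultimately show ?thesis
    using norm_LINT_split0[OF int0 p] unfolding p_def[symmetric] by argo
qed

lemma norm_reg_kernel_le:
  assumes a: "a > 1" and e: "e > 0"
  shows "norm (reg_kernel a e x 1) \<le> kernel_growth a x"
  unfolding reg_kernel_one[OF a e] ray_rotation[OF a e, symmetric] kernel_growth_def
  using norm_reg_half_kernel_le[OF a e, of x] norm_reg_half_kernel_le[OF a e, of "- x"]
  by (intro order_trans[OF norm_triangle_ineq]) simp

lemma norm_lim_kernel_le:
  assumes a: "a > 1"
  shows "norm (lim_kernel a x) \<le> kernel_growth a x"
  by (rule tendsto_upperbound[OF tendsto_norm[OF reg_kernel_tendsto[OF a, of x]]])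
     (auto simp: eventually_at_filter norm_reg_kernel_le[OF a])

lemma kernel_growth_le:
  obtains A N where "A \<ge> 0" "\<And>x. kernel_growth a x \<le> A * (1 + \<bar>x\<bar>) ^ N"
proof
  define N where "N = nat \<lceil>1 / (a - 1)\<rceil>"
  show "(2 * 2 ^ N + 32 :: real) \<ge> 0" by simp
  fix x :: real
  have gen: "2 * (p + 16) \<le> 2 * q + 32 * y" if "p \<le> q" "1 \<le> y" for p q y :: real
    using that mult_left_mono[of p q 2] mult_left_mono[of 1 y 32] by (simp add: distrib_left)
  have pos: "2 * (1 + \<bar>x\<bar>) > 0" by simp
  have "(2 * \<bar>x\<bar> + 1) powr (1 / (a - 1)) \<le> (2 * \<bar>x\<bar> + 1) powr (real N)"
    unfolding N_def by (rule powr_mono) (auto intro: real_nat_ceiling_ge)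
  also have "\<dots> \<le> (2 * (1 + \<bar>x\<bar>)) powr (real N)" by (rule powr_mono2) auto
  also have "\<dots> = 2 ^ N * (1 + \<bar>x\<bar>) ^ N" unfolding powr_realpow[OF pos] power_mult_distrib ..
  finally have "(2 * \<bar>x\<bar> + 1) powr (1 / (a - 1)) \<le> 2 ^ N * (1 + \<bar>x\<bar>) ^ N" .
  moreover have "(1 + \<bar>x\<bar>) ^ N \<ge> 1" by (rule one_le_power) simp
  ultimately have "2 * ((2 * \<bar>x\<bar> + 1) powr (1 / (a - 1)) + 16) \<le> 2 * (2 ^ N * (1 + \<bar>x\<bar>) ^ N) + 32 * (1 + \<bar>x\<bar>) ^ N"
    by (rule gen)
  then show "kernel_growth a x \<le> (2 * 2 ^ N + 32) * (1 + \<bar>x\<bar>) ^ N"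
    by (simp add: kernel_growth_def algebra_simps)
qed

section \<open>Gaussians as test functions\<close>

lemma integral_prod_Basis:
  fixes f :: "'a::euclidean_space \<Rightarrow> real \<Rightarrow> complex"
  assumes f: "\<And>b. b \<in> Basis \<Longrightarrow> integrable lborel (f b)"
  shows "integrable lborel (\<lambda>x::'a. \<Prod>b\<in>Basis. f b (x \<bullet> b))"
    and "(LINT x|lborel. (\<Prod>b\<in>Basis. f b ((x::'a) \<bullet> b))) = (\<Prod>b\<in>Basis. LINT s|lborel. f b s)"
proof -
  interpret product_sigma_finite "\<lambda>_::'a. lborel :: real measure" ..
  have [measurable]: "f b \<in> borel_measurable borel" if "b \<in> Basis" for b using f[OF that] by auto
  have coord: "(\<Sum>b\<in>Basis. g b *\<^sub>R b) \<bullet> b' = g b'" if "b' \<in> Basis" for g and b' :: 'a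
    using that by (simp add: inner_sum_left_Basis)
  have m: "(\<lambda>x::'a. \<Prod>b\<in>Basis. f b (x \<bullet> b)) \<in> borel_measurable borel" by measurable
  have m': "(\<lambda>g. \<Sum>b\<in>Basis. g b *\<^sub>R (b::'a)) \<in> measurable (Pi\<^sub>M Basis (\<lambda>b. lborel)) borel" by measurable
  have eq: "(\<Prod>b\<in>Basis. f b ((\<Sum>b\<in>Basis. g b *\<^sub>R b) \<bullet> b)) = (\<Prod>b\<in>Basis. f b (g b))" for g
    by (intro prod.cong) (auto simp: coord)
  show "integrable lborel (\<lambda>x::'a. \<Prod>b\<in>Basis. f b (x \<bullet> b))"
    unfolding lborel_eq[where 'a='a] integrable_distr_eq[OF m' m] eq
    by (rule product_integrable_prod) (auto intro: f)
  show "(LINT x|lborel. (\<Prod>b\<in>Basis. f b ((x::'a) \<bullet> b))) = (\<Prod>b\<in>Basis. LINT s|lborel. f b s)"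
    unfolding lborel_eq[where 'a='a] integral_distr[OF m' m] eq
    by (rule product_integral_prod) (auto intro: f)
qed

lemma nn_integral_prod_Basis:
  fixes f :: "'a::euclidean_space \<Rightarrow> real \<Rightarrow> ennreal"
  assumes f: "\<And>b. b \<in> Basis \<Longrightarrow> f b \<in> borel_measurable borel"
  shows "(\<integral>\<^sup>+x. (\<Prod>b\<in>Basis. f b ((x::'a) \<bullet> b)) \<partial>lborel) = (\<Prod>b\<in>Basis. \<integral>\<^sup>+s. f b s \<partial>lborel)"
proof -
  interpret product_sigma_finite "\<lambda>_::'a. lborel :: real measure" ..
  note f[measurable]
  have coord: "(\<Sum>b\<in>Basis. g b *\<^sub>R b) \<bullet> b' = g b'" if "b' \<in> Basis" for g and b' :: 'a
    using that by (simp add: inner_sum_left_Basis)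
  have m: "(\<lambda>x::'a. \<Prod>b\<in>Basis. f b (x \<bullet> b)) \<in> borel_measurable borel" by measurable
  have m': "(\<lambda>g. \<Sum>b\<in>Basis. g b *\<^sub>R (b::'a)) \<in> measurable (Pi\<^sub>M Basis (\<lambda>b. lborel)) borel" by measurable
  have eq: "(\<Prod>b\<in>Basis. f b ((\<Sum>b\<in>Basis. g b *\<^sub>R b) \<bullet> b)) = (\<Prod>b\<in>Basis. f b (g b))" for g
    by (intro prod.cong) (auto simp: coord)
  show ?thesis
  proof -
    have "(\<integral>\<^sup>+x. (\<Prod>b\<in>Basis. f b ((x::'a) \<bullet> b)) \<partial>lborel)
        = (\<integral>\<^sup>+g. (\<Prod>b\<in>Basis. f b ((\<Sum>b\<in>Basis. g b *\<^sub>R b) \<bullet> b)) \<partial>Pi\<^sub>M Basis (\<lambda>b. lborel))"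
      unfolding lborel_eq[where 'a='a] by (rule nn_integral_distr[OF m']) (use m in simp)
    also have "\<dots> = (\<Prod>b\<in>Basis. \<integral>\<^sup>+s. f b s \<partial>lborel)"
      unfolding eq by (rule product_nn_integral_prod) (auto intro: f)
    finally show ?thesis .
  qed
qed

lemma prod_Basis_vec: "(\<Prod>b\<in>Basis. f b) = (\<Prod>j\<in>UNIV. f (axis j 1 :: real ^ 'n))"
proof -
  have B: "(Basis :: (real ^ 'n) set) = range (\<lambda>j. axis j 1)"
    by (auto simp: Basis_vec_def)
  show ?thesis unfolding B by (subst prod.reindex) (auto simp: inj_def axis_eq_axis)
qed

lemma integral_prod_vec:
  fixes f :: "'n::finite \<Rightarrow> real \<Rightarrow> complex"
  assumes f: "\<And>j. integrable lborel (f j)"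
  shows "integrable lborel (\<lambda>x::real^'n. \<Prod>j\<in>UNIV. f j (x $ j))"
    and "(LINT x|lborel. (\<Prod>j\<in>UNIV. f j ((x::real^'n) $ j))) = (\<Prod>j\<in>UNIV. LINT s|lborel. f j s)"
proof -
  define g where "g b = f (THE j. b = axis j 1)" for b :: "real ^ 'n"
  have g: "g (axis j 1) = f j" for j by (simp add: g_def axis_eq_axis)
  have gi: "integrable lborel (g b)" for b unfolding g_def by (rule f)
  show "integrable lborel (\<lambda>x::real^'n. \<Prod>j\<in>UNIV. f j (x $ j))"
    using integral_prod_Basis(1)[of g, OF gi] by (simp add: prod_Basis_vec g inner_axis)
  show "(LINT x|lborel. (\<Prod>j\<in>UNIV. f j ((x::real^'n) $ j))) = (\<Prod>j\<in>UNIV. LINT s|lborel. f j s)"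
    using integral_prod_Basis(2)[of g, OF gi] by (simp add: prod_Basis_vec g inner_axis)
qed

lemma nn_integral_prod_vec:
  fixes f :: "'n::finite \<Rightarrow> real \<Rightarrow> ennreal"
  assumes f: "\<And>j. f j \<in> borel_measurable borel"
  shows "(\<integral>\<^sup>+x. (\<Prod>j\<in>UNIV. f j ((x::real^'n) $ j)) \<partial>lborel) = (\<Prod>j\<in>UNIV. \<integral>\<^sup>+s. f j s \<partial>lborel)"
proof -
  define g where "g b = f (THE j. b = axis j 1)" for b :: "real ^ 'n"
  have g: "g (axis j 1) = f j" for j by (simp add: g_def axis_eq_axis)
  have gi: "g b \<in> borel_measurable borel" for b unfolding g_def by (rule f)
  show ?thesis
    using nn_integral_prod_Basis[of g, OF gi] by (simp add: prod_Basis_vec g inner_axis)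
qed

text \<open>The scale \<open>k\<close> satisfies c k^2 = 1/2, which turns the integral into the
  characteristic function of the standard normal distribution.\<close>

lemma gauss_fourier_real:
  fixes c y :: real assumes c: "c > 0"
  shows "(LINT s|lborel. of_real (exp (- c * s\<^sup>2)) * cis (s * y)) = of_real (sqrt (pi / c) * exp (- y\<^sup>2 / (4 * c)))"
proof -
  define k where "k = 1 / sqrt (2 * c)"
  have k: "k > 0" "c * k\<^sup>2 = 1 / 2" using c by (auto simp: k_def power_divide)
  have "(LINT s|lborel. of_real (exp (- c * s\<^sup>2)) * cis (s * y)) =
      k *\<^sub>R (LINT s|lborel. of_real (exp (- s\<^sup>2 / 2)) * cis (s * (k * y)))"
  proof -
    have ks: "- c * (0 + k * s)\<^sup>2 = - s\<^sup>2 / 2" for s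
    proof -
      have "- c * (0 + k * s)\<^sup>2 = - (c * k\<^sup>2) * s\<^sup>2" by (simp add: power_mult_distrib)
      then show ?thesis using k by simp
    qed
    have ky: "(0 + k * s) * y = s * (k * y)" for s by simp
    have k0: "k \<noteq> 0" "\<bar>k\<bar> = k" using k by auto
    show ?thesis
      by (subst lborel_integral_real_affine[OF k0(1), of _ 0]) (simp only: ks ky k0(2))
  qed
  also have "(LINT s|lborel. of_real (exp (- s\<^sup>2 / 2)) * cis (s * (k * y))) =
      (LINT s|lborel. of_real (sqrt (2 * pi)) * (std_normal_density s *\<^sub>R iexp ((k * y) * s)))"
    by (intro Bochner_Integration.integral_cong) (auto simp: std_normal_density_def cis_conv_exp mult_ac scaleR_conv_of_real)
  also have "\<dots> = of_real (sqrt (2 * pi)) * (LINT s|lborel. std_normal_density s *\<^sub>R iexp ((k * y) * s))"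
    by (rule integral_mult_right_zero)
  also have "(LINT s|lborel. std_normal_density s *\<^sub>R iexp ((k * y) * s)) = char std_normal_distribution (k * y)"
    unfolding char_def by (subst integral_density) simp_all
  also have "k *\<^sub>R (of_real (sqrt (2 * pi)) * char std_normal_distribution (k * y)) = of_real (k * sqrt (2 * pi) * exp (- (k * y)\<^sup>2 / 2))"
    by (simp add: char_std_normal_distribution scaleR_conv_of_real)
  also have "k * sqrt (2 * pi) = sqrt (pi / c)"
    using c by (simp add: k_def real_sqrt_mult real_sqrt_divide)
  also have "- (k * y)\<^sup>2 / 2 = - y\<^sup>2 / (4 * c)"
    using c by (simp add: k_def power_mult_distrib power_divide)
  finally show ?thesis .
qed

lemma norm_sq_Basis: "(norm (x::'a::euclidean_space))\<^sup>2 = (\<Sum>b\<in>Basis. (x \<bullet> b)\<^sup>2)"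
  by (subst power2_norm_eq_inner, subst euclidean_inner) (simp add: power2_eq_square)

lemma cis_sum: "finite A \<Longrightarrow> cis (\<Sum>i\<in>A. f i) = (\<Prod>i\<in>A. cis (f i))"
  by (induction A rule: finite_induct) (auto simp flip: cis_mult)

lemma gauss_cis_prod:
  "of_real (exp (- c * (norm (x::'a::euclidean_space))\<^sup>2)) * cis (x \<bullet> y) =
    (\<Prod>b\<in>Basis. of_real (exp (- c * (x \<bullet> b)\<^sup>2)) * cis ((x \<bullet> b) * (y \<bullet> b)))"
proof -
  have "exp (- c * (norm x)\<^sup>2) = (\<Prod>b\<in>Basis. exp (- c * (x \<bullet> b)\<^sup>2))"
    unfolding norm_sq_Basis sum_distrib_left by (rule exp_sum) simp
  moreover have "cis (x \<bullet> y) = (\<Prod>b\<in>Basis. cis ((x \<bullet> b) * (y \<bullet> b)))"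
    unfolding euclidean_inner[of x y] by (rule cis_sum) simp
  ultimately show ?thesis by (simp add: prod.distrib)
qed

lemma gauss_fourier:
  fixes y :: "'a::euclidean_space" assumes c: "c > 0"
  shows "integrable lborel (\<lambda>x. of_real (exp (- c * (norm x)\<^sup>2)) * cis (x \<bullet> y))"
    and "(LINT x|lborel. of_real (exp (- c * (norm x)\<^sup>2)) * cis (x \<bullet> y))
      = of_real (sqrt (pi / c) ^ DIM('a) * exp (- (norm y)\<^sup>2 / (4 * c)))"
proof -
  have int: "integrable lborel (\<lambda>s. of_real (exp (- c * s\<^sup>2)) * cis (s * (y \<bullet> b)))" for b
    by (intro integrable_mult_cis integrable_gauss c) measurable
  show "integrable lborel (\<lambda>x. of_real (exp (- c * (norm x)\<^sup>2)) * cis (x \<bullet> y))"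
    unfolding gauss_cis_prod by (rule integral_prod_Basis(1)) (rule int)
  have "(LINT x|lborel. of_real (exp (- c * (norm x)\<^sup>2)) * cis (x \<bullet> y))
      = (\<Prod>b\<in>Basis. LINT s|lborel. of_real (exp (- c * s\<^sup>2)) * cis (s * (y \<bullet> b)))"
    unfolding gauss_cis_prod by (rule integral_prod_Basis(2)) (rule int)
  also have "\<dots> = of_real (\<Prod>b\<in>(Basis::'a set). sqrt (pi / c) * exp (- (y \<bullet> b)\<^sup>2 / (4 * c)))"
    unfolding gauss_fourier_real[OF c] by simp
  also have "(\<Prod>b\<in>(Basis::'a set). sqrt (pi / c) * exp (- (y \<bullet> b)\<^sup>2 / (4 * c)))
      = sqrt (pi / c) ^ DIM('a) * exp (\<Sum>b\<in>(Basis::'a set). - (y \<bullet> b)\<^sup>2 / (4 * c))"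
    by (simp add: prod.distrib exp_sum)
  also have "(\<Sum>b\<in>(Basis::'a set). - (y \<bullet> b)\<^sup>2 / (4 * c)) = - (norm y)\<^sup>2 / (4 * c)"
    unfolding norm_sq_Basis by (simp add: sum_negf sum_divide_distrib)
  finally show "(LINT x|lborel. of_real (exp (- c * (norm x)\<^sup>2)) * cis (x \<bullet> y))
      = of_real (sqrt (pi / c) ^ DIM('a) * exp (- (norm y)\<^sup>2 / (4 * c)))" .
qed

lemma gauss_integral:
  assumes c: "c > 0"
  shows "integrable lborel (\<lambda>x::'a::euclidean_space. exp (- c * (norm x)\<^sup>2))"
    and "(LINT x|lborel. exp (- c * (norm (x::'a))\<^sup>2)) = sqrt (pi / c) ^ DIM('a)"
proof -
  have 1: "integrable lborel (\<lambda>x::'a. complex_of_real (exp (- c * (norm x)\<^sup>2)))"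
    using gauss_fourier(1)[OF c, of "0::'a"] by simp
  have "complex_of_real (LINT x|lborel. exp (- c * (norm (x::'a))\<^sup>2)) = of_real (sqrt (pi / c) ^ DIM('a))"
    using gauss_fourier(2)[OF c, of "0::'a"] by simp
  then show "(LINT x|lborel. exp (- c * (norm (x::'a))\<^sup>2)) = sqrt (pi / c) ^ DIM('a)"
    unfolding of_real_eq_iff .
  show "integrable lborel (\<lambda>x::'a. exp (- c * (norm x)\<^sup>2))" using integrable_Re[OF 1] by simp
qed

lemma lborel_integral_affine:
  fixes f :: "'a::euclidean_space \<Rightarrow> 'b::{banach, second_countable_topology}"
  assumes c: "c \<noteq> 0" and [measurable]: "f \<in> borel_measurable borel"
  shows "(LINT x|lborel. f x) = \<bar>c\<bar> ^ DIM('a) *\<^sub>R (LINT x|lborel. f (t + c *\<^sub>R x))"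
  by (subst lborel_affine[OF c, of t]) (simp add: integral_density integral_distr)

lemma lborel_integrable_affine:
  fixes f :: "'a::euclidean_space \<Rightarrow> 'b::{banach, second_countable_topology}"
  assumes c: "c \<noteq> 0" and f: "integrable lborel f"
  shows "integrable lborel (\<lambda>x. f (t + c *\<^sub>R x))"
proof -
  have [measurable]: "f \<in> borel_measurable borel" using f by auto
  from f have "integrable (density (distr lborel borel (\<lambda>x. t + c *\<^sub>R x)) (\<lambda>x. ennreal (\<bar>c\<bar> ^ DIM('a)))) f"
    by (simp flip: lborel_affine[OF c, of t])
  then have "integrable lborel (\<lambda>x. \<bar>c\<bar> ^ DIM('a) *\<^sub>R f (t + c *\<^sub>R x))"
    by (simp add: integrable_density integrable_distr_eq)
  then have "integrable lborel (\<lambda>x. inverse (\<bar>c\<bar> ^ DIM('a)) *\<^sub>R (\<bar>c\<bar> ^ DIM('a) *\<^sub>R f (t + c *\<^sub>R x)))"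
    by (rule integrable_scaleR_right)
  then show ?thesis using c by simp
qed

section \<open>Polynomials times Gaussians as Schwartz functions\<close>

text \<open>Generated inductively because two facts are wanted, closure under directional
  derivatives and polynomial growth, and both follow by rule induction.\<close>

inductive polyfn :: "('a::euclidean_space \<Rightarrow> complex) \<Rightarrow> bool" where
  const: "polyfn (\<lambda>x. c)"
| coord: "polyfn (\<lambda>x. of_real (x \<bullet> b))"
| add: "polyfn p \<Longrightarrow> polyfn q \<Longrightarrow> polyfn (\<lambda>x. p x + q x)"
| mult: "polyfn p \<Longrightarrow> polyfn q \<Longrightarrow> polyfn (\<lambda>x. p x * q x)"

lemma polyfn_deriv:
  "polyfn p \<Longrightarrow> \<exists>p'. (\<forall>x. (p has_derivative p' x) (at x)) \<and> (\<forall>b. polyfn (\<lambda>x. p' x b))"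
proof (induction rule: polyfn.induct)
  case (const c)
  show ?case by (rule exI[of _ "\<lambda>x h. 0"]) (auto intro: polyfn.const)
next
  case (coord b)
  have "((\<lambda>x::'a. complex_of_real (x \<bullet> b)) has_derivative (\<lambda>h. of_real (h \<bullet> b))) (at x)" for x
    by (auto intro!: derivative_eq_intros)
  then show ?case by (intro exI[of _ "\<lambda>x h. of_real (h \<bullet> b)"]) (auto intro: polyfn.const)
next
  case (add p q)
  then obtain p' q' where
    "\<And>x. (p has_derivative p' x) (at x)" "\<And>x. (q has_derivative q' x) (at x)"
    "\<And>b. polyfn (\<lambda>x. p' x b)" "\<And>b. polyfn (\<lambda>x. q' x b)" by blast
  then show ?case
    by (intro exI[of _ "\<lambda>x h. p' x h + q' x h"]) (auto intro!: polyfn.add has_derivative_add)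
next
  case (mult p q)
  then obtain p' q' where
    "\<And>x. (p has_derivative p' x) (at x)" "\<And>x. (q has_derivative q' x) (at x)"
    "\<And>b. polyfn (\<lambda>x. p' x b)" "\<And>b. polyfn (\<lambda>x. q' x b)" by blast
  with mult show ?case
    by (intro exI[of _ "\<lambda>x h. p x * q' x h + p' x h * q x"]) (auto intro!: polyfn.add polyfn.mult has_derivative_mult)
qed

lemma polyfn_growth:
  "polyfn p \<Longrightarrow> \<exists>A N. A \<ge> 0 \<and> (\<forall>x. norm (p x) \<le> A * (1 + norm x) ^ N)"
proof (induction rule: polyfn.induct)
  case (const c)
  show ?case by (rule exI[of _ "norm c"], rule exI[of _ 0]) auto
next
  case (coord b)
  have "\<bar>x \<bullet> b\<bar> \<le> norm b * (1 + norm x)" for x :: 'a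
    using Cauchy_Schwarz_ineq2[of x b] by (simp add: distrib_left mult.commute add_increasing)
  then show ?case by (intro exI[of _ "norm b"] exI[of _ 1]) auto
next
  case (add p q)
  then obtain A N B M where *: "A \<ge> 0" "\<And>x. norm (p x) \<le> A * (1 + norm x) ^ N"
    "B \<ge> 0" "\<And>x. norm (q x) \<le> B * (1 + norm x) ^ M" by blast
  have "norm (p x + q x) \<le> (A + B) * (1 + norm x) ^ (N + M)" for x
  proof -
    have "A * (1 + norm x) ^ N \<le> A * (1 + norm x) ^ (N + M)" "B * (1 + norm x) ^ M \<le> B * (1 + norm x) ^ (N + M)"
      using *(1,3) by (auto intro!: mult_left_mono power_increasing)
    then have "norm (p x) + norm (q x) \<le> (A + B) * (1 + norm x) ^ (N + M)"
      using *(2)[of x] *(4)[of x] unfolding distrib_right by linarith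
    then show ?thesis by (rule order_trans[OF norm_triangle_ineq])
  qed
  then show ?case using * by (intro exI[of _ "A + B"] exI[of _ "N + M"]) auto
next
  case (mult p q)
  then obtain A N B M where *: "A \<ge> 0" "\<And>x. norm (p x) \<le> A * (1 + norm x) ^ N"
    "B \<ge> 0" "\<And>x. norm (q x) \<le> B * (1 + norm x) ^ M" by blast
  have "norm (p x * q x) \<le> (A * B) * (1 + norm x) ^ (N + M)" for x
  proof -
    have "norm (p x * q x) \<le> (A * (1 + norm x) ^ N) * (B * (1 + norm x) ^ M)"
      unfolding norm_mult using * by (intro mult_mono) auto
    then show ?thesis by (simp add: power_add mult_ac)
  qed
  then show ?case using * by (intro exI[of _ "A * B"] exI[of _ "N + M"]) auto
qed

text \<open>A Gaussian centred at \<open>y\<close> and modulated with frequency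
  \<open>\<eta>\<close>. Translation and modulation are both present because the Fourier transform
  exchanges them.\<close>

definition gauss_mod :: "real \<Rightarrow> 'a \<Rightarrow> 'a \<Rightarrow> 'a::euclidean_space \<Rightarrow> complex" where
  "gauss_mod c y \<eta> x = of_real (exp (- c * (norm (x - y))\<^sup>2)) * cis (x \<bullet> \<eta>)"

lemma gauss_mod_deriv:
  "(gauss_mod c y \<eta> has_derivative (\<lambda>h. (of_real (- 2 * c * ((x - y) \<bullet> h)) + \<i> * of_real (h \<bullet> \<eta>)) * gauss_mod c y \<eta> x)) (at x)"
proof -
  have eq: "gauss_mod c y \<eta> = (\<lambda>x. exp (of_real (- c * ((x - y) \<bullet> (x - y))) + \<i> * of_real (x \<bullet> \<eta>)))"
  proof -
    have "exp (of_real A + \<i> * of_real B) = of_real (exp A) * cis B" for A B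
      by (simp add: exp_add cis_conv_exp exp_of_real)
    from this[symmetric] show ?thesis by (simp only: gauss_mod_def fun_eq_iff power2_norm_eq_inner) blast
  qed
  have "((\<lambda>x. of_real (- c * ((x - y) \<bullet> (x - y))) + \<i> * of_real (x \<bullet> \<eta>)) has_derivative
      (\<lambda>h. complex_of_real (- 2 * c * ((x - y) \<bullet> h)) + \<i> * of_real (h \<bullet> \<eta>))) (at x)"
    by (rule has_derivative_eq_rhs, (rule derivative_intros)+)
       (simp add: fun_eq_iff inner_commute algebra_simps)
  from has_derivative_compose[OF this DERIV_exp[unfolded has_field_derivative_def]]
  show ?thesis unfolding eq by (simp only: mult.commute)
qed

text \<open>The logarithmic derivative of \<open>gauss_mod\<close> is an affine function, so a
  derivative changes only the polynomial factor.\<close>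

lemma iter_deriv_gauss:
  assumes "polyfn p"
  shows "\<exists>q. polyfn q \<and> iter_deriv bs (\<lambda>x. p x * gauss_mod c y \<eta> x) = (\<lambda>x. q x * gauss_mod c y \<eta> x)"
proof (induction bs)
  case Nil
  then show ?case using assms by (auto simp: iter_deriv_def)
next
  case (Cons b bs)
  then obtain q where q: "polyfn q" "iter_deriv bs (\<lambda>x. p x * gauss_mod c y \<eta> x) = (\<lambda>x. q x * gauss_mod c y \<eta> x)" by blast
  obtain q' where q': "\<And>x. (q has_derivative q' x) (at x)" "\<And>b. polyfn (\<lambda>x. q' x b)"
    using polyfn_deriv[OF q(1)] by blast
  let ?l = "\<lambda>x. of_real (- 2 * c * ((x - y) \<bullet> b)) + \<i> * of_real (b \<bullet> \<eta>)"
  have "iter_deriv (b # bs) (\<lambda>x. p x * gauss_mod c y \<eta> x) = (\<lambda>x. frechet_derivative (\<lambda>x. q x * gauss_mod c y \<eta> x) (at x) b)"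
    using q(2) by (simp add: iter_deriv_def)
  also have "\<dots> = (\<lambda>x. (q x * ?l x + q' x b) * gauss_mod c y \<eta> x)"
    using frechet_derivative_at[OF has_derivative_mult[OF q'(1) gauss_mod_deriv[of c y \<eta>]], symmetric]
    by (simp add: fun_eq_iff algebra_simps)
  finally have "iter_deriv (b # bs) (\<lambda>x. p x * gauss_mod c y \<eta> x) = (\<lambda>x. (q x * ?l x + q' x b) * gauss_mod c y \<eta> x)" .
  moreover have "polyfn (\<lambda>x. q x * ?l x + q' x b)"
  proof -
    have "?l = (\<lambda>x. of_real (- 2 * c) * of_real (x \<bullet> b) + (of_real (2 * c * (y \<bullet> b)) + \<i> * of_real (b \<bullet> \<eta>)))"
      by (simp add: fun_eq_iff inner_diff_left algebra_simps)
    moreover have "polyfn (\<lambda>x. complex_of_real (- 2 * c) * of_real (x \<bullet> b) + (of_real (2 * c * (y \<bullet> b)) + \<i> * of_real (b \<bullet> \<eta>)))"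
      by (rule polyfn.add[OF polyfn.mult[OF polyfn.const polyfn.coord] polyfn.const])
    ultimately have l: "polyfn ?l" by (simp only:)
    show ?thesis by (rule polyfn.add[OF polyfn.mult[OF q(1) l] q'(2)])
  qed
  ultimately show ?case by blast
qed

lemma norm_power_gauss_bounded:
  fixes y :: "'a::euclidean_space"
  assumes c: "c > 0"
  obtains B where "\<And>x. (1 + norm x) ^ M * exp (- c * (norm (x - y))\<^sup>2) \<le> B"
proof
  fix x :: 'a
  let ?r = "1 + norm x" and ?d = "norm (x - y)"
  have "?r ^ M / fact M \<le> exp ?r"
  proof -
    have "(\<Sum>n\<in>{M}. ?r ^ n /\<^sub>R fact n) \<le> (\<Sum>n. ?r ^ n /\<^sub>R fact n)"
      by (rule sum_le_suminf) (use summable_exp_generic[of ?r] in auto)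
    then show ?thesis by (simp add: exp_def field_simps)
  qed
  then have "?r ^ M \<le> fact M * exp ?r" by (simp add: field_simps)
  then have "?r ^ M * exp (- c * ?d\<^sup>2) \<le> fact M * exp ?r * exp (- c * ?d\<^sup>2)" by (rule mult_right_mono) simp
  also have "\<dots> = fact M * exp (?r - c * ?d\<^sup>2)" by (simp add: exp_add[symmetric])
  \<comment> \<open>Completing the square: 1/(4c) is the maximum of d - c d^2 over d.\<close>
  also have "\<dots> \<le> fact M * exp (1 + norm y + 1 / (4 * c))"
  proof -
    have "norm x \<le> norm y + ?d" using norm_triangle_ineq[of y "x - y"] by simp
    moreover have "0 \<le> (1 - 2 * c * ?d)\<^sup>2 / (4 * c)" using c by simp
    moreover have "(1 - 2 * c * ?d)\<^sup>2 / (4 * c) = 1 / (4 * c) - ?d + c * ?d\<^sup>2"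
      using c by (simp add: power2_eq_square field_simps)
    ultimately show ?thesis by (intro mult_left_mono) auto
  qed
  finally show "?r ^ M * exp (- c * ?d\<^sup>2) \<le> fact M * exp (1 + norm y + 1 / (4 * c))" .
qed

lemma schwartz_poly_gauss:
  assumes c: "c > 0" and p: "polyfn p"
  shows "(\<lambda>x. p x * gauss_mod c y \<eta> x) \<in> schwartz"
  unfolding schwartz_def smooth_def mem_Collect_eq
proof (intro conjI allI impI)
  fix bs :: "'a list" and x
  obtain q where q: "polyfn q" "iter_deriv bs (\<lambda>x. p x * gauss_mod c y \<eta> x) = (\<lambda>x. q x * gauss_mod c y \<eta> x)"
    using iter_deriv_gauss[OF p] by blast
  show "iter_deriv bs (\<lambda>x. p x * gauss_mod c y \<eta> x) differentiable (at x)"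
    unfolding q(2) using polyfn_deriv[OF q(1)] gauss_mod_deriv
    by (intro differentiable_mult) (blast intro: differentiableI)+
next
  fix k and bs :: "'a list"
  obtain q where q: "polyfn q" "iter_deriv bs (\<lambda>x. p x * gauss_mod c y \<eta> x) = (\<lambda>x. q x * gauss_mod c y \<eta> x)"
    using iter_deriv_gauss[OF p] by blast
  obtain A N where A: "A \<ge> 0" "\<And>x. norm (q x) \<le> A * (1 + norm x) ^ N" using polyfn_growth[OF q(1)] by blast
  obtain B where B: "\<And>x. (1 + norm x) ^ (k + N) * exp (- c * (norm (x - y))\<^sup>2) \<le> B"
    by (rule norm_power_gauss_bounded[OF c, of "k + N" y], rule that)
  show "bdd_above (range (\<lambda>x. (1 + norm x) ^ k * norm (iter_deriv bs (\<lambda>x. p x * gauss_mod c y \<eta> x) x)))"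
  proof (rule bdd_aboveI2)
    fix x
    have "(1 + norm x) ^ k * norm (q x * gauss_mod c y \<eta> x) = (1 + norm x) ^ k * (norm (q x) * exp (- c * (norm (x - y))\<^sup>2))"
      by (simp add: norm_mult gauss_mod_def)
    also have "\<dots> \<le> (1 + norm x) ^ k * ((A * (1 + norm x) ^ N) * exp (- c * (norm (x - y))\<^sup>2))"
      using A by (intro mult_left_mono mult_right_mono) auto
    also have "\<dots> = A * ((1 + norm x) ^ (k + N) * exp (- c * (norm (x - y))\<^sup>2))"
      by (simp add: power_add)
    also have "\<dots> \<le> A * B" using A B by (intro mult_left_mono) auto
    finally show "(1 + norm x) ^ k * norm (iter_deriv bs (\<lambda>x. p x * gauss_mod c y \<eta> x) x) \<le> A * B"
      unfolding q(2) .
  qed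
qed

lemma schwartz_gauss_mod: "c > 0 \<Longrightarrow> (\<lambda>x. k * gauss_mod c y \<eta> x) \<in> schwartz"
  by (rule schwartz_poly_gauss[OF _ polyfn.const])

section \<open>Functions determined by their Gaussian means\<close>

text \<open>Boxes are stable under intersection and generate the Borel sets, so the vanishing
  spreads to all Borel sets by induction over disjoint unions and complements. The complement step
  uses that the integral over the whole space vanishes, which comes from exhausting the space by
  boxes.\<close>

lemma AE_zero_if_box_integrals_zero_integrable:
  fixes h :: "'a::euclidean_space \<Rightarrow> complex"
  assumes int: "integrable lborel h" and z: "\<And>l u. (LINT x:box l u|lborel. h x) = 0"
  shows "AE x in lborel. h x = 0"
proof (rule sigma_finite_measure.density_zero[OF sigma_finite_lborel int])
  have si: "set_integrable lborel A h" if "A \<in> sets lborel" for A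
    unfolding set_integrable_def using integrable_mult_indicator[OF that int] .
  have UNIV: "(LINT x|lborel. h x) = 0"
  proof -
    define B :: "nat \<Rightarrow> 'a set" where "B n = box (- (real n *\<^sub>R One)) (real n *\<^sub>R One)" for n
    have "incseq B"
    proof (rule monoI, rule subsetI)
      fix m n :: nat and x assume mn: "m \<le> n" and x: "x \<in> B m"
      show "x \<in> B n" unfolding B_def mem_box
      proof
        fix b :: 'a assume b: "b \<in> Basis"
        have "- real m < x \<bullet> b \<and> x \<bullet> b < real m" using x b by (auto simp: B_def mem_box)
        then have "- real n < x \<bullet> b \<and> x \<bullet> b < real n" using mn by auto
        then show "- (real n *\<^sub>R One) \<bullet> b < x \<bullet> b \<and> x \<bullet> b < real n *\<^sub>R One \<bullet> b" using b by simp
      qed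
    qed
    moreover have "(\<Union>n. B n) = UNIV" unfolding B_def by (rule UN_box_eq_UNIV)
    ultimately have "(\<lambda>n. LINT x:B n|lborel. h x) \<longlonglongrightarrow> (LINT x:UNIV|lborel. h x)"
      using set_integral_cont_up[of B lborel h] si by (simp add: B_def)
    moreover have "(\<lambda>n. LINT x:B n|lborel. h x) = (\<lambda>n. 0)" by (simp add: B_def z)
    ultimately have "(LINT x:UNIV|lborel. h x) = 0" by (simp add: LIMSEQ_const_iff)
    then show ?thesis by (simp add: set_lebesgue_integral_def)
  qed
  fix A :: "'a set" assume A: "A \<in> sets lborel"
  have st: "Int_stable (range (\<lambda>(l, u). box l u :: 'a set))"
    by (auto simp: Int_stable_def box_Int_box)
  have sets: "sigma_sets UNIV (range (\<lambda>(l, u). box l u :: 'a set)) = sets lborel"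
    by (simp add: borel_eq_box)
  have sub: "range (\<lambda>(l, u). box l u :: 'a set) \<subseteq> Pow UNIV" by simp
  have "A \<in> sigma_sets UNIV (range (\<lambda>(l, u). box l u))" unfolding sets by (rule A)
  from st sub this show "(LINT x:A|lborel. h x) = 0"
  proof (induction rule: sigma_sets_induct_disjoint)
    case (basic A)
    then show ?case using z by auto
  next
    case empty
    show ?case by (simp add: set_lebesgue_integral_def)
  next
    case (compl A)
    have A: "A \<in> sets lborel" using compl(1) unfolding sets .
    have "(LINT x:A \<union> (UNIV - A)|lborel. h x) = (LINT x:A|lborel. h x) + (LINT x:UNIV - A|lborel. h x)"
      using A by (intro set_integral_Un si) auto
    then show ?case using compl UNIV by (simp add: set_lebesgue_integral_def)
  next
    case (union F)
    have F: "F i \<in> sets lborel" for i using union(2) unfolding sets by auto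
    have "(LINT x:(\<Union>i. F i)|lborel. h x) = (\<Sum>i. LINT x:F i|lborel. h x)"
      using union(1) F by (intro lebesgue_integral_countable_add si) (auto simp: disjoint_family_on_def)
    then show ?case using union(3) by simp
  qed
qed

text \<open>Cutting \<open>h\<close> off to a large box keeps the hypothesis, since two boxes
  intersect in a box, and makes it integrable.\<close>

lemma AE_zero_if_box_integrals_zero:
  fixes h :: "'a::euclidean_space \<Rightarrow> complex"
  assumes int: "\<And>l u. set_integrable lborel (box l u) h" and z: "\<And>l u. (LINT x:box l u|lborel. h x) = 0"
  shows "AE x in lborel. h x = 0"
proof -
  let ?B = "\<lambda>n::nat. box (- (real n *\<^sub>R One)) (real n *\<^sub>R One) :: 'a set"
  have "AE x in lborel. indicator (?B n) x *\<^sub>R h x = 0" for n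
  proof (rule AE_zero_if_box_integrals_zero_integrable)
    show "integrable lborel (\<lambda>x. indicator (?B n) x *\<^sub>R h x)" using int by (simp add: set_integrable_def)
    fix l u :: 'a
    have "box l u \<inter> ?B n = box (\<Sum>i\<in>Basis. max (l \<bullet> i) (- (real n *\<^sub>R One) \<bullet> i) *\<^sub>R i) (\<Sum>i\<in>Basis. min (u \<bullet> i) (real n *\<^sub>R One \<bullet> i) *\<^sub>R i)"
      by (rule box_Int_box)
    then have "(LINT x:box l u \<inter> ?B n|lborel. h x) = 0" using z by simp
    then show "(LINT x:box l u|lborel. indicator (?B n) x *\<^sub>R h x) = 0"
      by (simp add: set_lebesgue_integral_def indicator_inter_arith)
  qed
  then have "AE x in lborel. \<forall>n. indicator (?B n) x *\<^sub>R h x = 0" by (simp only: AE_all_countable) blast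
  then show ?thesis
  proof (rule AE_mp, intro AE_I2 impI)
    fix x assume H: "\<forall>n. indicat_real (?B n) x *\<^sub>R h x = 0"
    have "x \<in> (\<Union>n. ?B n)" unfolding UN_box_eq_UNIV by simp
    then show "h x = 0" using H by (auto simp: indicator_def)
  qed
qed

text \<open>The convolution of the indicator of \<open>Q\<close> with a probability density:
  \<open>sqrt (pi / c) ^ DIM('a)\<close> is the total mass of the Gaussian. Large \<open>c\<close>
  means narrow averaging.\<close>

definition gauss_avg :: "real \<Rightarrow> 'a::euclidean_space set \<Rightarrow> 'a \<Rightarrow> real" where
  "gauss_avg c Q x = (LINT y:Q|lborel. exp (- c * (norm (x - y))\<^sup>2)) / sqrt (pi / c) ^ DIM('a)"

text \<open>Substituting y = x + z / sqrt c moves \<open>c\<close> out of the Gaussian into the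
  indicator, leaving a majorant that is the same for all \<open>c\<close>.\<close>

lemma gauss_avg_altdef:
  fixes Q :: "'a::euclidean_space set"
  assumes c: "c > 0" and [measurable]: "Q \<in> sets borel"
  shows "gauss_avg c Q x = (LINT z|lborel. indicator Q (x + (1 / sqrt c) *\<^sub>R z) * exp (- (norm z)\<^sup>2)) / sqrt pi ^ DIM('a)"
proof -
  have c': "1 / sqrt c \<noteq> 0" using c by simp
  have "(LINT y:Q|lborel. exp (- c * (norm (x - y))\<^sup>2)) =
      \<bar>1 / sqrt c\<bar> ^ DIM('a) *\<^sub>R (LINT z|lborel. indicator Q (x + (1 / sqrt c) *\<^sub>R z) *\<^sub>R exp (- c * (norm (x - (x + (1 / sqrt c) *\<^sub>R z)))\<^sup>2))"
    unfolding set_lebesgue_integral_def by (rule lborel_integral_affine[OF c']) measurable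
  also have "(LINT z|lborel. indicator Q (x + (1 / sqrt c) *\<^sub>R z) *\<^sub>R exp (- c * (norm (x - (x + (1 / sqrt c) *\<^sub>R z)))\<^sup>2))
      = (LINT z|lborel. indicator Q (x + (1 / sqrt c) *\<^sub>R z) * exp (- (norm z)\<^sup>2))"
    using c by (intro Bochner_Integration.integral_cong) (auto simp: power_divide)
  finally show ?thesis
    using c by (simp add: gauss_avg_def real_sqrt_divide power_divide field_simps)
qed

text \<open>If x + z / sqrt c lies in \<open>Q\<close> and \<open>c \<ge> 1\<close>, then |x| is at
  most R + |z|, hence |x|^2 at most 2 R^2 + 2 |z|^2. Half of the Gaussian in z is traded for the
  factor exp(-|x|^2 / 4), and the other half is integrated.\<close>

lemma gauss_avg_bound:
  fixes Q :: "'a::euclidean_space set"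
  assumes [measurable]: "Q \<in> sets borel" and Q: "\<And>y. y \<in> Q \<Longrightarrow> norm y \<le> R"
  obtains C where "C \<ge> 0" "\<And>c x. c \<ge> 1 \<Longrightarrow> gauss_avg c Q x \<le> C * exp (- (1/4) * (norm x)\<^sup>2)"
proof
  define G where "G = (LINT z|lborel. exp (- (1/2) * (norm (z::'a))\<^sup>2))"
  have G0: "G \<ge> 0" unfolding G_def by (rule Bochner_Integration.integral_nonneg) auto
  then show "exp (R\<^sup>2 / 2) * G / sqrt pi ^ DIM('a) \<ge> 0" by simp
  fix c :: real and x :: 'a assume c: "c \<ge> 1"
  have le: "indicator Q (x + (1 / sqrt c) *\<^sub>R z) * exp (- (norm z)\<^sup>2)
      \<le> (exp (R\<^sup>2 / 2) * exp (- (1/4) * (norm x)\<^sup>2)) * exp (- (1/2) * (norm z)\<^sup>2)" for z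
  proof (cases "x + (1 / sqrt c) *\<^sub>R z \<in> Q")
    case True
    have sc: "1 / sqrt c \<le> 1" "0 \<le> 1 / sqrt c" using c by auto
    have "norm x \<le> norm (x + (1 / sqrt c) *\<^sub>R z) + norm ((1 / sqrt c) *\<^sub>R z)"
      using norm_triangle_ineq4[of "x + (1 / sqrt c) *\<^sub>R z" "(1 / sqrt c) *\<^sub>R z"] by simp
    also have "norm ((1 / sqrt c) *\<^sub>R z) \<le> norm z"
      using mult_right_mono[OF sc(1), of "norm z"] sc(2) by simp
    finally have "norm x \<le> R + norm z" using Q[OF True] by linarith
    then have "(norm x)\<^sup>2 \<le> (R + norm z)\<^sup>2" by (intro power_mono) auto
    also have "\<dots> \<le> 2 * R\<^sup>2 + 2 * (norm z)\<^sup>2"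
      using sum_squares_bound[of R "norm z"] by (simp add: power2_sum)
    finally have "- (norm z)\<^sup>2 \<le> R\<^sup>2 / 2 + - (1/4) * (norm x)\<^sup>2 + - (1/2) * (norm z)\<^sup>2" by argo
    then show ?thesis using True by (simp add: exp_add[symmetric])
  qed auto
  have "(LINT z|lborel. indicator Q (x + (1 / sqrt c) *\<^sub>R z) * exp (- (norm z)\<^sup>2))
      \<le> (LINT z|lborel. (exp (R\<^sup>2 / 2) * exp (- (1/4) * (norm x)\<^sup>2)) * exp (- (1/2) * (norm (z::'a))\<^sup>2))"
  proof (rule Bochner_Integration.integral_mono)
    show i2: "integrable lborel (\<lambda>z::'a. (exp (R\<^sup>2 / 2) * exp (- (1/4) * (norm x)\<^sup>2)) * exp (- (1/2) * (norm z)\<^sup>2))"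
      by (intro integrable_mult_right gauss_integral(1)) simp
    show "integrable lborel (\<lambda>z. indicator Q (x + (1 / sqrt c) *\<^sub>R z) * exp (- (norm z)\<^sup>2))"
    proof (rule Bochner_Integration.integrable_bound[OF i2])
      show "(\<lambda>z. indicator Q (x + (1 / sqrt c) *\<^sub>R z) * exp (- (norm z)\<^sup>2)) \<in> borel_measurable lborel" by measurable
      show "AE z in lborel. norm (indicator Q (x + (1 / sqrt c) *\<^sub>R z) * exp (- (norm z)\<^sup>2))
        \<le> norm ((exp (R\<^sup>2 / 2) * exp (- (1/4) * (norm x)\<^sup>2)) * exp (- (1/2) * (norm z)\<^sup>2))"
        using le by (intro AE_I2) (simp add: abs_mult)
    qed
  qed (rule le)
  also have "\<dots> = (exp (R\<^sup>2 / 2) * exp (- (1/4) * (norm x)\<^sup>2)) * G"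
    unfolding G_def by (rule integral_mult_right_zero)
  finally show "gauss_avg c Q x \<le> exp (R\<^sup>2 / 2) * G / sqrt pi ^ DIM('a) * exp (- (1/4) * (norm x)\<^sup>2)"
    using c by (subst gauss_avg_altdef) (auto simp: divide_simps mult_ac)
qed

lemma gauss_avg_nonneg: "c > 0 \<Longrightarrow> gauss_avg c Q x \<ge> 0"
  unfolding gauss_avg_def set_lebesgue_integral_def
  by (intro divide_nonneg_nonneg Bochner_Integration.integral_nonneg) auto

lemma gauss_avg_tendsto:
  fixes l u :: "'a::euclidean_space" and c :: "nat \<Rightarrow> real"
  assumes c: "\<And>n. c n \<ge> 1" "filterlim c at_top sequentially" and x: "x \<notin> frontier (box l u)"
  shows "(\<lambda>n. gauss_avg (c n) (box l u) x) \<longlonglongrightarrow> indicator (box l u) x"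
proof -
  let ?Q = "box l u"
  have g: "integrable lborel (\<lambda>z::'a. exp (- 1 * (norm z)\<^sup>2))" by (rule gauss_integral) simp
  have "(\<lambda>n. LINT z|lborel. indicator ?Q (x + (1 / sqrt (c n)) *\<^sub>R z) * exp (- 1 * (norm z)\<^sup>2))
      \<longlonglongrightarrow> (LINT z|lborel. indicator ?Q x * exp (- 1 * (norm (z::'a))\<^sup>2))"
  proof (rule integral_dominated_convergence[where w="\<lambda>z. exp (- 1 * (norm z)\<^sup>2)"])
    show "AE z in lborel. (\<lambda>n. indicator ?Q (x + (1 / sqrt (c n)) *\<^sub>R z) * exp (- 1 * (norm z)\<^sup>2))
      \<longlonglongrightarrow> indicator ?Q x * exp (- 1 * (norm z)\<^sup>2)"
    proof (rule AE_I2)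
      fix z :: 'a
      have "filterlim (\<lambda>n. sqrt (c n)) at_top sequentially"
        by (rule filterlim_compose[OF sqrt_at_top c(2)])
      then have "(\<lambda>n. 1 / sqrt (c n)) \<longlonglongrightarrow> 0"
        by (intro tendsto_divide_0[OF tendsto_const]) (auto intro: filterlim_at_top_imp_at_infinity)
      then have "(\<lambda>n. x + (1 / sqrt (c n)) *\<^sub>R z) \<longlonglongrightarrow> x + 0 *\<^sub>R z" by (intro tendsto_intros)
      then have lim: "(\<lambda>n. x + (1 / sqrt (c n)) *\<^sub>R z) \<longlonglongrightarrow> x" by simp
      have "eventually (\<lambda>n. indicator ?Q (x + (1 / sqrt (c n)) *\<^sub>R z) = (indicator ?Q x :: real)) sequentially"
      proof (cases "x \<in> ?Q")
        case True
        from topological_tendstoD[OF lim open_box this] show ?thesis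
          by (rule eventually_mono) (use True in simp)
      next
        case False
        have op: "open (- closure ?Q)" by (rule open_Compl[OF closed_closure])
        have "x \<in> - closure ?Q" using x False by (auto simp: frontier_def interior_open[OF open_box])
        from topological_tendstoD[OF lim op this] show ?thesis
          by (rule eventually_mono) (use False closure_subset[of ?Q] in \<open>auto simp: indicator_def\<close>)
      qed
      then show "(\<lambda>n. indicator ?Q (x + (1 / sqrt (c n)) *\<^sub>R z) * exp (- 1 * (norm z)\<^sup>2))
          \<longlonglongrightarrow> indicator ?Q x * exp (- 1 * (norm z)\<^sup>2)"
        by (intro tendsto_mult tendsto_const tendsto_eventually)
    qed
  qed (use g in \<open>auto simp: indicator_def\<close>)
  also have "(LINT z|lborel. indicator ?Q x * exp (- 1 * (norm (z::'a))\<^sup>2)) = indicator ?Q x * sqrt pi ^ DIM('a)"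
    using gauss_integral(2)[of 1, where 'a='a] by simp
  finally have "(\<lambda>n. (LINT z|lborel. indicator ?Q (x + (1 / sqrt (c n)) *\<^sub>R z) * exp (- 1 * (norm z)\<^sup>2)) / sqrt pi ^ DIM('a))
      \<longlonglongrightarrow> indicator ?Q x * sqrt pi ^ DIM('a) / sqrt pi ^ DIM('a)"
    by (intro tendsto_divide tendsto_const) auto
  moreover have "c n > 0" for n using c(1)[of n] by simp
  ultimately show ?thesis by (simp add: gauss_avg_altdef)
qed

lemma negligible_frontier_box: "AE x in lborel. x \<notin> frontier (box l (u::'a::euclidean_space))"
proof -
  have "negligible (frontier (box l u))" by (rule negligible_convex_frontier) simp
  then have "frontier (box l u) \<in> null_sets lebesgue" by (simp add: negligible_iff_null_sets)
  then have "AE x in lebesgue. x \<notin> frontier (box l u)" by (rule AE_not_in)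
  then show ?thesis by (simp add: AE_completion_iff)
qed

lemma box_norm_bound:
  obtains R where "\<And>x. x \<in> box l (u::'a::euclidean_space) \<Longrightarrow> norm x \<le> R"
  using bounded_box[of l u] unfolding bounded_iff by blast

text \<open>Integrate the vanishing Gaussian means over the centres y in the box and exchange the
  integrals; \<open>gauss_avg_bound\<close> and the integrability of \<open>h\<close> against
  exp(-|x|^2 / 4) justify the exchange.\<close>

lemma integral_gauss_avg_eq_0:
  fixes h :: "'a::euclidean_space \<Rightarrow> complex"
  assumes [measurable]: "h \<in> borel_measurable borel"
    and int: "integrable lborel (\<lambda>x. h x * of_real (exp (- (1/4) * (norm x)\<^sup>2)))"
    and z: "\<And>y. (LINT x|lborel. h x * of_real (exp (- c * (norm (x - y))\<^sup>2))) = 0"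
    and c: "c \<ge> 1"
  shows "(LINT x|lborel. h x * of_real (gauss_avg c (box l u) x)) = 0"
proof -
  let ?Q = "box l u" and ?k = "sqrt (pi / c) ^ DIM('a)"
  have k: "?k > 0" using c by simp
  obtain R where R: "\<And>x. x \<in> ?Q \<Longrightarrow> norm x \<le> R" by (rule box_norm_bound, rule that)
  obtain C where C: "C \<ge> 0" "\<And>c x. c \<ge> 1 \<Longrightarrow> gauss_avg c ?Q x \<le> C * exp (- (1/4) * (norm x)\<^sup>2)"
    using gauss_avg_bound[of ?Q R] R by (metis borel_open open_box)
  define f where "f x y = h x * of_real (indicator ?Q y * exp (- c * (norm (x - y))\<^sup>2))" for x y
  have [measurable]: "(\<lambda>(x, y). f x y) \<in> borel_measurable (lborel \<Otimes>\<^sub>M lborel)"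
    unfolding f_def by measurable
  have iy: "integrable lborel (\<lambda>y. indicator ?Q y * exp (- c * (norm (x - y))\<^sup>2))" for x
  proof (rule Bochner_Integration.integrable_bound[of lborel "\<lambda>y. indicator ?Q y :: real"])
    show "AE y in lborel. norm (indicator ?Q y * exp (- c * (norm (x - y))\<^sup>2)) \<le> norm (indicator ?Q y :: real)"
      using c by (auto simp: indicator_def)
    show "integrable lborel (\<lambda>y. indicator ?Q y :: real)"
      by (intro integrable_real_indicator) (auto simp: emeasure_lborel_box_eq)
  qed measurable
  have avg: "(LINT y|lborel. indicator ?Q y * exp (- c * (norm (x - y))\<^sup>2)) = ?k * gauss_avg c ?Q x" for x
    using k c by (simp add: gauss_avg_def set_lebesgue_integral_def)
  have P: "integrable (lborel \<Otimes>\<^sub>M lborel) (\<lambda>(x, y). f x y)"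
  proof (rule lborel_pair.Fubini_integrable)
    show "AE x in lborel. integrable lborel (\<lambda>y. case (x, y) of (x, y) \<Rightarrow> f x y)"
      unfolding f_def by (intro AE_I2) (simp only: prod.case, intro integrable_mult_right integrable_of_real iy)
    have "(\<lambda>x. LINT y|lborel. norm (case (x, y) of (x, y) \<Rightarrow> f x y)) = (\<lambda>x. norm (h x) * (?k * gauss_avg c ?Q x))"
      unfolding f_def avg[symmetric] by (simp add: norm_mult abs_mult)
    moreover have "integrable lborel (\<lambda>x. norm (h x) * (?k * gauss_avg c ?Q x))"
    proof (rule Bochner_Integration.integrable_bound[OF integrable_mult_right[OF integrable_norm[OF int], of "?k * C"]])
      show "(\<lambda>x. norm (h x) * (?k * gauss_avg c ?Q x)) \<in> borel_measurable lborel"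
        unfolding avg[symmetric] by measurable
      have "norm (h x) * (?k * gauss_avg c ?Q x) \<le> norm (h x) * (?k * (C * exp (- (1/4) * (norm x)\<^sup>2)))" for x
        using k C(2)[OF c] by (intro mult_left_mono) auto
      then show "AE x in lborel. norm (norm (h x) * (?k * gauss_avg c ?Q x))
         \<le> norm (?k * C * norm (h x * of_real (exp (- (1/4) * (norm x)\<^sup>2))))"
        using k C(1) gauss_avg_nonneg[of c ?Q] c by (intro AE_I2) (simp add: norm_mult abs_mult mult_ac)
    qed
    ultimately show "integrable lborel (\<lambda>x. LINT y|lborel. norm (case (x, y) of (x, y) \<Rightarrow> f x y))" by simp
  qed simp
  have "(LINT x|lborel. h x * of_real (?k * gauss_avg c ?Q x)) = (LINT x|lborel. LINT y|lborel. f x y)"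
    unfolding avg[symmetric] f_def
    by (intro Bochner_Integration.integral_cong refl)
       (simp only: integral_mult_right_zero integral_complex_of_real)
  also have "\<dots> = (LINT y|lborel. LINT x|lborel. f x y)" by (rule lborel_pair.Fubini_integral[OF P, symmetric])
  also have "\<dots> = 0"
  proof -
    have "f x y = indicator ?Q y * (h x * of_real (exp (- c * (norm (x - y))\<^sup>2)))" for x y
      by (simp add: f_def indicator_def)
    then show ?thesis by (simp add: z[simplified])
  qed
  also have "(LINT x|lborel. h x * of_real (?k * gauss_avg c ?Q x)) = ?k * (LINT x|lborel. h x * of_real (gauss_avg c ?Q x))"
    by (subst integral_mult_right_zero[symmetric]) (simp add: mult_ac)
  finally show ?thesis using k c by simp
qed

text \<open>Box averages of narrowing Gaussians tend to the indicator of the box off its frontier,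
  so all box integrals of \<open>h\<close> vanish. Integrability is demanded only against Gaussians,
  which admits the polynomially growing kernels; the same lemma later identifies a Fourier
  transform.\<close>

lemma gauss_uniqueness:
  fixes h :: "'a::euclidean_space \<Rightarrow> complex"
  assumes [measurable]: "h \<in> borel_measurable borel"
    and int: "\<And>c y. c > 0 \<Longrightarrow> integrable lborel (\<lambda>x. h x * of_real (exp (- c * (norm (x - y))\<^sup>2)))"
    and z: "\<And>c y. c > 0 \<Longrightarrow> (LINT x|lborel. h x * of_real (exp (- c * (norm (x - y))\<^sup>2))) = 0"
  shows "AE x in lborel. h x = 0"
proof (rule AE_zero_if_box_integrals_zero)
  fix l u :: 'a
  let ?Q = "box l u"
  obtain R where R: "\<And>x. x \<in> ?Q \<Longrightarrow> norm x \<le> R" by (rule box_norm_bound, rule that)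
  obtain C where C: "C \<ge> 0" "\<And>c x. c \<ge> 1 \<Longrightarrow> gauss_avg c ?Q x \<le> C * exp (- (1/4) * (norm x)\<^sup>2)"
    using gauss_avg_bound[of ?Q R] R by (metis borel_open open_box)
  have int4: "integrable lborel (\<lambda>x. h x * of_real (exp (- (1/4) * (norm x)\<^sup>2)))"
    using int[of "1/4" 0] by simp
  show si: "set_integrable lborel ?Q h"
    unfolding set_integrable_def
  proof (rule Bochner_Integration.integrable_bound[OF integrable_mult_right[OF integrable_norm[OF int4], of "exp ((1/4) * R\<^sup>2)"]])
    have "norm (h x) \<le> exp ((1/4) * R\<^sup>2) * norm (h x * of_real (exp (- (1/4) * (norm x)\<^sup>2)))" if "x \<in> ?Q" for x
    proof -
      have "(norm x)\<^sup>2 \<le> R\<^sup>2" using R[OF that] by (intro power_mono) auto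
      then have "1 \<le> exp ((1/4) * R\<^sup>2) * exp (- (1/4) * (norm x)\<^sup>2)" by (simp add: exp_add[symmetric])
      from mult_left_mono[OF this, of "norm (h x)"] show ?thesis by (simp add: norm_mult mult_ac)
    qed
    then show "AE x in lborel. norm (indicator ?Q x *\<^sub>R h x) \<le> norm (exp ((1/4) * R\<^sup>2) * norm (h x * of_real (exp (- (1/4) * (norm x)\<^sup>2))))"
      by (auto simp: indicator_def)
  qed measurable
  have "(\<lambda>n. LINT x|lborel. h x * of_real (gauss_avg (real (Suc n)) ?Q x)) \<longlonglongrightarrow> (LINT x|lborel. h x * of_real (indicator ?Q x))"
  proof (rule integral_dominated_convergence[where w="\<lambda>x. C * norm (h x * of_real (exp (- (1/4) * (norm x)\<^sup>2)))"])
    show "integrable lborel (\<lambda>x. C * norm (h x * of_real (exp (- (1/4) * (norm x)\<^sup>2))))"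
      by (intro integrable_mult_right integrable_norm int4)
    have "filterlim (\<lambda>n. real (Suc n)) at_top sequentially"
      by (rule filterlim_compose[OF filterlim_real_sequentially filterlim_Suc])
    then have "(\<lambda>n. h x * of_real (gauss_avg (real (Suc n)) ?Q x)) \<longlonglongrightarrow> h x * of_real (indicator ?Q x)"
      if "x \<notin> frontier ?Q" for x
      using that by (intro tendsto_intros gauss_avg_tendsto) auto
    with negligible_frontier_box[of l u]
    show "AE x in lborel. (\<lambda>n. h x * of_real (gauss_avg (real (Suc n)) ?Q x)) \<longlonglongrightarrow> h x * of_real (indicator ?Q x)"
      by (rule eventually_mono)
    fix n
    show "(\<lambda>x. h x * of_real (gauss_avg (real (Suc n)) ?Q x)) \<in> borel_measurable lborel"
      unfolding gauss_avg_def set_lebesgue_integral_def by measurable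
    have "norm (h x * of_real (gauss_avg (real (Suc n)) ?Q x)) \<le> C * norm (h x * of_real (exp (- (1/4) * (norm x)\<^sup>2)))" for x
      using mult_left_mono[OF C(2)[of "real (Suc n)" x], of "norm (h x)"] gauss_avg_nonneg[of "real (Suc n)" ?Q x]
      by (simp add: norm_mult mult_ac)
    then show "AE x in lborel. norm (h x * of_real (gauss_avg (real (Suc n)) ?Q x)) \<le> C * norm (h x * of_real (exp (- (1/4) * (norm x)\<^sup>2)))"
      by simp
  qed measurable
  moreover have "(LINT x|lborel. h x * of_real (gauss_avg (real (Suc n)) ?Q x)) = 0" for n
    by (rule integral_gauss_avg_eq_0[OF _ int4 z]) auto
  ultimately have "(LINT x|lborel. h x * of_real (indicator ?Q x)) = 0" by (simp only: LIMSEQ_const_iff)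
  then show "(LINT x:?Q|lborel. h x) = 0"
    by (simp add: set_lebesgue_integral_def scaleR_conv_of_real mult.commute)
qed

section \<open>Identification of the kernel\<close>

lemma smooth_continuous: "smooth f \<Longrightarrow> continuous_on UNIV f"
  unfolding smooth_def
  by (drule spec[of _ "[]"]) (auto simp: iter_deriv_def intro!: differentiable_imp_continuous_on simp: differentiable_on_def differentiable_at_withinI)

lemma schwartz_measurable: "\<phi> \<in> schwartz \<Longrightarrow> \<phi> \<in> borel_measurable borel"
  unfolding schwartz_def by (intro borel_measurable_continuous_onI smooth_continuous) auto

lemma schwartz_decay:
  assumes "\<phi> \<in> schwartz"
  obtains B where "B \<ge> 0" "\<And>x. (1 + norm x) ^ k * norm (\<phi> x) \<le> B"
proof -
  have "bdd_above (range (\<lambda>x. (1 + norm x) ^ k * norm (iter_deriv [] \<phi> x)))"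
    using assms unfolding schwartz_def by (auto dest!: spec[of _ k] spec[of _ "[]"])
  then obtain B where B: "\<And>x. (1 + norm x) ^ k * norm (\<phi> x) \<le> B"
    by (auto simp: bdd_above_def iter_deriv_def)
  moreover have "B \<ge> 0" using B[of 0] by (intro order_trans[OF _ B[of 0]]) simp
  ultimately show thesis using that by blast
qed

lemma integrable_inverse_one_plus_square: "integrable lborel (\<lambda>x::real. inverse (1 + x\<^sup>2))"
  using integrable_inverse_1_plus_square by (simp add: set_integrable_def einterval_def)

text \<open>Two powers of decay beyond the growth exponent leave the integrable 1 / (1 +
  x^2).\<close>

lemma integrable_growth_mult_schwartz:
  fixes \<phi> K :: "real \<Rightarrow> complex"
  assumes \<phi>: "\<phi> \<in> schwartz" and K: "\<And>x. norm (K x) \<le> A * (1 + \<bar>x\<bar>) ^ N"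
    and [measurable]: "K \<in> borel_measurable borel"
  shows "integrable lborel (\<lambda>x. K x * \<phi> x)"
proof -
  note [measurable] = schwartz_measurable[OF \<phi>]
  obtain B where B: "B \<ge> 0" "\<And>x. (1 + norm x) ^ (N + 2) * norm (\<phi> x) \<le> B"
    by (rule schwartz_decay[OF \<phi>, of "N + 2"], rule that)
  have A: "A \<ge> 0" using order_trans[OF norm_ge_zero K[of 0]] by simp
  show ?thesis
  proof (rule Bochner_Integration.integrable_bound[OF integrable_mult_right[OF integrable_inverse_one_plus_square, of "A * B"]])
    have "norm (K x * \<phi> x) \<le> A * B * inverse (1 + x\<^sup>2)" for x
    proof -
      have pos: "1 + x\<^sup>2 > 0" by (simp add: add_pos_nonneg)
      have "norm (K x * \<phi> x) * (1 + x\<^sup>2) \<le> (A * (1 + \<bar>x\<bar>) ^ N * norm (\<phi> x)) * (1 + \<bar>x\<bar>)\<^sup>2"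
        unfolding norm_mult
        using K A by (intro mult_mono) (auto simp: power2_sum)
      also have "\<dots> = A * ((1 + \<bar>x\<bar>) ^ (N + 2) * norm (\<phi> x))" by (simp add: power_add power2_eq_square)
      also have "\<dots> \<le> A * B" using A B(2)[of x] by (intro mult_left_mono) auto
      finally show ?thesis using pos by (simp add: field_simps)
    qed
    then show "AE x in lborel. norm (K x * \<phi> x) \<le> norm (A * B * inverse (1 + x\<^sup>2))"
      using A B by (intro AE_I2) (auto intro: order_trans)
  qed measurable
qed

lemma gauss_mod_measurable [measurable]: "gauss_mod c y \<eta> \<in> borel_measurable borel"
  unfolding gauss_mod_def[abs_def] by measurable

text \<open>Translation turns into modulation, so the transform of a test Gaussian is a multiple of
  a \<open>gauss_mod\<close> and thereby visibly a Schwartz function.\<close>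

lemma fourier_gauss_mod:
  fixes y :: "'a::euclidean_space"
  assumes c: "c > 0"
  shows "fourier (gauss_mod c y 0) = (\<lambda>\<xi>. of_real (sqrt (pi / c) ^ DIM('a)) * gauss_mod (1 / (4 * c)) 0 (- y) \<xi>)"
proof
  fix \<xi> :: 'a
  have "fourier (gauss_mod c y 0) \<xi> = (LINT x|lborel. cis (- (x \<bullet> \<xi>)) * gauss_mod c y 0 x)"
    unfolding fourier_def by (subst integral_completion) (auto simp: cis_conv_exp)
  also have "\<dots> = (LINT x|lborel. cis (- ((y + x) \<bullet> \<xi>)) * gauss_mod c y 0 (y + x))"
    using lborel_integral_affine[of 1 "\<lambda>x. cis (- (x \<bullet> \<xi>)) * gauss_mod c y 0 x" y] by simp
  also have "\<dots> = (LINT x|lborel. cis (- (y \<bullet> \<xi>)) * (of_real (exp (- c * (norm x)\<^sup>2)) * cis (x \<bullet> (- \<xi>))))"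
    by (intro Bochner_Integration.integral_cong) (auto simp: gauss_mod_def inner_add_left cis_mult algebra_simps)
  also have "\<dots> = cis (- (y \<bullet> \<xi>)) * of_real (sqrt (pi / c) ^ DIM('a) * exp (- (norm (- \<xi>))\<^sup>2 / (4 * c)))"
    unfolding integral_mult_right_zero gauss_fourier(2)[OF c] ..
  finally show "fourier (gauss_mod c y 0) \<xi> = of_real (sqrt (pi / c) ^ DIM('a)) * gauss_mod (1 / (4 * c)) 0 (- y) \<xi>"
    by (simp add: gauss_mod_def inner_commute mult_ac)
qed

lemma continuous_AE_zero:
  fixes D :: "'a::euclidean_space \<Rightarrow> complex"
  assumes "AE x in lborel. D x = 0" and cont: "continuous_on UNIV D"
  shows "D x = 0"
proof (rule ccontr)
  assume "D x \<noteq> 0"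
  have op: "open {x. D x \<noteq> 0}"
    using cont by (intro open_Collect_neq) auto
  have "{x. D x \<noteq> 0} \<in> null_sets lborel"
    using assms(1) op AE_iff_null_sets[of "{x. D x \<noteq> 0}" lborel] by simp
  then have "{x. D x \<noteq> 0} \<in> null_sets lebesgue" by (rule null_sets_completionI)
  then have "negligible {x. D x \<noteq> 0}" by (simp add: negligible_iff_null_sets)
  with open_not_negligible[OF op] \<open>D x \<noteq> 0\<close> show False by blast
qed

definition is_osc_kernel :: "real \<Rightarrow> (real \<Rightarrow> complex) \<Rightarrow> bool" where
  "is_osc_kernel a K \<longleftrightarrow> smooth K \<and>
     (\<exists>u. induces (\<lambda>\<xi>. exp (\<i> * of_real (\<bar>\<xi>\<bar> powr a))) u \<and> induces K (fourier_dist u))"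

text \<open>The distribution \<open>u\<close> may differ between two kernels and is pinned down on
  \<open>schwartz\<close> only. The Fourier transform of a Gaussian lies there, so both kernels have
  the same pairing with every Gaussian; they agree almost everywhere by
  \<open>gauss_uniqueness\<close>, and everywhere by continuity.\<close>

lemma is_osc_kernel_unique:
  assumes K: "is_osc_kernel a K" and L: "is_osc_kernel a L"
  shows "K = L"
proof -
  have gauss: "integrable lborel (\<lambda>x. K x * gauss_mod c y 0 x)"
    "(LINT x|lborel. K x * gauss_mod c y 0 x) = (LINT \<xi>|lborel. exp (\<i> * of_real (\<bar>\<xi>\<bar> powr a)) * fourier (gauss_mod c y 0) \<xi>)"
    if K: "is_osc_kernel a K" and c: "c > 0" for K c y
  proof -
    obtain u where sm: "smooth K" and u: "induces (\<lambda>\<xi>. exp (\<i> * of_real (\<bar>\<xi>\<bar> powr a))) u" "induces K (fourier_dist u)"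
      using K unfolding is_osc_kernel_def by blast
    have [measurable]: "K \<in> borel_measurable borel"
      by (intro borel_measurable_continuous_onI smooth_continuous sm)
    have g: "gauss_mod c y 0 \<in> schwartz" using schwartz_gauss_mod[OF c, of 1] by simp
    have "integrable lebesgue (\<lambda>x. K x * gauss_mod c y 0 x)" using u(2) g unfolding induces_def by blast
    then show "integrable lborel (\<lambda>x. K x * gauss_mod c y 0 x)" by (subst (asm) integrable_completion) auto
    have fg: "fourier (gauss_mod c y 0) \<in> schwartz"
      unfolding fourier_gauss_mod[OF c] by (rule schwartz_gauss_mod) (use c in simp)
    have [measurable]: "fourier (gauss_mod c y 0) \<in> borel_measurable borel" by (rule schwartz_measurable[OF fg])
    have "(LINT x|lborel. K x * gauss_mod c y 0 x) = (LINT x|lebesgue. K x * gauss_mod c y 0 x)"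
      by (rule integral_completion[symmetric]) measurable
    also have "\<dots> = u (fourier (gauss_mod c y 0))"
      using u(2) g unfolding induces_def fourier_dist_def by simp
    also have "\<dots> = (LINT \<xi>|lebesgue. exp (\<i> * of_real (\<bar>\<xi>\<bar> powr a)) * fourier (gauss_mod c y 0) \<xi>)"
      using u(1) fg unfolding induces_def by blast
    also have "\<dots> = (LINT \<xi>|lborel. exp (\<i> * of_real (\<bar>\<xi>\<bar> powr a)) * fourier (gauss_mod c y 0) \<xi>)"
      by (rule integral_completion) measurable
    finally show "(LINT x|lborel. K x * gauss_mod c y 0 x) = (LINT \<xi>|lborel. exp (\<i> * of_real (\<bar>\<xi>\<bar> powr a)) * fourier (gauss_mod c y 0) \<xi>)" .
  qed
  have cont: "continuous_on UNIV (\<lambda>x. K x - L x)"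
    using K L by (intro continuous_intros smooth_continuous) (auto simp: is_osc_kernel_def)
  have gm: "gauss_mod c y 0 x = of_real (exp (- c * (norm (x - y))\<^sup>2))" for c and x y :: real
    by (simp add: gauss_mod_def)
  have "AE x in lborel. K x - L x = 0"
  proof (rule gauss_uniqueness)
    show "(\<lambda>x. K x - L x) \<in> borel_measurable borel" by (rule borel_measurable_continuous_onI[OF cont])
    fix c y :: real assume c: "c > 0"
    show "integrable lborel (\<lambda>x. (K x - L x) * of_real (exp (- c * (norm (x - y))\<^sup>2)))"
      unfolding gm[symmetric] left_diff_distrib
      by (intro Bochner_Integration.integrable_diff gauss(1) K L c)
    show "(LINT x|lborel. (K x - L x) * of_real (exp (- c * (norm (x - y))\<^sup>2))) = 0"
      unfolding gm[symmetric] left_diff_distrib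
      by (simp add: gauss[OF K c] gauss[OF L c])
  qed
  then show "K = L" using continuous_AE_zero[OF _ cont] by (auto simp: fun_eq_iff)
qed

lemma reg_kernel_even: "reg_kernel a e (- x) t = reg_kernel a e x t"
  unfolding reg_kernel_def by (subst lborel_integral_real_affine[of "-1" _ 0]) auto

lemma reg_kernel_measurable [measurable]: "(\<lambda>x. reg_kernel a e x t) \<in> borel_measurable borel"
  unfolding reg_kernel_def by measurable

text \<open>For positive \<open>e\<close> the damped multiplier and \<open>\<phi>\<close> are both
  integrable, so Fubini applies; the sign of \<open>x\<close> left by the Fourier exponential is
  removed by evenness.\<close>

lemma reg_kernel_duality:
  fixes \<phi> :: "real \<Rightarrow> complex"
  assumes e: "e > 0" and \<phi>: "integrable lborel \<phi>"
  shows "(LINT s|lborel. of_real (exp (- e * s\<^sup>2)) * cis (t * \<bar>s\<bar> powr a) * fourier \<phi> s)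
    = (LINT x|lborel. reg_kernel a e x t * \<phi> x)"
proof -
  have [measurable]: "\<phi> \<in> borel_measurable borel" using \<phi> by auto
  let ?g = "\<lambda>s. of_real (exp (- e * s\<^sup>2)) * cis (t * \<bar>s\<bar> powr a)"
  define F where "F s x = ?g s * (cis (- (x * s)) * \<phi> x)" for s x
  have gint: "integrable lborel ?g" by (rule integrable_gauss_cis[OF e]) measurable
  have P: "integrable (lborel \<Otimes>\<^sub>M lborel) (\<lambda>(s, x). F s x)"
  proof (rule lborel_pair.Fubini_integrable)
    show "(\<lambda>(s, x). F s x) \<in> borel_measurable (lborel \<Otimes>\<^sub>M lborel)" unfolding F_def by measurable
    have "integrable lborel (\<lambda>s. norm (?g s) * (LINT x|lborel. norm (\<phi> x)))"
      using gint by (intro integrable_mult_left integrable_norm)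
    then show "integrable lborel (\<lambda>s. LINT x|lborel. norm (case (s, x) of (s, x) \<Rightarrow> F s x))"
      by (simp add: F_def norm_mult)
    have "integrable lborel (\<lambda>x. cis (- (x * s)) * \<phi> x)" for s
      by (rule Bochner_Integration.integrable_bound[OF \<phi>]) (auto simp: norm_mult)
    then show "AE s in lborel. integrable lborel (\<lambda>x. case (s, x) of (s, x) \<Rightarrow> F s x)"
      by (auto simp: F_def)
  qed
  have "(LINT s|lborel. ?g s * fourier \<phi> s) = (LINT s|lborel. LINT x|lborel. F s x)"
  proof (intro Bochner_Integration.integral_cong refl)
    fix s
    have "fourier \<phi> s = (LINT x|lborel. cis (- (x * s)) * \<phi> x)"
      unfolding fourier_def by (subst integral_completion) (auto simp: cis_conv_exp)
    then show "?g s * fourier \<phi> s = (LINT x|lborel. F s x)"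
      unfolding F_def integral_mult_right_zero by simp
  qed
  also have "\<dots> = (LINT x|lborel. LINT s|lborel. F s x)" by (rule lborel_pair.Fubini_integral[OF P, symmetric])
  also have "\<dots> = (LINT x|lborel. reg_kernel a e x t * \<phi> x)"
  proof (intro Bochner_Integration.integral_cong refl)
    fix x
    have "(LINT s|lborel. F s x) = (LINT s|lborel. (of_real (exp (- e * s\<^sup>2)) * cis ((- x) * s + t * \<bar>s\<bar> powr a)) * \<phi> x)"
    proof (intro Bochner_Integration.integral_cong refl)
      fix s
      have "cis ((- x) * s + t * \<bar>s\<bar> powr a) = cis (- (x * s)) * cis (t * \<bar>s\<bar> powr a)" by (simp add: cis_mult)
      then show "F s x = (of_real (exp (- e * s\<^sup>2)) * cis ((- x) * s + t * \<bar>s\<bar> powr a)) * \<phi> x"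
        unfolding F_def by (simp only: mult_ac)
    qed
    also have "\<dots> = reg_kernel a e (- x) t * \<phi> x"
      unfolding reg_kernel_def by (rule integral_mult_left_zero)
    finally show "(LINT s|lborel. F s x) = reg_kernel a e x t * \<phi> x" by (simp add: reg_kernel_even)
  qed
  finally show ?thesis .
qed

lemma lim_kernel_measurable: "a > 1 \<Longrightarrow> lim_kernel a \<in> borel_measurable borel"
  by (intro borel_measurable_continuous_onI smooth_continuous smooth_lim_kernel)

text \<open>On a Schwartz function dominated convergence removes the damping, so \<open>u\<close> is
  integration against the multiplier. On the Fourier transform of one, duality turns the damped
  pairing into a pairing with \<open>reg_kernel a (e n) x 1\<close>, which converges to
  \<open>lim_kernel\<close> under the polynomial majorant \<open>kernel_growth\<close>.\<close>

lemma is_osc_kernel_lim_kernel: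
  assumes a: "a > 1"
  shows "is_osc_kernel a (lim_kernel a)"
  unfolding is_osc_kernel_def
proof (intro conjI exI)
  show "smooth (lim_kernel a)" by (rule smooth_lim_kernel[OF a])
  note [measurable] = lim_kernel_measurable[OF a]
  define e where "e n = 1 / real (Suc n)" for n
  have e: "e n > 0" for n by (simp add: e_def)
  have e0: "e \<longlonglongrightarrow> 0" unfolding e_def by real_asymp
  have er: "filterlim e (at_right 0) sequentially"
    using e0 e less_imp_neq[OF e, THEN not_sym] by (auto simp: filterlim_at)
  text \<open>Defining \<open>u\<close> by Gaussian regularisation makes it meaningful on every Fourier transform of
    a Schwartz function without first showing that this transform is integrable.\<close>
  define u where "u \<psi> = lim (\<lambda>n. LINT s|lborel. of_real (exp (- e n * s\<^sup>2)) * cis (1 * \<bar>s\<bar> powr a) * \<psi> s)"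
    for \<psi> :: "real \<Rightarrow> complex"
  obtain A N where A: "A \<ge> 0" and growth: "\<And>x. kernel_growth a x \<le> A * (1 + \<bar>x\<bar>) ^ N"
    by (rule kernel_growth_le[of a], rule that)
  have phi_int: "integrable lborel \<phi>" if "\<phi> \<in> schwartz" for \<phi> :: "real \<Rightarrow> complex"
    using integrable_growth_mult_schwartz[OF that, of "\<lambda>_. 1" 1 0] by simp
  show "induces (\<lambda>\<xi>. exp (\<i> * of_real (\<bar>\<xi>\<bar> powr a))) u"
    unfolding induces_def
  proof (intro conjI ballI)
    have [measurable]: "(\<lambda>\<xi>. exp (\<i> * complex_of_real (\<bar>\<xi>\<bar> powr a))) \<in> borel_measurable borel" by measurable
    then show "(\<lambda>\<xi>. exp (\<i> * complex_of_real (\<bar>\<xi>\<bar> powr a))) \<in> borel_measurable lebesgue"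
      by (intro measurable_completion) simp
    fix \<phi> :: "real \<Rightarrow> complex" assume \<phi>: "\<phi> \<in> schwartz"
    note [measurable] = schwartz_measurable[OF \<phi>]
    have int: "integrable lborel (\<lambda>x. exp (\<i> * of_real (\<bar>x\<bar> powr a)) * \<phi> x)"
      by (rule integrable_growth_mult_schwartz[OF \<phi>, of _ 1 0]) auto
    then show "integrable lebesgue (\<lambda>x. exp (\<i> * of_real (\<bar>x\<bar> powr a)) * \<phi> x)"
      by (subst integrable_completion) auto
    have "(\<lambda>n. LINT s|lborel. of_real (exp (- e n * s\<^sup>2)) * cis (1 * \<bar>s\<bar> powr a) * \<phi> s) \<longlonglongrightarrow>
        (LINT s|lborel. of_real (exp (- 0 * s\<^sup>2)) * cis (1 * \<bar>s\<bar> powr a) * \<phi> s)"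
    proof (rule integral_dominated_convergence[where w="\<lambda>s. norm (\<phi> s)"])
      show "integrable lborel (\<lambda>s. norm (\<phi> s))" by (rule integrable_norm[OF phi_int[OF \<phi>]])
      show "AE s in lborel. (\<lambda>n. of_real (exp (- e n * s\<^sup>2)) * cis (1 * \<bar>s\<bar> powr a) * \<phi> s)
          \<longlonglongrightarrow> of_real (exp (- 0 * s\<^sup>2)) * cis (1 * \<bar>s\<bar> powr a) * \<phi> s"
        by (intro AE_I2 tendsto_intros e0)
      show "AE s in lborel. norm (of_real (exp (- e n * s\<^sup>2)) * cis (1 * \<bar>s\<bar> powr a) * \<phi> s) \<le> norm (\<phi> s)" for n
        using e[of n] by (auto simp: norm_mult intro!: mult_left_le_one_le)
    qed measurable
    then have "u \<phi> = (LINT s|lborel. of_real (exp (- 0 * s\<^sup>2)) * cis (1 * \<bar>s\<bar> powr a) * \<phi> s)"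
      unfolding u_def by (rule limI)
    also have "\<dots> = (LINT s|lborel. exp (\<i> * of_real (\<bar>s\<bar> powr a)) * \<phi> s)"
      by (simp add: cis_conv_exp)
    also have "\<dots> = (LINT s|lebesgue. exp (\<i> * of_real (\<bar>s\<bar> powr a)) * \<phi> s)"
      by (rule integral_completion[symmetric]) measurable
    finally show "u \<phi> = (LINT s|lebesgue. exp (\<i> * of_real (\<bar>s\<bar> powr a)) * \<phi> s)" .
  qed
  show "induces (lim_kernel a) (fourier_dist u)"
    unfolding induces_def
  proof (intro conjI ballI)
    show "lim_kernel a \<in> borel_measurable lebesgue" by (intro measurable_completion) simp
    fix \<phi> :: "real \<Rightarrow> complex" assume \<phi>: "\<phi> \<in> schwartz"
    note [measurable] = schwartz_measurable[OF \<phi>]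
    have int: "integrable lborel (\<lambda>x. lim_kernel a x * \<phi> x)"
      by (rule integrable_growth_mult_schwartz[OF \<phi>, of _ A N])
         (auto intro: order_trans[OF norm_lim_kernel_le[OF a] growth])
    then show "integrable lebesgue (\<lambda>x. lim_kernel a x * \<phi> x)"
      by (subst integrable_completion) auto
    have g_int: "integrable lborel (\<lambda>x. of_real (kernel_growth a x) * \<phi> x)"
    proof (rule integrable_growth_mult_schwartz[OF \<phi>, of _ A N])
      have "kernel_growth a x \<ge> 0" for x by (simp add: kernel_growth_def)
      then show "norm (complex_of_real (kernel_growth a x)) \<le> A * (1 + \<bar>x\<bar>) ^ N" for x
        using growth[of x] by simp
      show "(\<lambda>x. complex_of_real (kernel_growth a x)) \<in> borel_measurable borel"
        unfolding kernel_growth_def by measurable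
    qed
    have "(\<lambda>n. LINT x|lborel. reg_kernel a (e n) x 1 * \<phi> x) \<longlonglongrightarrow> (LINT x|lborel. lim_kernel a x * \<phi> x)"
    proof (rule integral_dominated_convergence[where w="\<lambda>x. norm (of_real (kernel_growth a x) * \<phi> x)"])
      show "integrable lborel (\<lambda>x. norm (of_real (kernel_growth a x) * \<phi> x))" by (rule integrable_norm[OF g_int])
      show "AE x in lborel. (\<lambda>n. reg_kernel a (e n) x 1 * \<phi> x) \<longlonglongrightarrow> lim_kernel a x * \<phi> x"
        by (intro AE_I2 tendsto_mult tendsto_const filterlim_compose[OF reg_kernel_tendsto[OF a] er])
      show "AE x in lborel. norm (reg_kernel a (e n) x 1 * \<phi> x) \<le> norm (of_real (kernel_growth a x) * \<phi> x)" for n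
      proof (rule AE_I2)
        fix x
        have "norm (reg_kernel a (e n) x 1) \<le> \<bar>kernel_growth a x\<bar>"
          by (rule order_trans[OF norm_reg_kernel_le[OF a e] abs_ge_self])
        then show "norm (reg_kernel a (e n) x 1 * \<phi> x) \<le> norm (of_real (kernel_growth a x) * \<phi> x)"
          by (simp add: norm_mult mult_right_mono)
      qed
    qed measurable
    then have "(\<lambda>n. LINT s|lborel. of_real (exp (- e n * s\<^sup>2)) * cis (1 * \<bar>s\<bar> powr a) * fourier \<phi> s)
        \<longlonglongrightarrow> (LINT x|lborel. lim_kernel a x * \<phi> x)"
      unfolding reg_kernel_duality[OF e phi_int[OF \<phi>]] .
    then have "u (fourier \<phi>) = (LINT x|lborel. lim_kernel a x * \<phi> x)" unfolding u_def by (rule limI)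
    also have "\<dots> = (LINT x|lebesgue. lim_kernel a x * \<phi> x)" by (rule integral_completion[symmetric]) measurable
    finally show "fourier_dist u \<phi> = (LINT x|lebesgue. lim_kernel a x * \<phi> x)" by (simp add: fourier_dist_def)
  qed
qed

theorem osc_kernel_eq: "a > 1 \<Longrightarrow> osc_kernel a = lim_kernel a"
  unfolding osc_kernel_def is_osc_kernel_def[symmetric]
  using is_osc_kernel_lim_kernel is_osc_kernel_unique by (metis someI)

section \<open>The maximal estimate\<close>

lemma measurable_vec_nth [measurable (raw)]:
  fixes f :: "'b \<Rightarrow> real ^ 'n::finite"
  assumes [measurable]: "f \<in> borel_measurable M"
  shows "(\<lambda>x. f x $ i) \<in> borel_measurable M"
proof -
  have "(\<lambda>v::real^'n. v $ i) \<in> borel_measurable borel"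
    by (intro borel_measurable_continuous_onI continuous_intros)
  from measurable_compose[OF assms this] show ?thesis .
qed

definition phase :: "real^'n::finite \<Rightarrow> real^'n \<Rightarrow> real^'n \<Rightarrow> real^'n \<Rightarrow> real" where
  "phase a x t \<xi> = (\<Sum>j\<in>UNIV. x $ j * \<xi> $ j + t $ j * \<bar>\<xi> $ j\<bar> powr (a $ j))"

text \<open>With \<open>G\<close> the Fourier transform of f this is formally (2 pi)^n times the
  operator at time \<open>t\<close>. It is meaningful for every real time, in particular at 0, where
  it is Fourier inversion.\<close>

definition osc_op :: "real^'n::finite \<Rightarrow> (real^'n \<Rightarrow> complex) \<Rightarrow> real^'n \<Rightarrow> real^'n \<Rightarrow> complex" where
  "osc_op a G x t = (LINT \<xi>|lborel. cis (phase a x t \<xi>) * G \<xi>)"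

definition weight :: "real^'n::finite \<Rightarrow> real" where
  "weight \<xi> = (\<Prod>j\<in>UNIV. sqrt \<bar>\<xi> $ j\<bar>)"

lemma phase_measurable [measurable (raw)]:
  assumes [measurable]: "x \<in> borel_measurable M" "t \<in> borel_measurable M" "\<xi> \<in> borel_measurable M"
  shows "(\<lambda>z. phase a (x z) (t z) (\<xi> z)) \<in> borel_measurable M"
  unfolding phase_def by measurable

lemma weight_measurable [measurable]: "weight \<in> borel_measurable borel"
  unfolding weight_def[abs_def] by measurable

lemma osc_op_measurable [measurable (raw)]:
  assumes [measurable]: "G \<in> borel_measurable borel" "x \<in> borel_measurable M" "t \<in> borel_measurable M"
  shows "(\<lambda>z. osc_op a G (x z) (t z)) \<in> borel_measurable M"
  unfolding osc_op_def by measurable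

lemma norm_osc_op_le:
  assumes "integrable lborel G"
  shows "norm (osc_op a G x t) \<le> (LINT \<xi>|lborel. norm (G \<xi>))"
proof -
  have "norm (osc_op a G x t) \<le> (LINT \<xi>|lborel. norm (cis (phase a x t \<xi>) * G \<xi>))"
    unfolding osc_op_def by (rule integral_norm_bound)
  then show ?thesis by (simp add: norm_mult)
qed

lemma phase_diff: "phase a x t \<xi> - phase a y s \<xi> = phase a (x - y) (t - s) \<xi>"
  unfolding phase_def sum_subtractf[symmetric] by (intro sum.cong) (auto simp: algebra_simps)

lemma cis_phase: "cis (phase a x t \<xi>) = (\<Prod>j\<in>UNIV. cis (x $ j * \<xi> $ j + t $ j * \<bar>\<xi> $ j\<bar> powr (a $ j)))"
  unfolding phase_def by (rule cis_sum) simp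

text \<open>A damped \<open>1 / weight\<close>, the multiplier that sits between the linearised
  operator and its adjoint. Damping each coordinate separately preserves the product
  structure.\<close>

definition reg_weight :: "real \<Rightarrow> real^'n::finite \<Rightarrow> real" where
  "reg_weight e \<xi> = (\<Prod>j\<in>UNIV. osc_amp e (\<xi> $ j))"

lemma reg_weight_measurable [measurable]: "reg_weight e \<in> borel_measurable borel"
  unfolding reg_weight_def[abs_def] by measurable

lemma osc_amp_nonneg: "osc_amp e s \<ge> 0" by (simp add: osc_amp_def)

lemma reg_weight_nonneg: "reg_weight e \<xi> \<ge> 0"
  unfolding reg_weight_def by (intro prod_nonneg) (simp add: osc_amp_nonneg)

lemma integrable_reg_weight:
  assumes "e > 0" shows "integrable lborel (reg_weight e :: real^'n::finite \<Rightarrow> real)"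
proof -
  have "integrable lborel (\<lambda>\<xi>::real^'n. \<Prod>j\<in>UNIV. complex_of_real (osc_amp e (\<xi> $ j)))"
    by (rule integral_prod_vec(1)) (rule integrable_of_real[OF integrable_osc_amp[OF assms]])
  from integrable_Re[OF this] show ?thesis by (simp add: reg_weight_def[abs_def] flip: of_real_prod)
qed

lemma reg_weight_fourier:
  assumes "e > 0"
  shows "(LINT \<xi>|lborel. of_real (reg_weight e \<xi>) * cis (phase a z t \<xi>)) =
    (\<Prod>j\<in>UNIV. LINT s|lborel. of_real (osc_amp e s) * cis (z $ j * s + t $ j * \<bar>s\<bar> powr (a $ j)))"
  unfolding reg_weight_def cis_phase of_real_prod prod.distrib[symmetric]
  by (rule integral_prod_vec(2)) (intro integrable_mult_cis integrable_osc_amp assms, measurable)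

lemma AE_coordinates_neq: "AE y in lborel. \<forall>j. (x::real^'n::finite) $ j \<noteq> y $ j"
proof -
  have "AE y in lborel. x $ j \<noteq> y $ j" for j
  proof -
    have "axis j 1 \<in> (Basis :: (real^'n) set)" by (auto simp: Basis_vec_def)
    from negligible_standard_hyperplane[OF this, of "x $ j"]
    have "negligible {y::real^'n. y $ j = x $ j}" by (simp add: inner_axis)
    then have "{y. y $ j = x $ j} \<in> null_sets lebesgue" by (simp add: negligible_iff_null_sets)
    then have "AE y in lebesgue. y \<notin> {y. y $ j = x $ j}" by (rule AE_not_in)
    then have "AE y in lborel. y \<notin> {y. y $ j = x $ j}" by (simp add: AE_completion_iff)
    then show ?thesis by eventually_elim auto
  qed
  then show ?thesis by (simp add: AE_all_countable)
qed

text \<open>On |s| at most 2 \<open>\<rho>\<close>, where all differences u - s lie, the Gaussian in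
  \<open>osc_amp 1\<close> is at least exp(-4 \<open>\<rho>\<close>^2). Hence the singularity is
  dominated by a multiple of a function known to be integrable.\<close>

lemma nn_integral_sqrt_sing_finite:
  obtains L where "L \<ge> 0" "\<And>u. \<bar>u\<bar> \<le> \<rho> \<Longrightarrow> (\<integral>\<^sup>+s. indicator {-\<rho>..\<rho>} s * ennreal (1 / sqrt \<bar>u - s\<bar>) \<partial>lborel) \<le> ennreal L"
proof
  let ?L = "exp (4 * \<rho>\<^sup>2) * (LINT s|lborel. osc_amp 1 s)"
  show "?L \<ge> 0" by (intro mult_nonneg_nonneg Bochner_Integration.integral_nonneg) (auto simp: osc_amp_nonneg)
  fix u :: real assume u: "\<bar>u\<bar> \<le> \<rho>"
  have "(\<integral>\<^sup>+s. indicator {-\<rho>..\<rho>} s * ennreal (1 / sqrt \<bar>u - s\<bar>) \<partial>lborel)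
      = (\<integral>\<^sup>+s. indicator {-\<rho>..\<rho>} (u + (-1) * s) * ennreal (1 / sqrt \<bar>u - (u + (-1) * s)\<bar>) \<partial>lborel)"
    by (subst nn_integral_real_affine[of _ "-1" u]) auto
  also have "\<dots> \<le> (\<integral>\<^sup>+s. ennreal (exp (4 * \<rho>\<^sup>2) * osc_amp 1 s) \<partial>lborel)"
  proof (rule nn_integral_mono)
    fix s :: real
    show "indicator {-\<rho>..\<rho>} (u + (-1) * s) * ennreal (1 / sqrt \<bar>u - (u + (-1) * s)\<bar>) \<le> ennreal (exp (4 * \<rho>\<^sup>2) * osc_amp 1 s)"
    proof (cases "u + (-1) * s \<in> {-\<rho>..\<rho>}")
      case True
      then have "\<bar>s\<bar> \<le> 2 * \<rho>" using u by auto
      then have "\<bar>s\<bar>\<^sup>2 \<le> (2 * \<rho>)\<^sup>2" by (intro power_mono) auto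
      then have "1 \<le> exp (4 * \<rho>\<^sup>2) * exp (- 1 * s\<^sup>2)" by (simp add: exp_add[symmetric] power_mult_distrib)
      then have "1 / sqrt \<bar>s\<bar> \<le> exp (4 * \<rho>\<^sup>2) * exp (- 1 * s\<^sup>2) / sqrt \<bar>s\<bar>" by (intro divide_right_mono) auto
      then show ?thesis using True by (auto simp: osc_amp_def intro!: ennreal_leI)
    qed auto
  qed
  also have "\<dots> = ennreal (exp (4 * \<rho>\<^sup>2) * (LINT s|lborel. osc_amp 1 s))"
    using integrable_osc_amp[of 1] by (subst nn_integral_eq_integral) (auto simp: osc_amp_nonneg)
  finally show "(\<integral>\<^sup>+s. indicator {-\<rho>..\<rho>} s * ennreal (1 / sqrt \<bar>u - s\<bar>) \<partial>lborel) \<le> ennreal ?L" .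
qed

definition cube :: "real \<Rightarrow> (real^'n::finite) set" where
  "cube \<rho> = {x. \<forall>j. \<bar>x $ j\<bar> \<le> \<rho>}"

lemma cube_measurable [measurable]: "cube \<rho> \<in> sets (borel :: (real^'n::finite) measure)"
proof -
  have "closed (cube \<rho> :: (real^'n) set)" unfolding cube_def
    by (intro closed_Collect_all closed_Collect_le continuous_intros)
  then show ?thesis by simp
qed

lemma indicator_cube: "(indicator (cube \<rho>) y :: ennreal) = (\<Prod>j\<in>UNIV. indicator {-\<rho>..\<rho>} (y $ j))"
proof (cases "y \<in> cube \<rho>")
  case True
  then have "y $ j \<in> {-\<rho>..\<rho>}" for j by (simp add: cube_def abs_le_iff minus_le_iff)
  then show ?thesis using True by simp
next
  case False
  then obtain j where "y $ j \<notin> {-\<rho>..\<rho>}" by (auto simp: cube_def abs_le_iff minus_le_iff)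
  then have "(\<Prod>j\<in>UNIV. indicator {-\<rho>..\<rho>} (y $ j) :: ennreal) = 0" by (intro prod_zero bexI[of _ j]) auto
  then show ?thesis using False by simp
qed

text \<open>The cube and the integrand are both products over the coordinates, so the constant for
  Schur's test is a product of one-dimensional ones and independent of \<open>x\<close>.\<close>

lemma riesz_product_integral:
  fixes C :: "'n::finite \<Rightarrow> real"
  assumes C: "\<And>j. C j \<ge> 0"
  obtains \<Lambda> where "\<Lambda> \<ge> 0" "\<And>x::real^'n. x \<in> cube \<rho> \<Longrightarrow>
    (\<integral>\<^sup>+y. indicator (cube \<rho>) y * ennreal (\<Prod>j\<in>UNIV. C j / sqrt \<bar>x $ j - y $ j\<bar>) \<partial>lborel) \<le> ennreal \<Lambda>"
proof -
  obtain L where L: "L \<ge> 0" "\<And>u. \<bar>u\<bar> \<le> \<rho> \<Longrightarrow> (\<integral>\<^sup>+s. indicator {-\<rho>..\<rho>} s * ennreal (1 / sqrt \<bar>u - s\<bar>) \<partial>lborel) \<le> ennreal L"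
    by (rule nn_integral_sqrt_sing_finite[of \<rho>], rule that)
  show thesis
  proof (rule that)
    show "(\<Prod>j\<in>UNIV. C j * L) \<ge> 0" using C L by (intro prod_nonneg) auto
    fix x :: "real^'n" assume x: "x \<in> cube \<rho>"
    have "(\<integral>\<^sup>+y. indicator (cube \<rho>) y * ennreal (\<Prod>j\<in>UNIV. C j / sqrt \<bar>x $ j - y $ j\<bar>) \<partial>lborel)
       = (\<integral>\<^sup>+y. (\<Prod>j\<in>UNIV. ennreal (C j) * (indicator {-\<rho>..\<rho>} (y $ j) * ennreal (1 / sqrt \<bar>x $ j - y $ j\<bar>))) \<partial>lborel)"
    proof (rule nn_integral_cong)
      fix y :: "real^'n"
      have "ennreal (\<Prod>j\<in>UNIV. C j / sqrt \<bar>x $ j - y $ j\<bar>) = (\<Prod>j\<in>UNIV. ennreal (C j) * ennreal (1 / sqrt \<bar>x $ j - y $ j\<bar>))"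
        using C by (subst prod_ennreal[symmetric]) (auto simp: ennreal_mult[symmetric])
      then show "indicator (cube \<rho>) y * ennreal (\<Prod>j\<in>UNIV. C j / sqrt \<bar>x $ j - y $ j\<bar>)
        = (\<Prod>j\<in>UNIV. ennreal (C j) * (indicator {-\<rho>..\<rho>} (y $ j) * ennreal (1 / sqrt \<bar>x $ j - y $ j\<bar>)))"
        unfolding indicator_cube by (simp add: prod.distrib mult_ac)
    qed
    also have "\<dots> = (\<Prod>j\<in>UNIV. \<integral>\<^sup>+s. ennreal (C j) * (indicator {-\<rho>..\<rho>} s * ennreal (1 / sqrt \<bar>x $ j - s\<bar>)) \<partial>lborel)"
      by (rule nn_integral_prod_vec) measurable
    also have "\<dots> \<le> (\<Prod>j\<in>UNIV. ennreal (C j * L))"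
    proof (rule prod_mono_ennreal)
      fix j
      have "(\<integral>\<^sup>+s. ennreal (C j) * (indicator {-\<rho>..\<rho>} s * ennreal (1 / sqrt \<bar>x $ j - s\<bar>)) \<partial>lborel)
          = ennreal (C j) * (\<integral>\<^sup>+s. indicator {-\<rho>..\<rho>} s * ennreal (1 / sqrt \<bar>x $ j - s\<bar>) \<partial>lborel)"
        by (rule nn_integral_cmult) measurable
      also have "\<dots> \<le> ennreal (C j) * ennreal L" using x by (intro mult_left_mono L) (auto simp: cube_def)
      finally show "(\<integral>\<^sup>+s. ennreal (C j) * (indicator {-\<rho>..\<rho>} s * ennreal (1 / sqrt \<bar>x $ j - s\<bar>)) \<partial>lborel) \<le> ennreal (C j * L)"
        unfolding ennreal_mult[OF C L(1)] .
    qed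
    also have "\<dots> = ennreal (\<Prod>j\<in>UNIV. C j * L)" using C L by (intro prod_ennreal) auto
    finally show "(\<integral>\<^sup>+y. indicator (cube \<rho>) y * ennreal (\<Prod>j\<in>UNIV. C j / sqrt \<bar>x $ j - y $ j\<bar>) \<partial>lborel) \<le> ennreal (\<Prod>j\<in>UNIV. C j * L)" .
  qed
qed

lemma integrable_bounded_mult:
  fixes f g :: "'a \<Rightarrow> complex"
  assumes f: "integrable M f" and [measurable]: "g \<in> borel_measurable M" and g: "\<And>x. norm (g x) \<le> B"
  shows "integrable M (\<lambda>x. f x * g x)"
proof (rule Bochner_Integration.integrable_bound[OF integrable_mult_right[OF f, of "of_real B"]])
  have B: "B \<ge> 0" using order_trans[OF norm_ge_zero g] .
  show "(\<lambda>x. f x * g x) \<in> borel_measurable M" using f by measurable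
  show "AE x in M. norm (f x * g x) \<le> norm (of_real B * f x)"
  proof (rule AE_I2)
    fix x
    show "norm (f x * g x) \<le> norm (of_real B * f x)"
      using mult_left_mono[OF g[of x], of "norm (f x)"] B by (simp add: norm_mult mult.commute)
  qed
qed

lemma Fubini_bounded:
  fixes u :: "'a::euclidean_space \<Rightarrow> complex" and v :: "'b::euclidean_space \<Rightarrow> complex" and k :: "'a \<Rightarrow> 'b \<Rightarrow> complex"
  assumes u: "integrable lborel u" and v: "integrable lborel v"
    and [measurable]: "case_prod k \<in> borel_measurable (borel \<Otimes>\<^sub>M borel)" and k: "\<And>x y. norm (k x y) \<le> B"
  shows "(LINT x|lborel. u x * (LINT y|lborel. k x y * v y)) = (LINT y|lborel. v y * (LINT x|lborel. k x y * u x))"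
proof -
  have [measurable]: "u \<in> borel_measurable borel" "v \<in> borel_measurable borel" using u v by auto
  have P: "integrable (lborel \<Otimes>\<^sub>M lborel) (\<lambda>(x, y). u x * (k x y * v y))"
  proof (rule Bochner_Integration.integrable_bound)
    show "integrable (lborel \<Otimes>\<^sub>M lborel) (\<lambda>(x, y). of_real B * (u x * v y))"
    proof (rule lborel_pair.Fubini_integrable)
      have "integrable lborel (\<lambda>x. norm (u x) * (LINT y|lborel. norm (v y)))"
        using u by (intro integrable_mult_left integrable_norm)
      from integrable_mult_right[OF this, of "\<bar>B\<bar>"]
      show "integrable lborel (\<lambda>x. LINT y|lborel. norm (case (x, y) of (x, y) \<Rightarrow> of_real B * (u x * v y)))"
        by (simp add: norm_mult mult_ac)
      show "AE x in lborel. integrable lborel (\<lambda>y. case (x, y) of (x, y) \<Rightarrow> of_real B * (u x * v y))"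
        by (simp add: v)
    qed measurable
    have "norm (u x * (k x y * v y)) \<le> norm (of_real B * (u x * v y))" for x y
    proof -
      have "norm (u x) * (norm (k x y) * norm (v y)) \<le> norm (u x) * (\<bar>B\<bar> * norm (v y))"
        by (intro mult_left_mono mult_right_mono order_trans[OF k abs_ge_self]) auto
      then show ?thesis by (simp add: norm_mult mult_ac)
    qed
    then show "AE z in lborel \<Otimes>\<^sub>M lborel. norm (case z of (x, y) \<Rightarrow> u x * (k x y * v y)) \<le> norm (case z of (x, y) \<Rightarrow> of_real B * (u x * v y))"
      by (auto simp: split_beta)
  qed measurable
  have "(LINT x|lborel. u x * (LINT y|lborel. k x y * v y)) = (LINT x|lborel. LINT y|lborel. u x * (k x y * v y))"
    unfolding integral_mult_right_zero ..
  also have "\<dots> = (LINT y|lborel. LINT x|lborel. u x * (k x y * v y))"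
    by (rule lborel_pair.Fubini_integral[OF P, symmetric])
  also have "\<dots> = (LINT y|lborel. LINT x|lborel. v y * (k x y * u x))" by (simp only: mult_ac)
  also have "\<dots> = (LINT y|lborel. v y * (LINT x|lborel. k x y * u x))" unfolding integral_mult_right_zero ..
  finally show ?thesis .
qed

text \<open>The product |w(x)| |w(y)| is at most half the sum of the squares. As \<open>H\<close> is
  even, exchanging x and y shows that both halves contribute equally, and in each the free variable
  is integrated over the cube at cost \<open>\<Lambda>\<close>.\<close>

lemma schur_bound:
  fixes w :: "real^'n::finite \<Rightarrow> complex" and H :: "real^'n \<Rightarrow> ennreal"
  assumes [measurable]: "w \<in> borel_measurable borel" "H \<in> borel_measurable borel"
    and even: "\<And>z. H (- z) = H z" and supp: "\<And>x. x \<notin> cube \<rho> \<Longrightarrow> w x = 0"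
    and H: "\<And>x. x \<in> cube \<rho> \<Longrightarrow> (\<integral>\<^sup>+y. indicator (cube \<rho>) y * H (x - y) \<partial>lborel) \<le> \<Lambda>"
  shows "(\<integral>\<^sup>+x. \<integral>\<^sup>+y. ennreal (norm (w x) * norm (w y)) * H (x - y) \<partial>lborel \<partial>lborel)
    \<le> \<Lambda> * (\<integral>\<^sup>+x. ennreal ((norm (w x))\<^sup>2) \<partial>lborel)"
proof -
  let ?I = "\<integral>\<^sup>+x. \<integral>\<^sup>+y. ennreal ((norm (w x))\<^sup>2 / 2) * (indicator (cube \<rho>) y * H (x - y)) \<partial>lborel \<partial>lborel"
  have half: "?I \<le> ennreal (1/2) * (\<Lambda> * (\<integral>\<^sup>+x. ennreal ((norm (w x))\<^sup>2) \<partial>lborel))"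
  proof -
    have "?I \<le> (\<integral>\<^sup>+x. ennreal (1/2) * \<Lambda> * ennreal ((norm (w x))\<^sup>2) \<partial>lborel)"
    proof (rule nn_integral_mono)
      fix x
      have "(\<integral>\<^sup>+y. ennreal ((norm (w x))\<^sup>2 / 2) * (indicator (cube \<rho>) y * H (x - y)) \<partial>lborel)
          = ennreal ((norm (w x))\<^sup>2 / 2) * (\<integral>\<^sup>+y. indicator (cube \<rho>) y * H (x - y) \<partial>lborel)"
        by (rule nn_integral_cmult) measurable
      also have "\<dots> \<le> ennreal ((norm (w x))\<^sup>2 / 2) * \<Lambda>"
      proof (cases "x \<in> cube \<rho>")
        case True
        then show ?thesis by (intro mult_left_mono H) auto
      qed (simp add: supp)
      also have "\<dots> = ennreal (1/2) * \<Lambda> * ennreal ((norm (w x))\<^sup>2)"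
      proof -
        have "ennreal ((norm (w x))\<^sup>2 / 2) = ennreal (1/2) * ennreal ((norm (w x))\<^sup>2)"
          by (subst ennreal_mult[symmetric]) auto
        then show ?thesis by (simp add: mult_ac)
      qed
      finally show "(\<integral>\<^sup>+y. ennreal ((norm (w x))\<^sup>2 / 2) * (indicator (cube \<rho>) y * H (x - y)) \<partial>lborel)
        \<le> ennreal (1/2) * \<Lambda> * ennreal ((norm (w x))\<^sup>2)" .
    qed
    also have "\<dots> = ennreal (1/2) * \<Lambda> * (\<integral>\<^sup>+x. ennreal ((norm (w x))\<^sup>2) \<partial>lborel)"
      by (rule nn_integral_cmult) measurable
    finally show ?thesis by (simp add: mult.assoc)
  qed
  have sym: "(\<integral>\<^sup>+x. \<integral>\<^sup>+y. ennreal ((norm (w y))\<^sup>2 / 2) * (indicator (cube \<rho>) x * H (x - y)) \<partial>lborel \<partial>lborel) = ?I"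
  proof -
    have "(\<integral>\<^sup>+x. \<integral>\<^sup>+y. ennreal ((norm (w y))\<^sup>2 / 2) * (indicator (cube \<rho>) x * H (x - y)) \<partial>lborel \<partial>lborel)
        = (\<integral>\<^sup>+y. \<integral>\<^sup>+x. ennreal ((norm (w y))\<^sup>2 / 2) * (indicator (cube \<rho>) x * H (x - y)) \<partial>lborel \<partial>lborel)"
      by (rule lborel_pair.Fubini') measurable
    also have "\<dots> = ?I"
      by (intro nn_integral_cong) (metis even minus_diff_eq)
    finally show ?thesis .
  qed
  have "(\<integral>\<^sup>+x. \<integral>\<^sup>+y. ennreal (norm (w x) * norm (w y)) * H (x - y) \<partial>lborel \<partial>lborel)
      \<le> (\<integral>\<^sup>+x. (\<integral>\<^sup>+y. ennreal ((norm (w x))\<^sup>2 / 2) * (indicator (cube \<rho>) y * H (x - y)) \<partial>lborel)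
          + (\<integral>\<^sup>+y. ennreal ((norm (w y))\<^sup>2 / 2) * (indicator (cube \<rho>) x * H (x - y)) \<partial>lborel) \<partial>lborel)"
  proof (rule nn_integral_mono)
    fix x
    have "(\<integral>\<^sup>+y. ennreal (norm (w x) * norm (w y)) * H (x - y) \<partial>lborel)
        \<le> (\<integral>\<^sup>+y. ennreal ((norm (w x))\<^sup>2 / 2) * (indicator (cube \<rho>) y * H (x - y))
           + ennreal ((norm (w y))\<^sup>2 / 2) * (indicator (cube \<rho>) x * H (x - y)) \<partial>lborel)"
    proof (rule nn_integral_mono)
      fix y
      show "ennreal (norm (w x) * norm (w y)) * H (x - y) \<le> ennreal ((norm (w x))\<^sup>2 / 2) * (indicator (cube \<rho>) y * H (x - y))
           + ennreal ((norm (w y))\<^sup>2 / 2) * (indicator (cube \<rho>) x * H (x - y))"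
      proof (cases "x \<in> cube \<rho> \<and> y \<in> cube \<rho>")
        case True
        have "norm (w x) * norm (w y) \<le> (norm (w x))\<^sup>2 / 2 + (norm (w y))\<^sup>2 / 2"
          using sum_squares_bound[of "norm (w x)" "norm (w y)"] by simp
        then have "ennreal (norm (w x) * norm (w y)) \<le> ennreal ((norm (w x))\<^sup>2 / 2) + ennreal ((norm (w y))\<^sup>2 / 2)"
          by (intro order_trans[OF ennreal_leI eq_refl[OF ennreal_plus]]) auto
        from mult_right_mono[OF this, of "H (x - y)"] show ?thesis using True by (simp add: distrib_right)
      next
        case False
        then have "norm (w x) * norm (w y) = 0" using supp by auto
        then show ?thesis by (simp only: ennreal_0 mult_zero_left zero_le)
      qed
    qed
    also have "\<dots> = (\<integral>\<^sup>+y. ennreal ((norm (w x))\<^sup>2 / 2) * (indicator (cube \<rho>) y * H (x - y)) \<partial>lborel)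
          + (\<integral>\<^sup>+y. ennreal ((norm (w y))\<^sup>2 / 2) * (indicator (cube \<rho>) x * H (x - y)) \<partial>lborel)"
      by (rule nn_integral_add) measurable
    finally show "(\<integral>\<^sup>+y. ennreal (norm (w x) * norm (w y)) * H (x - y) \<partial>lborel) \<le> \<dots>" .
  qed
  also have "\<dots> = ?I + (\<integral>\<^sup>+x. \<integral>\<^sup>+y. ennreal ((norm (w y))\<^sup>2 / 2) * (indicator (cube \<rho>) x * H (x - y)) \<partial>lborel \<partial>lborel)"
    by (rule nn_integral_add) measurable
  also have "\<dots> \<le> ennreal (1/2) * (\<Lambda> * (\<integral>\<^sup>+x. ennreal ((norm (w x))\<^sup>2) \<partial>lborel))
      + ennreal (1/2) * (\<Lambda> * (\<integral>\<^sup>+x. ennreal ((norm (w x))\<^sup>2) \<partial>lborel))"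
    unfolding sym by (intro add_mono half)
  also have "\<dots> = (ennreal (1/2) + ennreal (1/2)) * (\<Lambda> * (\<integral>\<^sup>+x. ennreal ((norm (w x))\<^sup>2) \<partial>lborel))"
    by (simp only: distrib_right)
  also have "ennreal (1/2) + ennreal (1/2) = 1" by (subst ennreal_plus[symmetric]) auto
  finally show ?thesis by simp
qed

lemma ennreal_norm_integral_le: "ennreal (norm (integral\<^sup>L M f)) \<le> (\<integral>\<^sup>+x. ennreal (norm (f x)) \<partial>M)"
  by (cases "integrable M f") (auto intro: integral_norm_bound_ennreal simp: not_integrable_integral_eq)

lemma cnj_measurable [measurable]: "cnj \<in> borel_measurable borel"
  by (intro borel_measurable_continuous_onI continuous_intros)

section \<open>The T T* argument for a measurable choice of times\<close>

context
  fixes a :: "real^'n::finite" and t :: "real^'n \<Rightarrow> real^'n" and w :: "real^'n \<Rightarrow> complex"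
    and W :: "real^'n \<Rightarrow> complex"
  assumes t [measurable]: "t \<in> borel_measurable borel" and w: "integrable lborel w"
  defines "W \<equiv> \<lambda>\<xi>. LINT x|lborel. cis (phase a x (t x) \<xi>) * w x"
begin

lemma w_measurable: "w \<in> borel_measurable borel" using w by auto

lemma W_measurable: "W \<in> borel_measurable borel"
proof -
  note [measurable] = w_measurable
  show ?thesis unfolding W_def by measurable
qed

lemma W_bounded: "norm (W \<xi>) \<le> (LINT x|lborel. norm (w x))"
proof -
  have "norm (W \<xi>) \<le> (LINT x|lborel. norm (cis (phase a x (t x) \<xi>) * w x))"
    unfolding W_def by (rule integral_norm_bound)
  then show ?thesis by (simp add: norm_mult)
qed

lemma cnj_W: "cnj (W \<xi>) = (LINT y|lborel. cis (- phase a y (t y) \<xi>) * cnj (w y))"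
  unfolding W_def by (simp flip: Bochner_Integration.integral_cnj add: cis_cnj)

lemma integrable_reg_weight_mult:
  fixes g :: "real^'n \<Rightarrow> complex"
  assumes e: "e > 0" and [measurable]: "g \<in> borel_measurable borel" and g: "\<And>\<xi>. norm (g \<xi>) \<le> B"
  shows "integrable lborel (\<lambda>\<xi>::real^'n. of_real (reg_weight e \<xi>) * g \<xi>)"
  by (rule integrable_bounded_mult[OF integrable_of_real[OF integrable_reg_weight[OF e]] _ g]) measurable

text \<open>Expand |W|^2 and exchange integrals twice, which is legitimate because \<open>w\<close>
  and \<open>reg_weight e\<close> are integrable and the exponentials have modulus 1. The phases at
  (x, t x) and (y, t y) subtract to a phase at (x - y, t x - t y), so the kernel is the transform of
  \<open>reg_weight\<close>.\<close>

lemma TTstar_identity: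
  assumes e: "e > 0"
  shows "(LINT \<xi>|lborel. (of_real (reg_weight e \<xi>) * cnj (W \<xi>)) * W \<xi>) =
    (LINT x|lborel. w x * (LINT y|lborel. cnj (w y) *
      (LINT \<xi>|lborel. of_real (reg_weight e \<xi>) * cis (phase a (x - y) (t x - t y) \<xi>))))"
proof -
  note [measurable] = w_measurable W_measurable
  have U: "integrable lborel (\<lambda>\<xi>. of_real (reg_weight e \<xi>) * cnj (W \<xi>))"
    by (rule integrable_reg_weight_mult[OF e]) (use W_bounded in auto)
  have "(LINT \<xi>|lborel. (of_real (reg_weight e \<xi>) * cnj (W \<xi>)) * W \<xi>)
      = (LINT x|lborel. w x * (LINT \<xi>|lborel. cis (phase a x (t x) \<xi>) * (of_real (reg_weight e \<xi>) * cnj (W \<xi>))))"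
    unfolding W_def
  proof (rule Fubini_bounded[OF U[unfolded W_def] w, of _ 1])
    show "(\<lambda>(\<xi>, x). cis (phase a x (t x) \<xi>)) \<in> borel_measurable (borel \<Otimes>\<^sub>M borel)" by measurable
  qed simp
  also have "(\<lambda>x. LINT \<xi>|lborel. cis (phase a x (t x) \<xi>) * (of_real (reg_weight e \<xi>) * cnj (W \<xi>)))
      = (\<lambda>x. LINT y|lborel. cnj (w y) * (LINT \<xi>|lborel. of_real (reg_weight e \<xi>) * cis (phase a (x - y) (t x - t y) \<xi>)))"
  proof
    fix x
    have u: "integrable lborel (\<lambda>\<xi>. of_real (reg_weight e \<xi>) * cis (phase a x (t x) \<xi>))"
      by (rule integrable_reg_weight_mult[OF e, of _ 1]) auto
    have v: "integrable lborel (\<lambda>y. cnj (w y))" using w by simp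
    have "(LINT \<xi>|lborel. cis (phase a x (t x) \<xi>) * (of_real (reg_weight e \<xi>) * cnj (W \<xi>)))
        = (LINT \<xi>|lborel. (of_real (reg_weight e \<xi>) * cis (phase a x (t x) \<xi>)) * (LINT y|lborel. cis (- phase a y (t y) \<xi>) * cnj (w y)))"
      unfolding cnj_W by (simp only: mult_ac)
    also have "\<dots> = (LINT y|lborel. cnj (w y) * (LINT \<xi>|lborel. cis (- phase a y (t y) \<xi>) * (of_real (reg_weight e \<xi>) * cis (phase a x (t x) \<xi>))))"
    proof (rule Fubini_bounded[OF u v, of _ 1])
      show "(\<lambda>(\<xi>, y). cis (- phase a y (t y) \<xi>)) \<in> borel_measurable (borel \<Otimes>\<^sub>M borel)" by measurable
    qed simp
    also have "\<dots> = (LINT y|lborel. cnj (w y) * (LINT \<xi>|lborel. of_real (reg_weight e \<xi>) * cis (phase a (x - y) (t x - t y) \<xi>)))"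
    proof -
      have "cis (- phase a y (t y) \<xi>) * (of_real (reg_weight e \<xi>) * cis (phase a x (t x) \<xi>))
          = of_real (reg_weight e \<xi>) * cis (phase a (x - y) (t x - t y) \<xi>)" for y \<xi>
        unfolding phase_diff[symmetric] by (simp add: cis_mult mult.left_commute)
      then show ?thesis by (simp only:)
    qed
    finally show "(LINT \<xi>|lborel. cis (phase a x (t x) \<xi>) * (of_real (reg_weight e \<xi>) * cnj (W \<xi>)))
      = (LINT y|lborel. cnj (w y) * (LINT \<xi>|lborel. of_real (reg_weight e \<xi>) * cis (phase a (x - y) (t x - t y) \<xi>)))" .
  qed
  finally show ?thesis .
qed

text \<open>The kernel factorises into one-dimensional integrals, each bounded independently of the
  time difference. So the unknown function \<open>t\<close> disappears from the estimate, and what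
  remains is a positive even convolution kernel on the cube, ready for Schur's test.\<close>

lemma reg_TTstar_bound:
  assumes e: "e > 0"
    and C: "\<And>j. C j > 0" "\<And>j x s. x \<noteq> 0 \<Longrightarrow>
      norm (LINT r|lborel. of_real (osc_amp e r) * cis (x * r + s * \<bar>r\<bar> powr (a $ j))) \<le> C j / sqrt \<bar>x\<bar>"
    and supp: "\<And>x. x \<notin> cube \<rho> \<Longrightarrow> w x = 0"
    and \<Lambda>: "\<And>x::real^'n. x \<in> cube \<rho> \<Longrightarrow>
      (\<integral>\<^sup>+y. indicator (cube \<rho>) y * ennreal (\<Prod>j\<in>UNIV. C j / sqrt \<bar>x $ j - y $ j\<bar>) \<partial>lborel) \<le> \<Lambda>"
  shows "(\<integral>\<^sup>+\<xi>. ennreal (reg_weight e \<xi> * (norm (W \<xi>))\<^sup>2) \<partial>lborel) \<le> \<Lambda> * (\<integral>\<^sup>+x. ennreal ((norm (w x))\<^sup>2) \<partial>lborel)"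
proof -
  note [measurable] = w_measurable W_measurable
  define H where "H z = ennreal (\<Prod>j\<in>UNIV. C j / sqrt \<bar>z $ j\<bar>)" for z :: "real^'n"
  define K where "K x y = (LINT \<xi>|lborel. of_real (reg_weight e \<xi>) * cis (phase a (x - y) (t x - t y) \<xi>))" for x y
  \<comment> \<open>Where x and y share a coordinate, division by zero makes the right-hand side 0;
    the bound is claimed off these null hyperplanes.\<close>
  have Kle: "AE y in lborel. ennreal (norm (K x y)) \<le> H (x - y)" for x
    using AE_coordinates_neq[of x]
  proof eventually_elim
    case (elim y)
    have "norm (K x y) \<le> (\<Prod>j\<in>UNIV. C j / sqrt \<bar>(x - y) $ j\<bar>)"
      unfolding K_def reg_weight_fourier[OF e] prod_norm[symmetric]
      using elim by (intro prod_mono conjI C(2)) auto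
    then show ?case unfolding H_def by (rule ennreal_leI)
  qed
  have int: "integrable lborel (\<lambda>\<xi>. of_real (reg_weight e \<xi>) * (cnj (W \<xi>) * W \<xi>))"
  proof (rule integrable_reg_weight_mult[OF e])
    show "norm (cnj (W \<xi>) * W \<xi>) \<le> (LINT x|lborel. norm (w x)) * (LINT x|lborel. norm (w x))" for \<xi>
      unfolding norm_mult complex_mod_cnj by (intro mult_mono W_bounded) (auto intro: Bochner_Integration.integral_nonneg)
  qed measurable
  have eq: "of_real (reg_weight e \<xi>) * (cnj (W \<xi>) * W \<xi>) = of_real (reg_weight e \<xi> * (norm (W \<xi>))\<^sup>2)" for \<xi>
    using complex_norm_square[of "W \<xi>"] by (simp add: mult.commute)
  have int': "integrable lborel (\<lambda>\<xi>. reg_weight e \<xi> * (norm (W \<xi>))\<^sup>2)"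
    using integrable_Re[OF int[unfolded eq]] by simp
  have "(\<integral>\<^sup>+\<xi>. ennreal (reg_weight e \<xi> * (norm (W \<xi>))\<^sup>2) \<partial>lborel) = ennreal (LINT \<xi>|lborel. reg_weight e \<xi> * (norm (W \<xi>))\<^sup>2)"
    by (rule nn_integral_eq_integral[OF int']) (simp add: reg_weight_nonneg)
  also have "(LINT \<xi>|lborel. reg_weight e \<xi> * (norm (W \<xi>))\<^sup>2) = norm (LINT \<xi>|lborel. (of_real (reg_weight e \<xi>) * cnj (W \<xi>)) * W \<xi>)"
  proof -
    have "(LINT \<xi>|lborel. (of_real (reg_weight e \<xi>) * cnj (W \<xi>)) * W \<xi>) = complex_of_real (LINT \<xi>|lborel. reg_weight e \<xi> * (norm (W \<xi>))\<^sup>2)"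
      unfolding mult.assoc eq by (rule integral_complex_of_real)
    moreover have "(LINT \<xi>|lborel. reg_weight e \<xi> * (norm (W \<xi>))\<^sup>2) \<ge> 0"
      by (rule Bochner_Integration.integral_nonneg) (simp add: reg_weight_nonneg)
    ultimately show ?thesis by simp
  qed
  also have "\<dots> = norm (LINT x|lborel. w x * (LINT y|lborel. cnj (w y) * K x y))"
    unfolding TTstar_identity[OF e] K_def ..
  also have "ennreal \<dots> \<le> (\<integral>\<^sup>+x. ennreal (norm (w x * (LINT y|lborel. cnj (w y) * K x y))) \<partial>lborel)"
    by (rule ennreal_norm_integral_le)
  also have "\<dots> \<le> (\<integral>\<^sup>+x. \<integral>\<^sup>+y. ennreal (norm (w x) * norm (w y)) * H (x - y) \<partial>lborel \<partial>lborel)"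
  proof (rule nn_integral_mono)
    fix x
    have "ennreal (norm (w x * (LINT y|lborel. cnj (w y) * K x y))) = ennreal (norm (LINT y|lborel. w x * (cnj (w y) * K x y)))"
      by simp
    also have "\<dots> \<le> (\<integral>\<^sup>+y. ennreal (norm (w x * (cnj (w y) * K x y))) \<partial>lborel)" by (rule ennreal_norm_integral_le)
    also have "\<dots> \<le> (\<integral>\<^sup>+y. ennreal (norm (w x) * norm (w y)) * H (x - y) \<partial>lborel)"
    proof (rule nn_integral_mono_AE)
      show "AE y in lborel. ennreal (norm (w x * (cnj (w y) * K x y))) \<le> ennreal (norm (w x) * norm (w y)) * H (x - y)"
        using Kle[of x]
      proof eventually_elim
        case (elim y)
        have "ennreal (norm (w x * (cnj (w y) * K x y))) = ennreal (norm (w x) * norm (w y)) * ennreal (norm (K x y))"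
          by (simp add: norm_mult ennreal_mult mult.assoc)
        also have "\<dots> \<le> ennreal (norm (w x) * norm (w y)) * H (x - y)" by (rule mult_left_mono[OF elim]) simp
        finally show ?case .
      qed
    qed
    finally show "ennreal (norm (w x * (LINT y|lborel. cnj (w y) * K x y))) \<le> \<dots>" .
  qed
  also have "\<dots> \<le> \<Lambda> * (\<integral>\<^sup>+x. ennreal ((norm (w x))\<^sup>2) \<partial>lborel)"
  proof (rule schur_bound[OF _ _ _ supp])
    show "H (- z) = H z" for z by (simp add: H_def)
    show "(\<integral>\<^sup>+y. indicator (cube \<rho>) y * H (x - y) \<partial>lborel) \<le> \<Lambda>" if "x \<in> cube \<rho>" for x
      using \<Lambda>[OF that] by (simp add: H_def)
    show "H \<in> borel_measurable borel" unfolding H_def by measurable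
  qed measurable
  finally show ?thesis .
qed

text \<open>Fatou's lemma removes the damping, since the previous bound does not depend on
  it.\<close>

lemma TTstar_bound:
  assumes C: "\<And>j. C j > 0" "\<And>j x s e. x \<noteq> 0 \<Longrightarrow> e > 0 \<Longrightarrow>
      norm (LINT r|lborel. of_real (osc_amp e r) * cis (x * r + s * \<bar>r\<bar> powr (a $ j))) \<le> C j / sqrt \<bar>x\<bar>"
    and supp: "\<And>x. x \<notin> cube \<rho> \<Longrightarrow> w x = 0"
    and \<Lambda>: "\<And>x::real^'n. x \<in> cube \<rho> \<Longrightarrow>
      (\<integral>\<^sup>+y. indicator (cube \<rho>) y * ennreal (\<Prod>j\<in>UNIV. C j / sqrt \<bar>x $ j - y $ j\<bar>) \<partial>lborel) \<le> \<Lambda>"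
  shows "(\<integral>\<^sup>+\<xi>. ennreal ((norm (W \<xi>))\<^sup>2 / weight \<xi>) \<partial>lborel) \<le> \<Lambda> * (\<integral>\<^sup>+x. ennreal ((norm (w x))\<^sup>2) \<partial>lborel)"
proof -
  note [measurable] = w_measurable W_measurable
  let ?u = "\<lambda>n \<xi>. ennreal (reg_weight (1 / real (Suc n)) \<xi> * (norm (W \<xi>))\<^sup>2)"
  \<comment> \<open>If a coordinate of \<open>\<xi>\<close> is 0, division by zero makes both
    \<open>reg_weight\<close> and \<open>1 / weight\<close> vanish, so the limit holds at every
    point.\<close>
  have lim: "(\<lambda>n. ?u n \<xi>) \<longlonglongrightarrow> ennreal ((norm (W \<xi>))\<^sup>2 / weight \<xi>)" for \<xi>
  proof -
    have "(\<lambda>n. 1 / real (Suc n)) \<longlonglongrightarrow> 0" by real_asymp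
    then have "(\<lambda>n. reg_weight (1 / real (Suc n)) \<xi>) \<longlonglongrightarrow> (\<Prod>j\<in>UNIV. exp (- 0 * (\<xi> $ j)\<^sup>2) / sqrt \<bar>\<xi> $ j\<bar>)"
      unfolding reg_weight_def osc_amp_def divide_inverse[of "exp _"] by (intro tendsto_intros)
    also have "(\<Prod>j\<in>UNIV. exp (- 0 * (\<xi> $ j)\<^sup>2) / sqrt \<bar>\<xi> $ j\<bar>) = 1 / weight \<xi>"
      by (simp add: weight_def prod_dividef)
    finally have "(\<lambda>n. reg_weight (1 / real (Suc n)) \<xi> * (norm (W \<xi>))\<^sup>2) \<longlonglongrightarrow> 1 / weight \<xi> * (norm (W \<xi>))\<^sup>2"
      by (intro tendsto_intros)
    from tendsto_ennrealI[OF this] show ?thesis by simp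
  qed
  have "(\<integral>\<^sup>+\<xi>. ennreal ((norm (W \<xi>))\<^sup>2 / weight \<xi>) \<partial>lborel) = (\<integral>\<^sup>+\<xi>. liminf (\<lambda>n. ?u n \<xi>) \<partial>lborel)"
    using lim_imp_Liminf[OF _ lim] by simp
  also have "\<dots> \<le> liminf (\<lambda>n. \<integral>\<^sup>+\<xi>. ?u n \<xi> \<partial>lborel)" by (rule nn_integral_liminf) measurable
  also have "\<dots> \<le> limsup (\<lambda>n. \<integral>\<^sup>+\<xi>. ?u n \<xi> \<partial>lborel)" by (rule Liminf_le_Limsup) simp
  also have "\<dots> \<le> \<Lambda> * (\<integral>\<^sup>+x. ennreal ((norm (w x))\<^sup>2) \<partial>lborel)"
    by (intro Limsup_bounded always_eventually allI reg_TTstar_bound[where \<rho>=\<rho> and C=C]) (auto intro: C supp \<Lambda>)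
  finally show ?thesis .
qed

end

lemma weight_nonneg: "weight \<xi> \<ge> 0"
  unfolding weight_def by (intro prod_nonneg) auto

lemma AE_weight_pos: "AE \<xi> in lborel. weight \<xi> > 0"
  using AE_coordinates_neq[of 0]
  by eventually_elim (auto simp: weight_def intro!: prod_pos)

lemma bounded_cube: "bounded (cube \<rho> :: (real^'n::finite) set)"
proof -
  have "cube \<rho> \<subseteq> cbox ((\<chi> i. - \<rho>) :: real^'n) (\<chi> i. \<rho>)"
    by (auto simp: cube_def mem_box_cart abs_le_iff minus_le_iff)
  then show ?thesis using bounded_cbox bounded_subset by blast
qed

lemma emeasure_cube_finite: "emeasure lborel (cube \<rho> :: (real^'n::finite) set) < \<infinity>"
  by (rule emeasure_bounded_finite[OF bounded_cube])

lemma integrable_cube_bounded: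
  fixes f :: "real^'n::finite \<Rightarrow> complex"
  assumes [measurable]: "f \<in> borel_measurable borel" and f: "\<And>x. norm (f x) \<le> B"
  shows "integrable lborel (\<lambda>x. indicator (cube \<rho>) x * f x)"
proof -
  have "integrable lborel (indicator (cube \<rho> :: (real^'n) set) :: _ \<Rightarrow> real)"
    by (rule integrable_real_indicator[OF _ emeasure_cube_finite]) measurable
  from integrable_of_real[OF this]
  have "integrable lborel (\<lambda>x. complex_of_real (indicator (cube \<rho>) x) * f x)"
    by (rule integrable_bounded_mult[OF _ _ f]) measurable
  then show ?thesis unfolding of_real_indicator .
qed

text \<open>Pair the operator with \<open>w\<close>, its own conjugate cut off to the cube. By
  Fubini A = ||w||^2 is the integral of G W; Cauchy-Schwarz with \<open>weight\<close> split evenly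
  gives A^2 at most N \<open>\<Lambda>\<close> A. Cancelling A requires it to be finite, which holds
  as the operator is bounded by the integral of |G| and the cube has finite measure.\<close>

theorem maximal_linearized:
  fixes a :: "real^'n::finite"
  assumes a: "\<And>j. a $ j > 1"
  obtains C where "C \<ge> 0" "\<And>G t. integrable lborel G \<Longrightarrow> t \<in> borel_measurable borel \<Longrightarrow>
    (\<integral>\<^sup>+x. indicator (cube \<rho>) x * ennreal ((norm (osc_op a G x (t x)))\<^sup>2) \<partial>lborel)
      \<le> ennreal C * (\<integral>\<^sup>+\<xi>. ennreal (weight \<xi> * (norm (G \<xi>))\<^sup>2) \<partial>lborel)"
proof -
  define good where "good j C \<longleftrightarrow> C > 0 \<and> (\<forall>x s e. x \<noteq> 0 \<longrightarrow> e > 0 \<longrightarrow>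
      norm (LINT r|lborel. of_real (osc_amp e r) * cis (x * r + s * \<bar>r\<bar> powr (a $ j))) \<le> C / sqrt \<bar>x\<bar>)" for j C
  have "\<forall>j. \<exists>C. good j C"
  proof
    fix j
    obtain C where "C > 0" "\<And>x s e. x \<noteq> 0 \<Longrightarrow> e > 0 \<Longrightarrow>
      norm (LINT r|lborel. of_real (osc_amp e r) * cis (x * r + s * \<bar>r\<bar> powr (a $ j))) \<le> C / sqrt \<bar>x\<bar>"
      by (rule osc_kernel_bound[OF a[of j]], rule that)
    then have "good j C" unfolding good_def by blast
    then show "\<exists>C. good j C" ..
  qed
  from choice[OF this] obtain C where "\<forall>j. good j (C j)" ..
  then have C: "\<And>j. C j > 0" "\<And>j x s e. x \<noteq> 0 \<Longrightarrow> e > 0 \<Longrightarrow>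
      norm (LINT r|lborel. of_real (osc_amp e r) * cis (x * r + s * \<bar>r\<bar> powr (a $ j))) \<le> C j / sqrt \<bar>x\<bar>"
    unfolding good_def by blast+
  obtain \<Lambda> where \<Lambda>: "\<Lambda> \<ge> 0" "\<And>x::real^'n. x \<in> cube \<rho> \<Longrightarrow>
    (\<integral>\<^sup>+y. indicator (cube \<rho>) y * ennreal (\<Prod>j\<in>UNIV. C j / sqrt \<bar>x $ j - y $ j\<bar>) \<partial>lborel) \<le> ennreal \<Lambda>"
    by (rule riesz_product_integral[of C \<rho>, OF less_imp_le[OF C(1)]], rule that)
  show thesis
  proof (rule that[OF \<Lambda>(1)])
    fix G :: "real^'n \<Rightarrow> complex" and t :: "real^'n \<Rightarrow> real^'n"
    assume G: "integrable lborel G" and t [measurable]: "t \<in> borel_measurable borel"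
    have [measurable]: "G \<in> borel_measurable borel" using G by auto
    define S where "S x = osc_op a G x (t x)" for x
    define w where "w x = indicator (cube \<rho>) x * cnj (S x)" for x
    define W where "W \<xi> = (LINT x|lborel. cis (phase a x (t x) \<xi>) * w x)" for \<xi>
    define A where "A = (\<integral>\<^sup>+x. ennreal ((norm (w x))\<^sup>2) \<partial>lborel)"
    define N where "N = (\<integral>\<^sup>+\<xi>. ennreal (weight \<xi> * (norm (G \<xi>))\<^sup>2) \<partial>lborel)"
    let ?M = "LINT \<xi>|lborel. norm (G \<xi>)"
    have [measurable]: "S \<in> borel_measurable borel" unfolding S_def by measurable
    have S: "norm (cnj (S x)) \<le> ?M" for x unfolding S_def using norm_osc_op_le[OF G] by simp
    have w: "integrable lborel w" unfolding w_def by (rule integrable_cube_bounded[OF _ S]) measurable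
    have [measurable]: "w \<in> borel_measurable borel" using w by auto
    have [measurable]: "W \<in> borel_measurable borel" unfolding W_def by measurable
    have WA: "(\<integral>\<^sup>+\<xi>. ennreal ((norm (W \<xi>))\<^sup>2 / weight \<xi>) \<partial>lborel) \<le> ennreal \<Lambda> * A"
      unfolding W_def A_def
      by (rule TTstar_bound[OF t w C, of \<rho>]) (auto simp: w_def \<Lambda>)
    have Aeq: "A = (\<integral>\<^sup>+x. indicator (cube \<rho>) x * ennreal ((norm (S x))\<^sup>2) \<partial>lborel)"
      unfolding A_def by (intro nn_integral_cong) (auto simp: w_def indicator_def)
    have Afin: "A < \<infinity>"
    proof -
      have "A \<le> (\<integral>\<^sup>+x. ennreal (?M\<^sup>2) * indicator (cube \<rho> :: (real^'n) set) x \<partial>lborel)"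
        unfolding Aeq using S by (intro nn_integral_mono) (auto simp: indicator_def intro!: ennreal_leI power_mono)
      also have "\<dots> = ennreal (?M\<^sup>2) * emeasure lborel (cube \<rho> :: (real^'n) set)"
        by (rule nn_integral_cmult_indicator) measurable
      also have "\<dots> < \<infinity>" using emeasure_cube_finite[of \<rho>, where 'n='n] by (simp add: ennreal_mult_less_top)
      finally show ?thesis .
    qed
    have "A \<le> (\<integral>\<^sup>+\<xi>. ennreal (norm (G \<xi> * W \<xi>)) \<partial>lborel)"
    proof -
      have eq: "w x * S x = of_real ((norm (w x))\<^sup>2)" for x
      proof (cases "x \<in> cube \<rho>")
        case True
        then show ?thesis using complex_norm_square[of "S x"] by (simp add: w_def mult.commute)
      qed (simp add: w_def)
      have int: "integrable lborel (\<lambda>x. w x * S x)"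
        by (rule integrable_bounded_mult[OF w, of _ ?M]) (use S in auto)
      have int': "integrable lborel (\<lambda>x. (norm (w x))\<^sup>2)" using integrable_Re[OF int[unfolded eq]] by simp
      have "A = ennreal (LINT x|lborel. (norm (w x))\<^sup>2)"
        unfolding A_def by (rule nn_integral_eq_integral[OF int']) simp
      also have "(LINT x|lborel. (norm (w x))\<^sup>2) = norm (LINT x|lborel. w x * S x)"
        unfolding eq integral_complex_of_real by (simp add: Bochner_Integration.integral_nonneg)
      also have "(LINT x|lborel. w x * S x) = (LINT \<xi>|lborel. G \<xi> * W \<xi>)"
        unfolding S_def osc_op_def W_def
      proof (rule Fubini_bounded[OF w G, of _ 1])
        show "(\<lambda>(x, \<xi>). cis (phase a x (t x) \<xi>)) \<in> borel_measurable (borel \<Otimes>\<^sub>M borel)" by measurable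
      qed simp
      finally show ?thesis using ennreal_norm_integral_le[of lborel "\<lambda>\<xi>. G \<xi> * W \<xi>"] by simp
    qed
    also have "\<dots> = (\<integral>\<^sup>+\<xi>. ennreal (sqrt (weight \<xi>) * norm (G \<xi>)) * ennreal (norm (W \<xi>) / sqrt (weight \<xi>)) \<partial>lborel)"
    proof (rule nn_integral_cong_AE)
      show "AE \<xi> in lborel. ennreal (norm (G \<xi> * W \<xi>)) = ennreal (sqrt (weight \<xi>) * norm (G \<xi>)) * ennreal (norm (W \<xi>) / sqrt (weight \<xi>))"
        using AE_weight_pos
        by eventually_elim (simp add: norm_mult ennreal_mult[symmetric])
    qed
    finally have "A\<^sup>2 \<le> (\<integral>\<^sup>+\<xi>. ennreal (sqrt (weight \<xi>) * norm (G \<xi>)) * ennreal (norm (W \<xi>) / sqrt (weight \<xi>)) \<partial>lborel)\<^sup>2"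
      by (intro power_mono) auto
    also have "\<dots> \<le> (\<integral>\<^sup>+\<xi>. (ennreal (sqrt (weight \<xi>) * norm (G \<xi>)))\<^sup>2 \<partial>lborel) * (\<integral>\<^sup>+\<xi>. (ennreal (norm (W \<xi>) / sqrt (weight \<xi>)))\<^sup>2 \<partial>lborel)"
      by (rule Cauchy_Schwarz_nn_integral) measurable
    also have "(\<integral>\<^sup>+\<xi>. (ennreal (sqrt (weight \<xi>) * norm (G \<xi>)))\<^sup>2 \<partial>lborel) = N"
      unfolding N_def by (intro nn_integral_cong) (simp add: ennreal_power power_mult_distrib weight_nonneg)
    also have "(\<integral>\<^sup>+\<xi>. (ennreal (norm (W \<xi>) / sqrt (weight \<xi>)))\<^sup>2 \<partial>lborel) = (\<integral>\<^sup>+\<xi>. ennreal ((norm (W \<xi>))\<^sup>2 / weight \<xi>) \<partial>lborel)"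
      by (intro nn_integral_cong) (simp add: ennreal_power power_divide weight_nonneg)
    also have "N * \<dots> \<le> N * (ennreal \<Lambda> * A)" by (rule mult_left_mono[OF WA]) simp
    finally have "A * A \<le> A * (ennreal \<Lambda> * N)" by (simp add: power2_eq_square mult_ac)
    then have "A \<le> ennreal \<Lambda> * N"
      using Afin by (cases "A = 0") (auto simp: ennreal_mult_le_mult_iff)
    then show "(\<integral>\<^sup>+x. indicator (cube \<rho>) x * ennreal ((norm (osc_op a G x (t x)))\<^sup>2) \<partial>lborel)
        \<le> ennreal \<Lambda> * (\<integral>\<^sup>+\<xi>. ennreal (weight \<xi> * (norm (G \<xi>))\<^sup>2) \<partial>lborel)"
      unfolding Aeq S_def N_def .
  qed
qed

section \<open>From measurable times to the supremum over all times\<close>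

lemma continuous_osc_op:
  fixes G :: "real^'n::finite \<Rightarrow> complex"
  assumes G: "integrable lborel G"
  shows "continuous_on UNIV (osc_op a G x)"
  unfolding continuous_on_sequentially
proof (intro allI ballI impI, elim conjE)
  fix t and T :: "nat \<Rightarrow> real^'n" assume T: "T \<longlonglongrightarrow> t"
  have [measurable]: "G \<in> borel_measurable borel" using G by auto
  show "(osc_op a G x \<circ> T) \<longlonglongrightarrow> osc_op a G x t"
    unfolding osc_op_def o_def
  proof (rule integral_dominated_convergence[where w="\<lambda>\<xi>. norm (G \<xi>)"])
    show "AE \<xi> in lborel. (\<lambda>n. cis (phase a x (T n) \<xi>) * G \<xi>) \<longlonglongrightarrow> cis (phase a x t \<xi>) * G \<xi>"
      unfolding phase_def cis.ctr complex_eq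
      by (intro AE_I2 tendsto_intros T)
  qed (use G in \<open>auto simp: norm_mult\<close>)
qed

text \<open>A point among \<open>d 0\<close>, ..., \<open>d n\<close> at which |S x| is largest. The
  explicit recursion, with strict comparison to settle ties, makes it measurable in
  \<open>x\<close>.\<close>

primrec argmax_time :: "(real^'n::finite \<Rightarrow> real^'n \<Rightarrow> complex) \<Rightarrow> (nat \<Rightarrow> real^'n) \<Rightarrow> nat \<Rightarrow> real^'n \<Rightarrow> real^'n" where
  "argmax_time S d 0 = (\<lambda>x. d 0)"
| "argmax_time S d (Suc n) = (\<lambda>x. if norm (S x (argmax_time S d n x)) < norm (S x (d (Suc n))) then d (Suc n) else argmax_time S d n x)"

lemma argmax_time_ge: "i \<le> n \<Longrightarrow> norm (S x (d i)) \<le> norm (S x (argmax_time S d n x))"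
proof (induction n)
  case (Suc n)
  then show ?case by (cases "i = Suc n") auto
qed auto

lemma argmax_time_incseq: "incseq (\<lambda>n. norm (S x (argmax_time S d n x)))"
  by (rule incseq_SucI) auto

lemma argmax_time_measurable:
  assumes S: "\<And>t. t \<in> borel_measurable borel \<Longrightarrow> (\<lambda>x. S x (t x)) \<in> borel_measurable borel"
  shows "argmax_time S d n \<in> borel_measurable borel"
proof (induction n)
  case (Suc n)
  have [measurable]: "(\<lambda>x. S x (argmax_time S d n x)) \<in> borel_measurable borel" by (rule S[OF Suc])
  have [measurable]: "(\<lambda>x. S x (d (Suc n))) \<in> borel_measurable borel" by (rule S) simp
  have "(\<lambda>x. if norm (S x (argmax_time S d n x)) < norm (S x (d (Suc n))) then d (Suc n) else argmax_time S d n x) \<in> borel_measurable borel"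
    by (intro measurable_If Suc measurable_const) measurable
  then show ?case by simp
qed simp

text \<open>Apply the linearised bound to the maximisers over the first points of a dense sequence
  of times and pass to the supremum by monotone convergence; continuity in time extends the majorant
  to all times. A measurable \<open>M\<close> is produced so that the uncountable supremum itself is
  never integrated.\<close>

theorem maximal_bound:
  fixes a :: "real^'n::finite"
  assumes a: "\<And>j. a $ j > 1"
  obtains C where "C \<ge> 0" "\<And>G. integrable lborel G \<Longrightarrow>
    \<exists>M\<in>borel_measurable borel. (\<forall>x t. ennreal ((norm (osc_op a G x t))\<^sup>2) \<le> M x) \<and>
      (\<integral>\<^sup>+x. indicator (cube \<rho>) x * M x \<partial>lborel) \<le> ennreal C * (\<integral>\<^sup>+\<xi>. ennreal (weight \<xi> * (norm (G \<xi>))\<^sup>2) \<partial>lborel)"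
proof -
  obtain C where C: "C \<ge> 0" "\<And>G t. integrable lborel G \<Longrightarrow> t \<in> borel_measurable borel \<Longrightarrow>
    (\<integral>\<^sup>+x. indicator (cube \<rho>) x * ennreal ((norm (osc_op a G x (t x)))\<^sup>2) \<partial>lborel)
      \<le> ennreal C * (\<integral>\<^sup>+\<xi>. ennreal (weight \<xi> * (norm (G \<xi>))\<^sup>2) \<partial>lborel)"
    by (rule maximal_linearized[OF a, of \<rho>], rule that)
  obtain D :: "(real^'n) set" where D: "countable D" "\<And>X. open X \<Longrightarrow> X \<noteq> {} \<Longrightarrow> \<exists>d\<in>D. d \<in> X"
    using countable_dense_setE by blast
  have "D \<noteq> {}" using D(2)[of UNIV] by auto
  then have "range (from_nat_into D) = D" by (rule range_from_nat_into[OF _ D(1)])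
  then obtain d :: "nat \<Rightarrow> real^'n" where d: "range d = D" by (rule that)
  show thesis
  proof (rule that[OF C(1)])
    fix G :: "real^'n \<Rightarrow> complex" assume G: "integrable lborel G"
    have [measurable]: "G \<in> borel_measurable borel" using G by auto
    let ?S = "osc_op a G"
    have tm [measurable]: "argmax_time ?S d n \<in> borel_measurable borel" for n
      by (rule argmax_time_measurable) measurable
    define m where "m n x = ennreal ((norm (?S x (argmax_time ?S d n x)))\<^sup>2)" for n x
    have [measurable]: "m n \<in> borel_measurable borel" for n unfolding m_def by measurable
    have inc: "incseq (\<lambda>n. m n x)" for x
      unfolding m_def using argmax_time_incseq[of ?S x d] by (auto simp: incseq_def intro!: ennreal_leI power_mono)
    show "\<exists>M\<in>borel_measurable borel. (\<forall>x t. ennreal ((norm (osc_op a G x t))\<^sup>2) \<le> M x) \<and>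
      (\<integral>\<^sup>+x. indicator (cube \<rho>) x * M x \<partial>lborel) \<le> ennreal C * (\<integral>\<^sup>+\<xi>. ennreal (weight \<xi> * (norm (G \<xi>))\<^sup>2) \<partial>lborel)"
    proof (intro bexI conjI allI)
      show "(\<lambda>x. SUP n. m n x) \<in> borel_measurable borel" by measurable
      show "(\<integral>\<^sup>+x. indicator (cube \<rho>) x * (SUP n. m n x) \<partial>lborel) \<le> ennreal C * (\<integral>\<^sup>+\<xi>. ennreal (weight \<xi> * (norm (G \<xi>))\<^sup>2) \<partial>lborel)"
      proof -
        have "(\<integral>\<^sup>+x. indicator (cube \<rho>) x * (SUP n. m n x) \<partial>lborel) = (\<integral>\<^sup>+x. (SUP n. indicator (cube \<rho>) x * m n x) \<partial>lborel)"
          by (simp add: SUP_mult_left_ennreal)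
        also have "\<dots> = (SUP n. \<integral>\<^sup>+x. indicator (cube \<rho>) x * m n x \<partial>lborel)"
        proof (rule nn_integral_monotone_convergence_SUP)
          show "incseq (\<lambda>n x. indicator (cube \<rho>) x * m n x)"
            using inc by (auto simp: incseq_def le_fun_def intro!: mult_left_mono)
        qed measurable
        also have "\<dots> \<le> ennreal C * (\<integral>\<^sup>+\<xi>. ennreal (weight \<xi> * (norm (G \<xi>))\<^sup>2) \<partial>lborel)"
          unfolding m_def by (intro SUP_least C(2) G tm)
        finally show ?thesis .
      qed
      fix x t
      show "ennreal ((norm (?S x t))\<^sup>2) \<le> (SUP n. m n x)"
      proof (rule ccontr)
        assume "\<not> ?thesis"
        then have gt: "(SUP n. m n x) < ennreal ((norm (?S x t))\<^sup>2)" by simp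
        then obtain b where b: "b \<ge> 0" "(SUP n. m n x) = ennreal b" by (cases "SUP n. m n x") auto
        then have "b < (norm (?S x t))\<^sup>2" using gt by (simp add: ennreal_less_iff)
        moreover have "open {s. b < (norm (?S x s))\<^sup>2}"
          by (intro open_Collect_less continuous_intros continuous_osc_op G)
        ultimately obtain s where s: "s \<in> D" "b < (norm (?S x s))\<^sup>2" using D(2)[of "{s. b < (norm (?S x s))\<^sup>2}"] by auto
        then obtain i where i: "s = d i" using d by auto
        have "ennreal ((norm (?S x s))\<^sup>2) \<le> m i x"
          unfolding m_def i using argmax_time_ge[of i i ?S x d] by (intro ennreal_leI power_mono) auto
        also have "\<dots> \<le> (SUP n. m n x)" by (rule SUP_upper) simp
        also have "\<dots> = ennreal b" by (rule b)
        finally show False using s b by (simp add: ennreal_le_iff)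
      qed
    qed
  qed
qed

section \<open>Pointwise convergence\<close>

lemma lebesgue_measurable_imp_borel_AE:
  fixes f :: "'a::euclidean_space \<Rightarrow> complex"
  assumes f: "f \<in> borel_measurable lebesgue"
  obtains f' where "f' \<in> borel_measurable borel" "AE x in lborel. f x = f' x"
proof -
  have re: "(\<lambda>x. Re (f x)) \<in> borel_measurable lebesgue" and im: "(\<lambda>x. Im (f x)) \<in> borel_measurable lebesgue"
    using f by measurable
  obtain r where r: "r \<in> borel_measurable lborel" "AE x in lborel. Re (f x) = r x"
    using completion_ex_borel_measurable_real[OF re] by blast
  obtain i where i: "i \<in> borel_measurable lborel" "AE x in lborel. Im (f x) = i x"
    using completion_ex_borel_measurable_real[OF im] by blast
  show thesis
  proof
    show "(\<lambda>x. Complex (r x) (i x)) \<in> borel_measurable borel"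
      unfolding Complex_eq using r(1) i(1) by simp
    show "AE x in lborel. f x = Complex (r x) (i x)"
      using r(2) i(2) by eventually_elim (simp add: complex_eq_iff)
  qed
qed

lemma fourier_eq_cis:
  assumes [measurable]: "f \<in> borel_measurable borel"
  shows "fourier f \<xi> = (LINT x|lborel. cis (- (x \<bullet> \<xi>)) * f x)"
  unfolding fourier_def by (subst integral_completion) (auto simp: cis_conv_exp)

lemma fourier_measurable [measurable]:
  assumes [measurable]: "f \<in> borel_measurable borel"
  shows "fourier f \<in> borel_measurable borel"
  unfolding fourier_eq_cis[OF assms, abs_def] by measurable

lemma norm_fourier_le:
  assumes "f \<in> borel_measurable borel"
  shows "norm (fourier f \<xi>) \<le> (LINT x|lborel. norm (f x))"
proof -
  have "norm (fourier f \<xi>) \<le> (LINT x|lborel. norm (cis (- (x \<bullet> \<xi>)) * f x))"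
    unfolding fourier_eq_cis[OF assms] by (rule integral_norm_bound)
  then show ?thesis by (simp add: norm_mult)
qed

lemma integrable_gauss_mod: "c > 0 \<Longrightarrow> integrable lborel (gauss_mod c y 0 :: 'a::euclidean_space \<Rightarrow> complex)"
  using lborel_integrable_affine[OF _ integrable_of_real[OF gauss_integral(1)[of c, where 'a='a]], of 1 "- y"]
  unfolding gauss_mod_def[abs_def] by (simp add: add.commute)

lemma fourier_multiplication_formula:
  fixes f \<phi> :: "'a::euclidean_space \<Rightarrow> complex"
  assumes f: "integrable lborel f" and \<phi>: "integrable lborel \<phi>"
  shows "(LINT x|lborel. f x * fourier \<phi> x) = (LINT \<xi>|lborel. fourier f \<xi> * \<phi> \<xi>)"
proof -
  have [measurable]: "f \<in> borel_measurable borel" "\<phi> \<in> borel_measurable borel" using f \<phi> by auto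
  have "(LINT x|lborel. f x * fourier \<phi> x) = (LINT x|lborel. f x * (LINT \<xi>|lborel. cis (- (x \<bullet> \<xi>)) * \<phi> \<xi>))"
    by (subst fourier_eq_cis) (auto simp: inner_commute)
  also have "\<dots> = (LINT \<xi>|lborel. \<phi> \<xi> * (LINT x|lborel. cis (- (x \<bullet> \<xi>)) * f x))"
  proof (rule Fubini_bounded[OF f \<phi>, of _ 1])
    show "(\<lambda>(x::'a, \<xi>). cis (- (x \<bullet> \<xi>))) \<in> borel_measurable (borel \<Otimes>\<^sub>M borel)" by measurable
  qed simp
  also have "\<dots> = (LINT \<xi>|lborel. fourier f \<xi> * \<phi> \<xi>)"
    by (subst fourier_eq_cis) (auto simp: mult.commute)
  finally show ?thesis .
qed

lemma weight_le:
  "weight (\<xi> :: real^'n::finite) \<le> (1 + (norm \<xi>)\<^sup>2) powr (real CARD('n) / 4)"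
proof -
  have pos: "1 + (norm \<xi>)\<^sup>2 > 0" by (simp add: add_pos_nonneg)
  have "weight \<xi> \<le> (\<Prod>j\<in>(UNIV::'n set). (1 + (norm \<xi>)\<^sup>2) powr (1/4))"
    unfolding weight_def
  proof (rule prod_mono, intro conjI)
    fix j
    have "\<bar>\<xi> $ j\<bar>\<^sup>2 \<le> (norm \<xi>)\<^sup>2" by (intro power_mono component_le_norm_cart) auto
    then have "\<bar>\<xi> $ j\<bar> \<le> sqrt (1 + (norm \<xi>)\<^sup>2)" by (intro real_le_rsqrt) simp
    then have "sqrt \<bar>\<xi> $ j\<bar> \<le> sqrt (sqrt (1 + (norm \<xi>)\<^sup>2))" by simp
    also have "\<dots> = (1 + (norm \<xi>)\<^sup>2) powr (1/4)"
      using pos by (simp add: powr_half_sqrt[symmetric] powr_powr)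
    finally show "sqrt \<bar>\<xi> $ j\<bar> \<le> (1 + (norm \<xi>)\<^sup>2) powr (1/4)" .
  qed simp
  also have "\<dots> = (1 + (norm \<xi>)\<^sup>2) powr (real CARD('n) / 4)"
    using pos by (simp add: powr_realpow[symmetric] powr_powr)
  finally show ?thesis .
qed

text \<open>A function inducing a tempered distribution is known to be integrable only against
  Schwartz functions; on the ball of radius \<open>R\<close> the Gaussian is at least exp(-R^2), so
  dividing by it is harmless.\<close>

lemma integrable_of_gauss_integrable:
  fixes f :: "'a::euclidean_space \<Rightarrow> complex"
  assumes int: "integrable lborel (\<lambda>x. f x * gauss_mod 1 0 0 x)"
    and [measurable]: "f \<in> borel_measurable borel" and supp: "\<And>x. norm x > R \<Longrightarrow> f x = 0"
  shows "integrable lborel f"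
proof (rule Bochner_Integration.integrable_bound[OF integrable_mult_right[OF int, of "of_real (exp (R\<^sup>2))"]])
  have "norm (f x) \<le> norm (of_real (exp (R\<^sup>2)) * (f x * gauss_mod 1 0 0 x))" for x
  proof (cases "norm x > R")
    case False
    then have "(norm x)\<^sup>2 \<le> R\<^sup>2" by (intro power_mono) auto
    then have "1 \<le> exp (R\<^sup>2) * exp (- 1 * (norm x)\<^sup>2)" by (simp add: exp_add[symmetric])
    from mult_left_mono[OF this, of "norm (f x)"] show ?thesis
      by (simp add: gauss_mod_def norm_mult mult_ac)
  qed (simp add: supp)
  then show "AE x in lborel. norm (f x) \<le> norm (of_real (exp (R\<^sup>2)) * (f x * gauss_mod 1 0 0 x))" by simp
qed measurable

text \<open>Compact support makes the Borel representative integrable, so its Fourier transform is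
  an actual bounded function. It must agree almost everywhere with the density \<open>g\<close> from
  the Sobolev condition, and then the Sobolev norm controls the weighted norm of
  \<open>fourier f'\<close>.\<close>

lemma sobolev_compact_support:
  fixes f :: "real^'n::finite \<Rightarrow> complex"
  assumes f: "f \<in> sobolev (real CARD('n) / 4)"
    and supp: "\<exists>C. compact C \<and> (AE x in lebesgue. x \<notin> C \<longrightarrow> f x = 0)"
  obtains f' R where "integrable lborel f'" "\<And>x. norm x > R \<Longrightarrow> f' x = 0" "AE x in lborel. f x = f' x"
    "(\<integral>\<^sup>+\<xi>. ennreal (weight \<xi> * (norm (fourier f' \<xi>))\<^sup>2) \<partial>lborel) < \<infinity>"
proof -
  let ?s = "real CARD('n) / 4"
  obtain u g where u: "induces f u" and g: "induces g (fourier_dist u)"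
    and gint: "integrable lebesgue (\<lambda>\<xi>. (1 + (norm \<xi>)\<^sup>2) powr ?s * (norm (g \<xi>))\<^sup>2)"
    using f unfolding sobolev_def sobolev_dist_def by blast
  have fm: "f \<in> borel_measurable lebesgue" and gm: "g \<in> borel_measurable lebesgue"
    using u g by (auto simp: induces_def)
  obtain f0 where f0 [measurable]: "f0 \<in> borel_measurable borel" and ff0: "AE x in lborel. f x = f0 x"
    by (rule lebesgue_measurable_imp_borel_AE[OF fm], rule that)
  obtain g0 where g0 [measurable]: "g0 \<in> borel_measurable borel" and gg0: "AE x in lborel. g x = g0 x"
    by (rule lebesgue_measurable_imp_borel_AE[OF gm], rule that)
  obtain C where C: "compact C" "AE x in lebesgue. x \<notin> C \<longrightarrow> f x = 0" using supp by blast
  obtain R where R: "\<And>x. x \<in> C \<Longrightarrow> norm x \<le> R" using compact_imp_bounded[OF C(1)] unfolding bounded_iff by blast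
  have [measurable]: "C \<in> sets borel" using compact_imp_closed[OF C(1)] by simp
  define f1 where "f1 x = indicator C x * f0 x" for x
  have [measurable]: "f1 \<in> borel_measurable borel" unfolding f1_def by measurable
  have f1_supp: "f1 x = 0" if "norm x > R" for x
    using R[of x] that by (auto simp: f1_def indicator_def)
  have Clb: "AE x in lborel. x \<notin> C \<longrightarrow> f x = 0" using C(2) by (simp add: AE_completion_iff)
  have ff1: "AE x in lborel. f x = f1 x"
    using ff0 Clb by eventually_elim (auto simp: f1_def indicator_def)
  \<comment> \<open>The hypotheses live on the Lebesgue completion; this passes to Borel
    representatives, for which the product-measure arguments are available.\<close>
  have test: "integrable lborel (\<lambda>x. h0 x * \<phi> x) \<and> v \<phi> = (LINT x|lborel. h0 x * \<phi> x)"
    if "induces h v" "AE x in lborel. h x = h0 x" "h0 \<in> borel_measurable borel" "\<phi> \<in> schwartz"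
    for h h0 :: "real^'n \<Rightarrow> complex" and v \<phi>
  proof -
    note [measurable] = that(3) schwartz_measurable[OF that(4)]
    have ae: "AE x in lebesgue. h x * \<phi> x = h0 x * \<phi> x"
      using AE_completion[OF that(2)] by eventually_elim simp
    have m: "(\<lambda>x. h x * \<phi> x) \<in> borel_measurable lebesgue" "(\<lambda>x. h0 x * \<phi> x) \<in> borel_measurable lebesgue"
      using that(1,4) by (auto simp: induces_def measurable_completion)
    have "integrable lebesgue (\<lambda>x. h x * \<phi> x)" and v: "v \<phi> = (LINT x|lebesgue. h x * \<phi> x)"
      using that(1,4) by (auto simp: induces_def)
    then have "integrable lebesgue (\<lambda>x. h0 x * \<phi> x)" using integrable_cong_AE[OF m ae] by simp
    then have "integrable lborel (\<lambda>x. h0 x * \<phi> x)" by (subst (asm) integrable_completion) auto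
    moreover have "v \<phi> = (LINT x|lborel. h0 x * \<phi> x)"
      unfolding v integral_cong_AE[OF m ae] by (rule integral_completion) measurable
    ultimately show ?thesis by blast
  qed
  have sch: "gauss_mod c y \<eta> \<in> schwartz" if "c > 0" for c and y \<eta> :: "real^'n"
    using schwartz_gauss_mod[OF that, of 1] by simp
  have f1: "integrable lborel f1"
    using test[OF u ff1 _ sch[of 1 0 0]] f1_supp by (intro integrable_of_gauss_integrable[of f1 R]) auto
  let ?F = "fourier f1"
  have "AE \<xi> in lborel. g0 \<xi> - ?F \<xi> = 0"
  proof (rule gauss_uniqueness)
    fix c :: real and y :: "real^'n" assume c: "c > 0"
    have gmod: "gauss_mod c y 0 \<xi> = of_real (exp (- c * (norm (\<xi> - y))\<^sup>2))" for \<xi> :: "real^'n"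
      by (simp add: gauss_mod_def)
    have fs: "fourier (gauss_mod c y 0) \<in> schwartz"
      unfolding fourier_gauss_mod[OF c] by (rule schwartz_gauss_mod) (use c in simp)
    have 1: "integrable lborel (\<lambda>\<xi>. g0 \<xi> * gauss_mod c y 0 \<xi>)"
      "u (fourier (gauss_mod c y 0)) = (LINT \<xi>|lborel. g0 \<xi> * gauss_mod c y 0 \<xi>)"
      using test[OF g gg0 g0 sch[OF c]] by (auto simp: fourier_dist_def)
    \<comment> \<open>The value of \<open>u\<close> at the transform of a Gaussian is read in two
      ways: through \<open>fourier_dist u\<close>, represented by \<open>g0\<close>, and through
      \<open>u\<close> itself, represented by \<open>f1\<close>, where the multiplication formula
      moves the transform onto \<open>f1\<close>.\<close>
    have 2: "u (fourier (gauss_mod c y 0)) = (LINT \<xi>|lborel. ?F \<xi> * gauss_mod c y 0 \<xi>)"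
      using test[OF u ff1 _ fs] fourier_multiplication_formula[OF f1 integrable_gauss_mod[OF c]] by simp
    have 3: "integrable lborel (\<lambda>\<xi>. ?F \<xi> * gauss_mod c y 0 \<xi>)"
      using integrable_bounded_mult[OF integrable_gauss_mod[OF c, of y] _ norm_fourier_le[of f1]]
      by (simp add: mult.commute)
    show "integrable lborel (\<lambda>\<xi>. (g0 \<xi> - ?F \<xi>) * of_real (exp (- c * (norm (\<xi> - y))\<^sup>2)))"
      unfolding gmod[symmetric] left_diff_distrib by (rule Bochner_Integration.integrable_diff[OF 1(1) 3])
    show "(LINT \<xi>|lborel. (g0 \<xi> - ?F \<xi>) * of_real (exp (- c * (norm (\<xi> - y))\<^sup>2))) = 0"
      unfolding gmod[symmetric] left_diff_distrib Bochner_Integration.integral_diff[OF 1(1) 3]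
      using 1(2) 2 by simp
  qed measurable
  with gg0 have gF: "AE \<xi> in lborel. norm (g \<xi>) = norm (?F \<xi>)" by eventually_elim simp
  have "(\<integral>\<^sup>+\<xi>. ennreal (weight \<xi> * (norm (?F \<xi>))\<^sup>2) \<partial>lborel) = (\<integral>\<^sup>+\<xi>. ennreal (weight \<xi> * (norm (?F \<xi>))\<^sup>2) \<partial>lebesgue)"
    by (rule nn_integral_completion[symmetric])
  also have "\<dots> \<le> (\<integral>\<^sup>+\<xi>. ennreal ((1 + (norm \<xi>)\<^sup>2) powr ?s * (norm (g \<xi>))\<^sup>2) \<partial>lebesgue)"
  proof (rule nn_integral_mono_AE)
    show "AE \<xi> in lebesgue. ennreal (weight \<xi> * (norm (?F \<xi>))\<^sup>2) \<le> ennreal ((1 + (norm \<xi>)\<^sup>2) powr ?s * (norm (g \<xi>))\<^sup>2)"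
      using AE_completion[OF gF] by eventually_elim (auto intro!: ennreal_leI mult_right_mono weight_le)
  qed
  also have "\<dots> < \<infinity>"
  proof -
    have "(\<integral>\<^sup>+\<xi>. ennreal ((1 + (norm \<xi>)\<^sup>2) powr ?s * (norm (g \<xi>))\<^sup>2) \<partial>lebesgue) = ennreal (LINT \<xi>|lebesgue. (1 + (norm \<xi>)\<^sup>2) powr ?s * (norm (g \<xi>))\<^sup>2)"
      by (rule nn_integral_eq_integral[OF gint]) auto
    then show ?thesis by simp
  qed
  finally show thesis using that[OF f1 f1_supp ff1] by blast
qed

section \<open>Damped operators and their limits at positive times and at time 0\<close>

text \<open>The factor \<open>k\<close> satisfies t k^a = 1, so s -> k s takes the time out of the
  phase and only rescales the damping. Limits and bounds as the damping vanishes thus carry over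
  from time 1.\<close>

lemma reg_kernel_scale:
  assumes t: "t > 0" and a: "a > 1"
  shows "reg_kernel a e x t = of_real (t powr (- 1 / a)) * reg_kernel a (e * (t powr (- 1 / a))\<^sup>2) (x / t powr (1 / a)) 1"
proof -
  define k where "k = t powr (- 1 / a)"
  have k: "k > 0" using t by (simp add: k_def)
  have kx: "x * k = x / t powr (1 / a)" using t by (simp add: k_def powr_minus_divide)
  have "k powr a = t powr (- 1)" using a by (simp add: k_def powr_powr)
  then have kt: "t * k powr a = 1" using t by (simp add: powr_minus_divide)
  have "reg_kernel a e x t = k *\<^sub>R (LINT s|lborel. of_real (exp (- e * (0 + k * s)\<^sup>2)) * cis (x * (0 + k * s) + t * \<bar>0 + k * s\<bar> powr a))"
    unfolding reg_kernel_def using k by (subst lborel_integral_real_affine[of k _ 0]) auto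
  also have "(\<lambda>s. of_real (exp (- e * (0 + k * s)\<^sup>2)) * cis (x * (0 + k * s) + t * \<bar>0 + k * s\<bar> powr a))
      = (\<lambda>s. of_real (exp (- (e * k\<^sup>2) * s\<^sup>2)) * cis ((x / t powr (1 / a)) * s + 1 * \<bar>s\<bar> powr a))"
  proof
    fix s
    have "t * \<bar>0 + k * s\<bar> powr a = 1 * \<bar>s\<bar> powr a"
    proof -
      have "t * \<bar>0 + k * s\<bar> powr a = (t * k powr a) * \<bar>s\<bar> powr a" using k by (simp add: abs_mult powr_mult)
      then show ?thesis unfolding kt .
    qed
    moreover have "x * (0 + k * s) = (x / t powr (1 / a)) * s" unfolding kx[symmetric] by simp
    moreover have "- e * (0 + k * s)\<^sup>2 = - (e * k\<^sup>2) * s\<^sup>2" by (simp add: power_mult_distrib)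
    ultimately show "of_real (exp (- e * (0 + k * s)\<^sup>2)) * cis (x * (0 + k * s) + t * \<bar>0 + k * s\<bar> powr a)
      = of_real (exp (- (e * k\<^sup>2) * s\<^sup>2)) * cis ((x / t powr (1 / a)) * s + 1 * \<bar>s\<bar> powr a)"
      by (simp only:)
  qed
  finally show ?thesis by (simp add: reg_kernel_def k_def scaleR_conv_of_real)
qed

lemma reg_kernel_scaled_tendsto:
  assumes t: "t > 0" and a: "a > 1" and e: "\<And>k. e k > 0" "e \<longlonglongrightarrow> 0"
  shows "(\<lambda>k::nat. reg_kernel a (e k) x t) \<longlonglongrightarrow> of_real (t powr (- 1 / a)) * osc_kernel a (x / t powr (1 / a))"
proof -
  have pos: "e k * (t powr (- 1 / a))\<^sup>2 > 0" for k using e(1)[of k] t by simp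
  have "(\<lambda>k. e k * (t powr (- 1 / a))\<^sup>2) \<longlonglongrightarrow> 0 * (t powr (- 1 / a))\<^sup>2" by (intro tendsto_intros e(2))
  then have "filterlim (\<lambda>k. e k * (t powr (- 1 / a))\<^sup>2) (at_right 0) sequentially"
    using pos less_imp_neq[OF pos, THEN not_sym] by (simp add: filterlim_at)
  from filterlim_compose[OF reg_kernel_tendsto[OF a] this]
  show ?thesis unfolding reg_kernel_scale[OF t a] osc_kernel_eq[OF a] by (intro tendsto_mult tendsto_const)
qed

lemma kernel_growth_mono: "a > 1 \<Longrightarrow> \<bar>x\<bar> \<le> \<bar>y\<bar> \<Longrightarrow> kernel_growth a x \<le> kernel_growth a y"
  unfolding kernel_growth_def by (intro mult_left_mono add_right_mono powr_mono2) auto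

lemma norm_reg_kernel_scaled_le:
  assumes t: "t > 0" and a: "a > 1" and e: "e > 0" and x: "\<bar>x\<bar> \<le> r"
  shows "norm (reg_kernel a e x t) \<le> t powr (- 1 / a) * kernel_growth a (r / t powr (1 / a))"
proof -
  have "norm (reg_kernel a (e * (t powr (- 1 / a))\<^sup>2) (x / t powr (1 / a)) 1) \<le> kernel_growth a (x / t powr (1 / a))"
    by (rule norm_reg_kernel_le[OF a]) (use e t in simp)
  also have "\<dots> \<le> kernel_growth a (r / t powr (1 / a))"
    using x by (intro kernel_growth_mono[OF a]) (simp add: divide_right_mono)
  finally show ?thesis unfolding reg_kernel_scale[OF t a] norm_mult by (simp add: mult_left_mono)
qed

definition reg_symbol :: "real \<Rightarrow> (real^'n::finite \<Rightarrow> complex) \<Rightarrow> real^'n \<Rightarrow> complex" where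
  "reg_symbol e f \<xi> = of_real (exp (- e * (norm \<xi>)\<^sup>2)) * fourier f \<xi>"

lemma integrable_reg_symbol:
  fixes f :: "real^'n::finite \<Rightarrow> complex"
  assumes [measurable]: "f \<in> borel_measurable borel" and e: "e > 0"
  shows "integrable lborel (reg_symbol e f)"
  unfolding reg_symbol_def[abs_def]
  by (rule integrable_bounded_mult[OF integrable_of_real[OF gauss_integral(1)[OF e]] _ norm_fourier_le]) auto

lemma norm_sq_vec: "(norm (x::real^'n::finite))\<^sup>2 = (\<Sum>j\<in>UNIV. (x $ j)\<^sup>2)"
  by (subst power2_norm_eq_inner) (simp add: inner_vec_def power2_eq_square)

text \<open>Damping, phase and the modulation from \<open>fourier f\<close> all factor over the
  coordinates. After Fubini the inner integral is the product of the one-dimensional regularised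
  kernels, so the damped operator is a convolution.\<close>

lemma osc_op_reg_symbol:
  fixes f :: "real^'n::finite \<Rightarrow> complex"
  assumes f: "integrable lborel f" and e: "e > 0"
  shows "osc_op a (reg_symbol e f) x t = (LINT y|lborel. f y * (\<Prod>j\<in>UNIV. reg_kernel (a $ j) e ((x - y) $ j) (t $ j)))"
proof -
  have [measurable]: "f \<in> borel_measurable borel" using f by auto
  define u where "u \<xi> = of_real (exp (- e * (norm \<xi>)\<^sup>2)) * cis (phase a x t \<xi>)" for \<xi>
  have u: "integrable lborel u" unfolding u_def by (rule integrable_mult_cis[OF gauss_integral(1)[OF e]]) measurable
  have "osc_op a (reg_symbol e f) x t = (LINT \<xi>|lborel. u \<xi> * (LINT y|lborel. cis (- (y \<bullet> \<xi>)) * f y))"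
    unfolding osc_op_def reg_symbol_def u_def by (subst fourier_eq_cis) (auto simp: mult_ac)
  also have "\<dots> = (LINT y|lborel. f y * (LINT \<xi>|lborel. cis (- (y \<bullet> \<xi>)) * u \<xi>))"
  proof (rule Fubini_bounded[OF u f, of _ 1])
    show "(\<lambda>(\<xi>::real^'n, y). cis (- (y \<bullet> \<xi>))) \<in> borel_measurable (borel \<Otimes>\<^sub>M borel)" by measurable
  qed simp
  also have "(\<lambda>y. LINT \<xi>|lborel. cis (- (y \<bullet> \<xi>)) * u \<xi>) = (\<lambda>y. \<Prod>j\<in>UNIV. reg_kernel (a $ j) e ((x - y) $ j) (t $ j))"
  proof
    fix y
    have "cis (- (y \<bullet> \<xi>)) * u \<xi> = (\<Prod>j\<in>UNIV. of_real (exp (- e * (\<xi> $ j)\<^sup>2)) * cis ((x - y) $ j * \<xi> $ j + t $ j * \<bar>\<xi> $ j\<bar> powr (a $ j)))" for \<xi>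
    proof -
      have "y \<bullet> \<xi> = phase a y 0 \<xi>" by (simp add: phase_def inner_vec_def)
      then have "cis (- (y \<bullet> \<xi>)) * cis (phase a x t \<xi>) = cis (phase a (x - y) (t - 0) \<xi>)"
        unfolding phase_diff[symmetric] by (simp add: cis_mult)
      moreover have "exp (- e * (norm \<xi>)\<^sup>2) = (\<Prod>j\<in>UNIV. exp (- e * (\<xi> $ j)\<^sup>2))"
        unfolding norm_sq_vec sum_distrib_left by (rule exp_sum) simp
      ultimately show ?thesis unfolding u_def
        by (simp add: prod.distrib cis_phase mult.left_commute)
    qed
    then have "(LINT \<xi>|lborel. cis (- (y \<bullet> \<xi>)) * u \<xi>)
       = (LINT \<xi>|lborel. (\<Prod>j\<in>UNIV. of_real (exp (- e * (\<xi> $ j)\<^sup>2)) * cis ((x - y) $ j * \<xi> $ j + t $ j * \<bar>\<xi> $ j\<bar> powr (a $ j))))"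
      by (simp only:)
    also have "\<dots> = (\<Prod>j\<in>UNIV. reg_kernel (a $ j) e ((x - y) $ j) (t $ j))"
      unfolding reg_kernel_def
      by (rule integral_prod_vec(2)) (intro integrable_mult_cis integrable_gauss e, measurable)
    finally show "(LINT \<xi>|lborel. cis (- (y \<bullet> \<xi>)) * u \<xi>) = (\<Prod>j\<in>UNIV. reg_kernel (a $ j) e ((x - y) $ j) (t $ j))" .
  qed
  finally show ?thesis .
qed

lemma osc_kernel_measurable: "a > 1 \<Longrightarrow> osc_kernel a \<in> borel_measurable borel"
  by (simp add: osc_kernel_eq lim_kernel_measurable)

text \<open>Where \<open>f y\<close> may be nonzero, each coordinate of x - y is at most |x| + R,
  and there the regularised kernels are bounded independently of the damping by
  \<open>kernel_growth\<close>. The resulting constant \<open>B\<close> depends on \<open>x\<close>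
  and \<open>t\<close>, which are fixed here.\<close>

lemma osc_op_tendsto_T_op:
  fixes a t x :: "real^'n::finite" and f :: "real^'n::finite \<Rightarrow> complex" and e :: "nat \<Rightarrow> real"
  assumes a: "\<And>j. a $ j > 1" and f: "integrable lborel f" and supp: "\<And>y. norm y > R \<Longrightarrow> f y = 0"
    and e: "\<And>k. e k > 0" "e \<longlonglongrightarrow> 0" and t: "\<And>j. t $ j > 0"
  shows "(\<lambda>k. of_real (1 / (2 * pi) ^ CARD('n)) * osc_op a (reg_symbol (e k) f) x t) \<longlonglongrightarrow> T_op a t f x"
proof -
  have [measurable]: "f \<in> borel_measurable borel" using f by auto
  note [measurable] = osc_kernel_measurable[OF a]
  let ?K = "\<lambda>y. \<Prod>j\<in>UNIV. of_real ((t $ j) powr (- 1 / a $ j)) * osc_kernel (a $ j) ((x - y) $ j / (t $ j) powr (1 / a $ j))"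
  have km: "(\<lambda>y. kernel a t (x - y)) \<in> borel_measurable borel"
    unfolding kernel_def by measurable
  note [measurable] = km
  define B where "B = (\<Prod>j\<in>UNIV. (t $ j) powr (- 1 / a $ j) * kernel_growth (a $ j) ((norm x + R) / (t $ j) powr (1 / a $ j)))"
  have "(\<lambda>k. LINT y|lborel. f y * (\<Prod>j\<in>UNIV. reg_kernel (a $ j) (e k) ((x - y) $ j) (t $ j))) \<longlonglongrightarrow> (LINT y|lborel. f y * kernel a t (x - y))"
  proof (rule integral_dominated_convergence[where w="\<lambda>y. B * norm (f y)"])
    show "integrable lborel (\<lambda>y. B * norm (f y))" by (intro integrable_mult_right integrable_norm f)
    show "AE y in lborel. (\<lambda>k. f y * (\<Prod>j\<in>UNIV. reg_kernel (a $ j) (e k) ((x - y) $ j) (t $ j))) \<longlonglongrightarrow> f y * kernel a t (x - y)"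
      unfolding kernel_def
      by (intro AE_I2 tendsto_mult tendsto_const tendsto_prod reg_kernel_scaled_tendsto a t e)
    fix k
    show "AE y in lborel. norm (f y * (\<Prod>j\<in>UNIV. reg_kernel (a $ j) (e k) ((x - y) $ j) (t $ j))) \<le> B * norm (f y)"
    proof (rule AE_I2)
      fix y
      show "norm (f y * (\<Prod>j\<in>UNIV. reg_kernel (a $ j) (e k) ((x - y) $ j) (t $ j))) \<le> B * norm (f y)"
      proof (cases "norm y > R")
        case False
        have "norm (\<Prod>j\<in>UNIV. reg_kernel (a $ j) (e k) ((x - y) $ j) (t $ j)) \<le> B"
          unfolding prod_norm[symmetric] B_def
        proof (rule prod_mono, intro conjI norm_ge_zero norm_reg_kernel_scaled_le t a e)
          fix j
          have "\<bar>(x - y) $ j\<bar> \<le> norm (x - y)" by (rule component_le_norm_cart)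
          also have "\<dots> \<le> norm x + R" using norm_triangle_ineq4[of x y] False by linarith
          finally show "\<bar>(x - y) $ j\<bar> \<le> norm x + R" .
        qed
        from mult_left_mono[OF this, of "norm (f y)"] show ?thesis by (simp add: norm_mult mult.commute)
      qed (simp add: supp)
    qed
  qed measurable
  then have "(\<lambda>k. of_real (1 / (2 * pi) ^ CARD('n)) * osc_op a (reg_symbol (e k) f) x t)
      \<longlonglongrightarrow> of_real (1 / (2 * pi) ^ CARD('n)) * (LINT y|lborel. f y * kernel a t (x - y))"
    unfolding osc_op_reg_symbol[OF f e(1)] by (intro tendsto_mult tendsto_const)
  also have "(LINT y|lborel. f y * kernel a t (x - y)) = (LINT y|lebesgue. kernel a t (x - y) * f y)"
    by (subst integral_completion) (auto simp: mult.commute)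
  finally show ?thesis unfolding T_op_def .
qed

lemma reg_kernel_zero:
  assumes e: "e > 0"
  shows "reg_kernel a e x 0 = of_real (sqrt (pi / e) * exp (- x\<^sup>2 / (4 * e)))"
  using gauss_fourier_real[OF e, of x] by (simp add: reg_kernel_def mult.commute)

text \<open>At time 0 the regularised kernel is a Gaussian: up to the factor (2 pi)^n the operator
  becomes convolution with the heat kernel at heat time \<open>e\<close>.\<close>

lemma osc_op_reg_symbol_zero:
  fixes f :: "real^'n::finite \<Rightarrow> complex"
  assumes f: "integrable lborel f" and e: "e > 0"
  shows "of_real (1 / (2 * pi) ^ CARD('n)) * osc_op a (reg_symbol e f) x 0
    = of_real (1 / sqrt (4 * pi * e) ^ CARD('n)) * (LINT y|lborel. of_real (exp (- (1 / (4 * e)) * (norm (x - y))\<^sup>2)) * f y)"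
proof -
  have "(\<Prod>j\<in>UNIV. reg_kernel (a $ j) e ((x - y) $ j) ((0::real^'n) $ j)) =
      of_real (sqrt (pi / e) ^ CARD('n)) * of_real (exp (- (1 / (4 * e)) * (norm (x - y))\<^sup>2))" for y
  proof -
    have "exp (- (1 / (4 * e)) * (norm (x - y))\<^sup>2) = (\<Prod>j\<in>UNIV. exp (- ((x - y) $ j)\<^sup>2 / (4 * e)))"
      unfolding norm_sq_vec sum_distrib_left by (subst exp_sum) auto
    then show ?thesis by (simp add: reg_kernel_zero[OF e] prod.distrib)
  qed
  then have "osc_op a (reg_symbol e f) x 0 = (LINT y|lborel. of_real (sqrt (pi / e) ^ CARD('n)) * (of_real (exp (- (1 / (4 * e)) * (norm (x - y))\<^sup>2)) * f y))"
    unfolding osc_op_reg_symbol[OF f e] by (simp only: mult_ac)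
  also have "\<dots> = of_real (sqrt (pi / e) ^ CARD('n)) * (LINT y|lborel. of_real (exp (- (1 / (4 * e)) * (norm (x - y))\<^sup>2)) * f y)"
    by (rule integral_mult_right_zero)
  finally have eq: "osc_op a (reg_symbol e f) x 0 = \<dots>" .
  have "1 / (2 * pi) * sqrt (pi / e) = 1 / sqrt (4 * pi * e)"
  proof -
    have "sqrt (4 * pi * e) = 2 * sqrt pi * sqrt e" by (simp add: real_sqrt_mult)
    then show ?thesis using e real_div_sqrt[of pi] by (simp add: real_sqrt_divide field_simps)
  qed
  then have "(1 / (2 * pi)) ^ CARD('n) * sqrt (pi / e) ^ CARD('n) = (1 / sqrt (4 * pi * e)) ^ CARD('n)"
    unfolding power_mult_distrib[symmetric] by (simp only:)
  then have c: "1 / (2 * pi) ^ CARD('n) * sqrt (pi / e) ^ CARD('n) = 1 / sqrt (4 * pi * e) ^ CARD('n)"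
    by (simp only: power_one_over)
  show ?thesis unfolding eq mult.assoc[symmetric] of_real_mult[symmetric] c ..
qed

text \<open>Fubini moves the Gaussian mean from \<open>f\<close> to the indicator of the box. Heat
  time \<open>e\<close> corresponds to c = 1/(4e) in \<open>gauss_avg\<close>, for which the
  normalisation sqrt(pi / c) is sqrt(4 pi e).\<close>

lemma box_integral_reg:
  fixes f :: "real^'n::finite \<Rightarrow> complex"
  assumes f: "integrable lborel f" and e: "e > 0"
  shows "(LINT x:box l u|lborel. of_real (1 / (2 * pi) ^ CARD('n)) * osc_op a (reg_symbol e f) x 0)
    = (LINT y|lborel. f y * of_real (gauss_avg (1 / (4 * e)) (box l u) y))"
proof -
  let ?Q = "box l u" and ?c = "1 / (4 * e)" and ?k = "complex_of_real (1 / sqrt (4 * pi * e) ^ CARD('n))"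
  have q: "integrable lborel (\<lambda>x. complex_of_real (indicator ?Q x))"
    by (intro integrable_of_real integrable_real_indicator) (auto simp: emeasure_lborel_box_eq)
  have "(LINT x:?Q|lborel. of_real (1 / (2 * pi) ^ CARD('n)) * osc_op a (reg_symbol e f) x 0)
      = (LINT x|lborel. ?k * (of_real (indicator ?Q x) * (LINT y|lborel. of_real (exp (- ?c * (norm (x - y))\<^sup>2)) * f y)))"
    unfolding osc_op_reg_symbol_zero[OF f e] set_lebesgue_integral_def scaleR_conv_of_real by (simp only: mult_ac)
  also have "\<dots> = ?k * (LINT x|lborel. of_real (indicator ?Q x) * (LINT y|lborel. of_real (exp (- ?c * (norm (x - y))\<^sup>2)) * f y))"
    by (rule integral_mult_right_zero)
  also have "(LINT x|lborel. of_real (indicator ?Q x) * (LINT y|lborel. of_real (exp (- ?c * (norm (x - y))\<^sup>2)) * f y))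
      = (LINT y|lborel. f y * (LINT x|lborel. of_real (exp (- ?c * (norm (x - y))\<^sup>2)) * of_real (indicator ?Q x)))"
  proof (rule Fubini_bounded[OF q f, of _ 1])
    show "(\<lambda>(x::real^'n, y). complex_of_real (exp (- ?c * (norm (x - y))\<^sup>2))) \<in> borel_measurable (borel \<Otimes>\<^sub>M borel)" by measurable
  qed (use e in simp)
  also have "?k * \<dots> = (LINT y|lborel. ?k * (f y * (LINT x|lborel. of_real (exp (- ?c * (norm (x - y))\<^sup>2)) * of_real (indicator ?Q x))))"
    by (rule integral_mult_right_zero[symmetric])
  also have "\<dots> = (LINT y|lborel. f y * of_real (gauss_avg ?c ?Q y))"
  proof (intro Bochner_Integration.integral_cong refl)
    fix y
    have "(LINT x|lborel. of_real (exp (- ?c * (norm (x - y))\<^sup>2)) * of_real (indicator ?Q x)) = complex_of_real (LINT x:?Q|lborel. exp (- ?c * (norm (y - x))\<^sup>2))"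
      unfolding set_lebesgue_integral_def integral_complex_of_real[symmetric]
      by (intro Bochner_Integration.integral_cong refl) (simp add: norm_minus_commute mult.commute)
    moreover have "sqrt (pi / ?c) = sqrt (4 * pi * e)" using e by (simp add: mult_ac)
    ultimately show "?k * (f y * (LINT x|lborel. of_real (exp (- ?c * (norm (x - y))\<^sup>2)) * of_real (indicator ?Q x))) = f y * of_real (gauss_avg ?c ?Q y)"
      by (simp add: gauss_avg_def mult_ac)
  qed
  finally show ?thesis .
qed

text \<open>The condition \<open>e k \<le> 1/4\<close> says that c = 1/(4e) is at least 1, the range
  covered by \<open>gauss_avg_bound\<close>; so the averages are at most \<open>C\<close> and
  converge to the indicator off the frontier, with \<open>C\<close> times |f| as majorant.\<close>

lemma box_integral_reg_tendsto:
  fixes f :: "real^'n::finite \<Rightarrow> complex" and e :: "nat \<Rightarrow> real"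
  assumes f: "integrable lborel f" and e: "\<And>k. e k > 0" "\<And>k. e k \<le> 1/4" "e \<longlonglongrightarrow> 0"
  shows "(\<lambda>k. LINT x:box l u|lborel. of_real (1 / (2 * pi) ^ CARD('n)) * osc_op a (reg_symbol (e k) f) x 0)
    \<longlonglongrightarrow> (LINT x:box l u|lborel. f x)"
proof -
  let ?Q = "box l u"
  have [measurable]: "f \<in> borel_measurable borel" using f by auto
  obtain R where R: "\<And>x. x \<in> ?Q \<Longrightarrow> norm x \<le> R" by (rule box_norm_bound, rule that)
  obtain C where C: "C \<ge> 0" "\<And>c x. c \<ge> 1 \<Longrightarrow> gauss_avg c ?Q x \<le> C * exp (- (1/4) * (norm x)\<^sup>2)"
    using gauss_avg_bound[of ?Q R] R by (metis borel_open open_box)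
  have c1: "1 / (4 * e k) \<ge> 1" for k using e(1,2)[of k] by (simp add: field_simps)
  have clim: "filterlim (\<lambda>k. 1 / (4 * e k)) at_top sequentially"
  proof -
    have "filterlim e (at_right 0) sequentially"
      using e(1,3) less_imp_neq[OF e(1), THEN not_sym] by (simp add: filterlim_at)
    from filterlim_compose[OF filterlim_inverse_at_top_right this]
    have "filterlim (\<lambda>k. (1/4) * inverse (e k)) at_top sequentially"
      by (intro filterlim_tendsto_pos_mult_at_top[OF tendsto_const]) auto
    then show ?thesis by (simp add: field_simps)
  qed
  have "(\<lambda>k. LINT y|lborel. f y * of_real (gauss_avg (1 / (4 * e k)) ?Q y)) \<longlonglongrightarrow> (LINT y|lborel. f y * of_real (indicator ?Q y))"
  proof (rule integral_dominated_convergence[where w="\<lambda>y. C * norm (f y)"])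
    show "integrable lborel (\<lambda>y. C * norm (f y))" by (intro integrable_mult_right integrable_norm f)
    have "(\<lambda>k. f y * of_real (gauss_avg (1 / (4 * e k)) ?Q y)) \<longlonglongrightarrow> f y * of_real (indicator ?Q y)" if "y \<notin> frontier ?Q" for y
      by (intro tendsto_intros gauss_avg_tendsto c1 clim that)
    with negligible_frontier_box[of l u]
    show "AE y in lborel. (\<lambda>k. f y * of_real (gauss_avg (1 / (4 * e k)) ?Q y)) \<longlonglongrightarrow> f y * of_real (indicator ?Q y)"
      by (rule eventually_mono)
    fix k
    show "(\<lambda>y. f y * of_real (gauss_avg (1 / (4 * e k)) ?Q y)) \<in> borel_measurable lborel"
      unfolding gauss_avg_def set_lebesgue_integral_def by measurable
    have "norm (f y * of_real (gauss_avg (1 / (4 * e k)) ?Q y)) \<le> C * norm (f y)" for y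
    proof -
      have "gauss_avg (1 / (4 * e k)) ?Q y \<le> C * exp (- (1/4) * (norm y)\<^sup>2)" by (rule C(2)[OF c1])
      also have "\<dots> \<le> C * 1" using C(1) by (intro mult_left_mono) auto
      finally have "gauss_avg (1 / (4 * e k)) ?Q y \<le> C" by simp
      moreover have "gauss_avg (1 / (4 * e k)) ?Q y \<ge> 0" by (rule gauss_avg_nonneg) (use e(1)[of k] in simp)
      ultimately show ?thesis using mult_left_mono[of "gauss_avg (1 / (4 * e k)) ?Q y" C "norm (f y)"]
        by (simp add: norm_mult mult.commute)
    qed
    then show "AE y in lborel. norm (f y * of_real (gauss_avg (1 / (4 * e k)) ?Q y)) \<le> C * norm (f y)" by simp
  qed measurable
  moreover have "(LINT y|lborel. f y * of_real (indicator ?Q y)) = (LINT x:?Q|lborel. f x)"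
    by (simp add: set_lebesgue_integral_def scaleR_conv_of_real mult.commute)
  ultimately show ?thesis unfolding box_integral_reg[OF f e(1)] by simp
qed

section \<open>Uniform convergence along a sequence of dampings\<close>

lemma exp_diff_le:
  fixes s :: real
  assumes "0 \<le> e'" "e' \<le> e" "0 \<le> s"
  shows "\<bar>exp (- e' * s) - exp (- e * s)\<bar> \<le> 1 - exp (- e * s)"
proof -
  have "exp (- e * s) \<le> exp (- e' * s)" using assms by (simp add: mult_right_mono)
  moreover have "exp (- e' * s) \<le> 1" using assms by simp
  ultimately show ?thesis by (simp add: abs_if)
qed

text \<open>The weighted loss \<open>V n\<close> caused by the damping tends to 0 by dominated
  convergence, so the dampings can be thinned out to any prescribed rate. The rate 16^(-k) tolerates
  a later factor 4^k and still leaves a geometric series.\<close>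

lemma regularisation_sequence:
  fixes f :: "real^'n::finite \<Rightarrow> complex"
  assumes [measurable]: "f \<in> borel_measurable borel"
    and fin: "(\<integral>\<^sup>+\<xi>. ennreal (weight \<xi> * (norm (fourier f \<xi>))\<^sup>2) \<partial>lborel) < \<infinity>"
  obtains e :: "nat \<Rightarrow> real" where "\<And>k. e k > 0" "\<And>k. e k \<le> 1/4" "e \<longlonglongrightarrow> 0"
    "\<And>k. (\<integral>\<^sup>+\<xi>. ennreal (weight \<xi> * (norm (reg_symbol (e (Suc k)) f \<xi> - reg_symbol (e k) f \<xi>))\<^sup>2) \<partial>lborel) \<le> ennreal ((1/16) ^ k)"
proof -
  \<comment> \<open>The factor 4 keeps all values at most 1/4. As the sequence decreases, the
    increment between two damped symbols is at most the loss of the more strongly damped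
    one.\<close>
  define \<epsilon> where "\<epsilon> n = 1 / (4 * real (Suc n))" for n
  have eps: "\<epsilon> n > 0" "\<epsilon> n \<le> 1/4" for n by (auto simp: \<epsilon>_def field_simps)
  have eps_mono: "\<epsilon> n \<le> \<epsilon> m" if "m \<le> n" for m n using that by (simp add: \<epsilon>_def frac_le)
  have eps0: "\<epsilon> \<longlonglongrightarrow> 0" unfolding \<epsilon>_def by real_asymp
  define V where "V n = (\<integral>\<^sup>+\<xi>. ennreal (weight \<xi> * ((1 - exp (- \<epsilon> n * (norm \<xi>)\<^sup>2)) * norm (fourier f \<xi>))\<^sup>2) \<partial>lborel)" for n
  have "V \<longlonglongrightarrow> (\<integral>\<^sup>+\<xi>. 0 \<partial>(lborel :: (real^'n) measure))"
    unfolding V_def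
  proof (rule nn_integral_dominated_convergence[where w="\<lambda>\<xi>. ennreal (weight \<xi> * (norm (fourier f \<xi>))\<^sup>2)"])
    show "AE \<xi> in lborel. ennreal (weight \<xi> * ((1 - exp (- \<epsilon> n * (norm \<xi>)\<^sup>2)) * norm (fourier f \<xi>))\<^sup>2)
        \<le> ennreal (weight \<xi> * (norm (fourier f \<xi>))\<^sup>2)" for n
    proof (intro AE_I2 ennreal_leI mult_left_mono power_mono weight_nonneg)
      fix \<xi> :: "real^'n"
      have "0 \<le> 1 - exp (- \<epsilon> n * (norm \<xi>)\<^sup>2)" "1 - exp (- \<epsilon> n * (norm \<xi>)\<^sup>2) \<le> 1"
        using eps(1)[of n] by auto
      then show "(1 - exp (- \<epsilon> n * (norm \<xi>)\<^sup>2)) * norm (fourier f \<xi>) \<le> norm (fourier f \<xi>)"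
        "0 \<le> (1 - exp (- \<epsilon> n * (norm \<xi>)\<^sup>2)) * norm (fourier f \<xi>)"
        by (auto intro!: mult_left_le_one_le)
    qed
    show "AE \<xi> in lborel. (\<lambda>n. ennreal (weight \<xi> * ((1 - exp (- \<epsilon> n * (norm \<xi>)\<^sup>2)) * norm (fourier f \<xi>))\<^sup>2)) \<longlonglongrightarrow> 0"
    proof (rule AE_I2)
      fix \<xi> :: "real^'n"
      have "(\<lambda>n. weight \<xi> * ((1 - exp (- \<epsilon> n * (norm \<xi>)\<^sup>2)) * norm (fourier f \<xi>))\<^sup>2)
          \<longlonglongrightarrow> weight \<xi> * ((1 - exp (- 0 * (norm \<xi>)\<^sup>2)) * norm (fourier f \<xi>))\<^sup>2"
        by (intro tendsto_intros eps0)
      from tendsto_ennrealI[OF this]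
      show "(\<lambda>n. ennreal (weight \<xi> * ((1 - exp (- \<epsilon> n * (norm \<xi>)\<^sup>2)) * norm (fourier f \<xi>))\<^sup>2)) \<longlonglongrightarrow> 0" by simp
    qed
  qed (use fin in auto)
  then have V0: "V \<longlonglongrightarrow> 0" by simp
  have "\<forall>k. \<exists>m. \<forall>n\<ge>m. V n \<le> ennreal ((1/16) ^ k)"
  proof
    fix k :: nat
    have "eventually (\<lambda>n. V n < ennreal ((1/16) ^ k)) sequentially" by (rule order_tendstoD(2)[OF V0]) simp
    then show "\<exists>m. \<forall>n\<ge>m. V n \<le> ennreal ((1/16) ^ k)"
      unfolding eventually_sequentially by (meson less_imp_le)
  qed
  from choice[OF this] obtain m where m: "\<And>k n. n \<ge> m k \<Longrightarrow> V n \<le> ennreal ((1/16) ^ k)" by blast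
  \<comment> \<open>Summing the thresholds makes \<open>\<mu>\<close> monotone and at least
    \<open>m k\<close>; the summand \<open>k\<close> drives it to infinity.\<close>
  define \<mu> where "\<mu> k = k + (\<Sum>i\<le>k. m i)" for k
  have mu: "\<mu> k \<ge> m k" "\<mu> k \<ge> k" "\<mu> k \<le> \<mu> (Suc k)" for k
    by (auto simp: \<mu>_def intro: trans_le_add2 member_le_sum)
  show thesis
  proof (rule that[of "\<lambda>k. \<epsilon> (\<mu> k)"])
    show "\<epsilon> (\<mu> k) > 0" "\<epsilon> (\<mu> k) \<le> 1/4" for k by (rule eps)+
    have "filterlim \<mu> sequentially sequentially"
      unfolding filterlim_at_top using mu(2) by (auto simp: eventually_sequentially intro: le_trans)
    from filterlim_compose[OF eps0 this] show "(\<lambda>k. \<epsilon> (\<mu> k)) \<longlonglongrightarrow> 0" .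
    fix k
    have "(\<integral>\<^sup>+\<xi>. ennreal (weight \<xi> * (norm (reg_symbol (\<epsilon> (\<mu> (Suc k))) f \<xi> - reg_symbol (\<epsilon> (\<mu> k)) f \<xi>))\<^sup>2) \<partial>lborel) \<le> V (\<mu> k)"
      unfolding V_def
    proof (intro nn_integral_mono ennreal_leI mult_left_mono power_mono weight_nonneg)
      fix \<xi> :: "real^'n"
      have "norm (reg_symbol (\<epsilon> (\<mu> (Suc k))) f \<xi> - reg_symbol (\<epsilon> (\<mu> k)) f \<xi>)
          = \<bar>exp (- \<epsilon> (\<mu> (Suc k)) * (norm \<xi>)\<^sup>2) - exp (- \<epsilon> (\<mu> k) * (norm \<xi>)\<^sup>2)\<bar> * norm (fourier f \<xi>)"
        unfolding reg_symbol_def left_diff_distrib[symmetric] norm_mult of_real_diff[symmetric] norm_of_real ..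
      also have "\<dots> \<le> (1 - exp (- \<epsilon> (\<mu> k) * (norm \<xi>)\<^sup>2)) * norm (fourier f \<xi>)"
        using eps(1)[of "\<mu> (Suc k)"] eps_mono[OF mu(3)] by (intro mult_right_mono exp_diff_le) auto
      finally show "norm (reg_symbol (\<epsilon> (\<mu> (Suc k))) f \<xi> - reg_symbol (\<epsilon> (\<mu> k)) f \<xi>) \<le> \<dots>" .
    qed auto
    also have "\<dots> \<le> ennreal ((1/16) ^ k)" by (rule m[OF mu(1)])
    finally show "(\<integral>\<^sup>+\<xi>. ennreal (weight \<xi> * (norm (reg_symbol (\<epsilon> (\<mu> (Suc k))) f \<xi> - reg_symbol (\<epsilon> (\<mu> k)) f \<xi>))\<^sup>2) \<partial>lborel) \<le> ennreal ((1/16) ^ k)" .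
  qed
qed

lemma osc_op_diff:
  assumes "integrable lborel G" "integrable lborel H"
  shows "osc_op a (\<lambda>\<xi>. G \<xi> - H \<xi>) x t = osc_op a G x t - osc_op a H x t"
proof -
  have *: "integrable lborel (\<lambda>\<xi>. cis (phase a x t \<xi>) * G \<xi>)" if "integrable lborel G" for G
  proof (rule Bochner_Integration.integrable_bound[OF that])
    have [measurable]: "G \<in> borel_measurable borel" using that by auto
    show "(\<lambda>\<xi>. cis (phase a x t \<xi>) * G \<xi>) \<in> borel_measurable lborel" by measurable
  qed (auto simp: norm_mult)
  show ?thesis unfolding osc_op_def right_diff_distrib
    by (rule Bochner_Integration.integral_diff[OF *[OF assms(1)] *[OF assms(2)]])
qed

lemma open_cube_subset: "box (- (\<rho> *\<^sub>R One)) (\<rho> *\<^sub>R One) \<subseteq> (cube \<rho> :: (real^'n::finite) set)"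
proof
  fix x :: "real^'n" assume x: "x \<in> box (- (\<rho> *\<^sub>R One)) (\<rho> *\<^sub>R One)"
  have "\<bar>x $ j\<bar> \<le> \<rho>" for j
  proof -
    have ax: "axis j 1 \<in> (Basis :: (real^'n) set)" by (auto simp: Basis_vec_def)
    have "\<forall>i\<in>Basis. - (\<rho> *\<^sub>R One) \<bullet> i < x \<bullet> i \<and> x \<bullet> i < (\<rho> *\<^sub>R One) \<bullet> i"
      using x unfolding mem_box .
    from bspec[OF this ax] have b: "- (\<rho> *\<^sub>R (One :: real^'n)) \<bullet> axis j 1 < x \<bullet> axis j 1 \<and> x \<bullet> axis j 1 < (\<rho> *\<^sub>R (One :: real^'n)) \<bullet> axis j 1" .
    have one: "(One :: real^'n) \<bullet> axis j 1 = 1"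
      unfolding inner_sum_left using ax by (simp add: inner_Basis)
    have "- \<rho> < x \<bullet> axis j 1 \<and> x \<bullet> axis j 1 < \<rho>"
      using b unfolding inner_minus_left inner_scaleR_left one by simp
    then have "- \<rho> < x $ j \<and> x $ j < \<rho>" by (simp add: inner_axis)
    then show ?thesis by auto
  qed
  then show "x \<in> cube \<rho>" by (simp add: cube_def)
qed

text \<open>Almost everywhere on the cube the increments of the damped operators are bounded by a
  geometric series that does not involve the time. So their limit is continuous in time, equals
  \<open>T_op\<close> at positive times, and its value at 0 is the limit l of the damped values
  there. The majorant \<open>w\<close> is provided for dominated convergence of these
  values.\<close>

lemma AE_convergence_sequence:
  fixes a :: "real^'n::finite" and f :: "real^'n \<Rightarrow> complex" and e :: "nat \<Rightarrow> real"
  assumes a: "\<And>j. a $ j > 1" and f: "integrable lborel f" and supp: "\<And>y. norm y > R \<Longrightarrow> f y = 0"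
    and e: "\<And>k. e k > 0" "e \<longlonglongrightarrow> 0"
    and V: "\<And>k. (\<integral>\<^sup>+\<xi>. ennreal (weight \<xi> * (norm (reg_symbol (e (Suc k)) f \<xi> - reg_symbol (e k) f \<xi>))\<^sup>2) \<partial>lborel) \<le> ennreal ((1/16) ^ k)"
  obtains w :: "real^'n \<Rightarrow> real" where "integrable lborel w"
    "AE x in lborel. x \<in> cube \<rho> \<longrightarrow>
      (\<forall>k. norm (of_real (1 / (2 * pi) ^ CARD('n)) * osc_op a (reg_symbol (e k) f) x 0) \<le> w x) \<and>
      (\<exists>l. (\<lambda>k. of_real (1 / (2 * pi) ^ CARD('n)) * osc_op a (reg_symbol (e k) f) x 0) \<longlonglongrightarrow> l \<and>
        ((\<lambda>t. T_op a t f x) \<longlongrightarrow> l) (at 0 within {t. \<forall>j. 0 < t $ j \<and> t $ j < 1}))"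
proof -
  have [measurable]: "f \<in> borel_measurable borel" using f by auto
  define \<kappa> where "\<kappa> = 1 / (2 * pi) ^ CARD('n)"
  have kappa: "\<kappa> \<ge> 0" by (simp add: \<kappa>_def)
  define S where "S k x t = osc_op a (reg_symbol (e k) f) x t" for k x t
  have Gint: "integrable lborel (reg_symbol (e k) f)" for k by (rule integrable_reg_symbol[OF _ e(1)]) measurable
  obtain C where C: "C \<ge> 0" "\<And>G. integrable lborel G \<Longrightarrow>
    \<exists>M\<in>borel_measurable borel. (\<forall>x t. ennreal ((norm (osc_op a G x t))\<^sup>2) \<le> M x) \<and>
      (\<integral>\<^sup>+x. indicator (cube \<rho>) x * M x \<partial>lborel) \<le> ennreal C * (\<integral>\<^sup>+\<xi>. ennreal (weight \<xi> * (norm (G \<xi>))\<^sup>2) \<partial>lborel)"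
    by (rule maximal_bound[OF a, of \<rho>], rule that)
  define P where "P k M \<longleftrightarrow> M \<in> borel_measurable borel \<and> (\<forall>x t. ennreal ((norm (S (Suc k) x t - S k x t))\<^sup>2) \<le> M x) \<and>
      (\<integral>\<^sup>+x. indicator (cube \<rho>) x * M x \<partial>lborel) \<le> ennreal C * ennreal ((1/16) ^ k)" for k M
  have "\<forall>k. \<exists>M. P k M"
  proof
    fix k
    have "integrable lborel (\<lambda>\<xi>. reg_symbol (e (Suc k)) f \<xi> - reg_symbol (e k) f \<xi>)"
      by (rule Bochner_Integration.integrable_diff[OF Gint Gint])
    from C(2)[OF this] obtain M where M: "M \<in> borel_measurable borel"
      "\<And>x t. ennreal ((norm (S (Suc k) x t - S k x t))\<^sup>2) \<le> M x"
      "(\<integral>\<^sup>+x. indicator (cube \<rho>) x * M x \<partial>lborel) \<le>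
        ennreal C * (\<integral>\<^sup>+\<xi>. ennreal (weight \<xi> * (norm (reg_symbol (e (Suc k)) f \<xi> - reg_symbol (e k) f \<xi>))\<^sup>2) \<partial>lborel)"
      unfolding osc_op_diff[OF Gint Gint] S_def by blast
    have "P k M" unfolding P_def using M(1,2) order_trans[OF M(3) mult_left_mono[OF V[of k]]] by simp
    then show "\<exists>M. P k M" by (rule exI[of "P k" M])
  qed
  from choice[OF this] obtain M where "\<And>k. P k (M k)" by blast
  then have [measurable]: "\<And>k. M k \<in> borel_measurable borel"
    and M: "\<And>k x t. ennreal ((norm (S (Suc k) x t - S k x t))\<^sup>2) \<le> M k x"
      "\<And>k. (\<integral>\<^sup>+x. indicator (cube \<rho>) x * M k x \<partial>lborel) \<le> ennreal C * ennreal ((1/16) ^ k)"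
    unfolding P_def by blast+
  text \<open>The factor \<open>4\<^sup>k\<close> turns finiteness of \<open>Z x\<close> into geometric decay of the increments,
    uniformly in \<open>t\<close>.\<close>
  define Z where "Z x = (\<Sum>k. ennreal (4 ^ k) * M k x)" for x
  have [measurable]: "Z \<in> borel_measurable borel" unfolding Z_def by measurable
  have Zfin: "(\<integral>\<^sup>+x. indicator (cube \<rho>) x * Z x \<partial>lborel) < \<infinity>"
  proof -
    have "(\<integral>\<^sup>+x. indicator (cube \<rho>) x * Z x \<partial>lborel) = (\<integral>\<^sup>+x. (\<Sum>k. ennreal (4 ^ k) * (indicator (cube \<rho>) x * M k x)) \<partial>lborel)"
      unfolding Z_def by (intro nn_integral_cong) (simp add: mult.left_commute flip: ennreal_suminf_cmult)
    also have "\<dots> = (\<Sum>k. \<integral>\<^sup>+x. ennreal (4 ^ k) * (indicator (cube \<rho>) x * M k x) \<partial>lborel)"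
      by (rule nn_integral_suminf) measurable
    also have "\<dots> \<le> (\<Sum>k. ennreal (C * (1/4) ^ k))"
    proof (rule suminf_le)
      fix k
      have "(\<integral>\<^sup>+x. ennreal (4 ^ k) * (indicator (cube \<rho>) x * M k x) \<partial>lborel) = ennreal (4 ^ k) * (\<integral>\<^sup>+x. indicator (cube \<rho>) x * M k x \<partial>lborel)"
        by (rule nn_integral_cmult) measurable
      also have "\<dots> \<le> ennreal (4 ^ k) * (ennreal C * ennreal ((1/16) ^ k))" by (rule mult_left_mono[OF M(2)]) simp
      also have "\<dots> = ennreal (4 ^ k * (C * (1/16) ^ k))" using C(1) by (simp add: ennreal_mult)
      also have "4 ^ k * (C * (1/16) ^ k) = C * (1/4) ^ k"
      proof -
        have "(4::real) ^ k * (1/16) ^ k = (1/4) ^ k" by (simp flip: power_mult_distrib)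
        then show ?thesis by (metis mult.left_commute)
      qed
      finally show "(\<integral>\<^sup>+x. ennreal (4 ^ k) * (indicator (cube \<rho>) x * M k x) \<partial>lborel) \<le> ennreal (C * (1/4) ^ k)" .
    qed auto
    also have "\<dots> < \<infinity>"
    proof -
      have "summable (\<lambda>k. C * (1/4) ^ k)" by (intro summable_mult summable_geometric) simp
      then show ?thesis using C(1) by (subst suminf_ennreal_eq[OF _ summable_sums]) auto
    qed
    finally show ?thesis .
  qed
  have Zae: "AE x in lborel. x \<in> cube \<rho> \<longrightarrow> Z x < \<infinity>"
  proof -
    have "AE x in lborel. indicator (cube \<rho>) x * Z x \<noteq> \<infinity>"
      using Zfin by (intro nn_integral_noteq_infinite) auto
    then show ?thesis by eventually_elim (auto simp: less_top)
  qed
  define z where "z x = enn2real (Z x)" for x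
  have diff_le: "norm (S (Suc k) x t - S k x t) \<le> (1 + z x) * (1/2) ^ k" if "Z x < \<infinity>" for k x t
  proof -
    have "ennreal (4 ^ k * (norm (S (Suc k) x t - S k x t))\<^sup>2) \<le> ennreal (4 ^ k) * M k x"
      by (simp add: ennreal_mult mult_left_mono M(1))
    also have "\<dots> \<le> Z x"
      unfolding Z_def using sum_le_suminf[of "\<lambda>k. ennreal (4 ^ k) * M k x" "{k}"] by simp
    also have "\<dots> = ennreal (z x)" using that by (simp add: z_def)
    finally have "4 ^ k * (norm (S (Suc k) x t - S k x t))\<^sup>2 \<le> z x"
      by (simp add: z_def)
    then have "(2 ^ k * norm (S (Suc k) x t - S k x t))\<^sup>2 \<le> z x"
    proof -
      have "(4::real) ^ k = (2 ^ k)\<^sup>2" by (simp add: power2_eq_square flip: power_mult_distrib)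
      then have "4 ^ k * d\<^sup>2 = (2 ^ k * d)\<^sup>2" for d :: real by (simp add: power_mult_distrib)
      then show ?thesis using \<open>4 ^ k * (norm (S (Suc k) x t - S k x t))\<^sup>2 \<le> z x\<close> by simp
    qed
    \<comment> \<open>Using 1 + z in place of the square root of z keeps the bound linear in z,
      hence integrable over the cube.\<close>
    also have "z x \<le> (1 + z x)\<^sup>2" by (simp add: power2_sum z_def add_increasing)
    finally have "2 ^ k * norm (S (Suc k) x t - S k x t) \<le> 1 + z x"
      by (rule power2_le_imp_le) (simp add: z_def)
    then show ?thesis by (simp add: power_one_over field_simps)
  qed
  \<comment> \<open>The first term bounds the initial operator \<open>S 0\<close> at every time; the
    second is the sum of the geometric series of increments.\<close>
  define w where "w x = indicator (cube \<rho>) x * (\<kappa> * (LINT \<xi>|lborel. norm (reg_symbol (e 0) f \<xi>)) + 2 * \<kappa> * (1 + z x))" for x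
  show thesis
  proof (rule that)
    show "integrable lborel w"
    proof -
      have ind: "integrable lborel (indicator (cube \<rho> :: (real^'n) set) :: _ \<Rightarrow> real)"
        by (rule integrable_real_indicator[OF _ emeasure_cube_finite]) measurable
      have "integrable lborel (\<lambda>x. indicator (cube \<rho>) x * z x)"
      proof (rule integrableI_bounded)
        have "(\<integral>\<^sup>+x. ennreal (norm (indicator (cube \<rho>) x * z x)) \<partial>lborel) \<le> (\<integral>\<^sup>+x. indicator (cube \<rho>) x * Z x \<partial>lborel)"
          by (intro nn_integral_mono) (auto simp: indicator_def z_def ennreal_enn2real_if)
        then show "(\<integral>\<^sup>+x. ennreal (norm (indicator (cube \<rho>) x * z x)) \<partial>lborel) < \<infinity>"
          using Zfin by (rule le_less_trans)
      qed (unfold z_def, measurable)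
      then have "integrable lborel (\<lambda>x. (\<kappa> * (LINT \<xi>|lborel. norm (reg_symbol (e 0) f \<xi>)) + 2 * \<kappa>) * indicator (cube \<rho>) x + 2 * \<kappa> * (indicator (cube \<rho>) x * z x))"
        using ind by (intro Bochner_Integration.integrable_add integrable_mult_right)
      then show ?thesis unfolding w_def by (simp add: algebra_simps)
    qed
    show "AE x in lborel. x \<in> cube \<rho> \<longrightarrow>
      (\<forall>k. norm (of_real (1 / (2 * pi) ^ CARD('n)) * osc_op a (reg_symbol (e k) f) x 0) \<le> w x) \<and>
      (\<exists>l. (\<lambda>k. of_real (1 / (2 * pi) ^ CARD('n)) * osc_op a (reg_symbol (e k) f) x 0) \<longlonglongrightarrow> l \<and>
        ((\<lambda>t. T_op a t f x) \<longlongrightarrow> l) (at 0 within {t. \<forall>j. 0 < t $ j \<and> t $ j < 1}))"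
      using Zae
    proof eventually_elim
      case (elim x)
      show ?case unfolding S_def[symmetric] \<kappa>_def[symmetric]
      proof
        assume x: "x \<in> cube \<rho>"
        with elim have Zx: "Z x < \<infinity>" by blast
        let ?D = "\<lambda>k t. S (Suc k) x t - S k x t"
        have tele: "(\<Sum>i<k. ?D i t) = S k x t - S 0 x t" for k t by (rule sum_lessThan_telescope)
        have sm: "summable (\<lambda>k. (1 + z x) * (1/2) ^ k)" by (intro summable_mult summable_geometric) simp
        \<comment> \<open>Uniformity over all times, 0 included, is what permits exchanging the
          limit in the damping with the limit in time.\<close>
        have unif: "uniform_limit UNIV (\<lambda>n t. \<Sum>i<n. ?D i t) (\<lambda>t. \<Sum>i. ?D i t) sequentially"
          by (rule Weierstrass_m_test[OF _ sm]) (rule diff_le[OF Zx])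
        define L where "L t = of_real \<kappa> * (S 0 x t + (\<Sum>i. ?D i t))" for t
        have lim: "(\<lambda>k. of_real \<kappa> * S k x t) \<longlonglongrightarrow> L t" for t
        proof -
          have "(\<lambda>n. \<Sum>i<n. ?D i t) \<longlonglongrightarrow> (\<Sum>i. ?D i t)" by (rule tendsto_uniform_limitI[OF unif]) simp
          then have "(\<lambda>n. of_real \<kappa> * (S 0 x t + (\<Sum>i<n. ?D i t))) \<longlonglongrightarrow> L t" unfolding L_def by (intro tendsto_intros)
          then show ?thesis unfolding tele by simp
        qed
        have Sc: "continuous_on UNIV (S k x)" for k unfolding S_def by (rule continuous_osc_op[OF Gint])
        have "continuous_on UNIV (\<lambda>t. \<Sum>i. ?D i t)"
          by (rule uniform_limit_theorem[OF _ unif]) (intro always_eventually allI continuous_intros Sc, simp)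
        then have "continuous_on UNIV L" unfolding L_def by (intro continuous_intros Sc)
        then have "(L \<longlongrightarrow> L 0) (at 0)" by (simp add: continuous_on_def)
        then have L0: "(L \<longlongrightarrow> L 0) (at 0 within {t. \<forall>j. 0 < t $ j \<and> t $ j < 1})"
          by (rule tendsto_within_subset[of _ _ _ UNIV]) simp
        have TL: "T_op a t f x = L t" if "\<forall>j. 0 < t $ j \<and> t $ j < 1" for t :: "real^'n"
        proof -
          have "(\<lambda>k. of_real \<kappa> * S k x t) \<longlonglongrightarrow> T_op a t f x"
            unfolding S_def \<kappa>_def by (rule osc_op_tendsto_T_op[OF a f supp e]) (use that in auto)
          then show ?thesis using lim LIMSEQ_unique by blast
        qed
        have T: "((\<lambda>t. T_op a t f x) \<longlongrightarrow> L 0) (at 0 within {t. \<forall>j. 0 < t $ j \<and> t $ j < 1})"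
          by (rule Lim_transform_eventually[OF L0]) (use TL in \<open>auto simp: eventually_at_filter\<close>)
        have bound: "norm (of_real \<kappa> * S k x 0) \<le> w x" for k
        proof -
          have "norm (S k x 0) = norm (S 0 x 0 + (\<Sum>i<k. ?D i 0))" unfolding tele by simp
          also have "\<dots> \<le> norm (S 0 x 0) + (\<Sum>i<k. norm (?D i 0))"
            by (rule order_trans[OF norm_triangle_ineq add_left_mono[OF norm_sum]])
          also have "\<dots> \<le> (LINT \<xi>|lborel. norm (reg_symbol (e 0) f \<xi>)) + (\<Sum>i<k. (1 + z x) * (1/2) ^ i)"
            unfolding S_def by (intro add_mono norm_osc_op_le Gint sum_mono diff_le[OF Zx, unfolded S_def])
          also have "(\<Sum>i<k. (1 + z x) * (1/2) ^ i) \<le> (1 + z x) * 2"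
          proof -
            have "(\<Sum>i<k. (1/2::real) ^ i) \<le> (\<Sum>i. (1/2) ^ i)" by (intro sum_le_suminf summable_geometric) auto
            also have "\<dots> = 2" using suminf_geometric[of "1/2::real"] by simp
            finally show ?thesis unfolding sum_distrib_left[symmetric] by (intro mult_left_mono) (auto simp: z_def)
          qed
          finally have "norm (S k x 0) \<le> (LINT \<xi>|lborel. norm (reg_symbol (e 0) f \<xi>)) + (1 + z x) * 2" by simp
          from mult_left_mono[OF this kappa] show ?thesis
            using x kappa by (simp add: w_def norm_mult algebra_simps)
        qed
        show "(\<forall>k. norm (of_real \<kappa> * S k x 0) \<le> w x) \<and>
          (\<exists>l. (\<lambda>k. of_real \<kappa> * S k x 0) \<longlonglongrightarrow> l \<and>
            ((\<lambda>t. T_op a t f x) \<longlongrightarrow> l) (at 0 within {t. \<forall>j. 0 < t $ j \<and> t $ j < 1}))"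
          using bound lim[of 0] T by blast
      qed
    qed
  qed
qed

text \<open>It remains to see that the limit h equals f almost everywhere. The damped values at time
  0 converge to h under an integrable majorant, so their box integrals tend to those of h; the same
  integrals tend to those of f because at time 0 the operator is a Gaussian mean.\<close>

lemma AE_T_op_tendsto_cube:
  fixes a :: "real^'n::finite" and f :: "real^'n \<Rightarrow> complex"
  assumes a: "\<And>j. a $ j > 1" and f: "integrable lborel f" and supp: "\<And>y. norm y > R \<Longrightarrow> f y = 0"
    and fin: "(\<integral>\<^sup>+\<xi>. ennreal (weight \<xi> * (norm (fourier f \<xi>))\<^sup>2) \<partial>lborel) < \<infinity>"
  shows "AE x in lborel. x \<in> box (- (\<rho> *\<^sub>R One)) (\<rho> *\<^sub>R One) \<longrightarrow>
    ((\<lambda>t. T_op a t f x) \<longlongrightarrow> f x) (at 0 within {t. \<forall>j. 0 < t $ j \<and> t $ j < 1})"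
proof -
  let ?B = "box (- (\<rho> *\<^sub>R One)) (\<rho> *\<^sub>R One) :: (real^'n) set"
  have [measurable]: "f \<in> borel_measurable borel" using f by auto
  obtain e :: "nat \<Rightarrow> real" where e: "\<And>k. e k > 0" "\<And>k. e k \<le> 1/4" "e \<longlonglongrightarrow> 0"
    and V: "\<And>k. (\<integral>\<^sup>+\<xi>. ennreal (weight \<xi> * (norm (reg_symbol (e (Suc k)) f \<xi> - reg_symbol (e k) f \<xi>))\<^sup>2) \<partial>lborel) \<le> ennreal ((1/16) ^ k)"
    by (rule regularisation_sequence[OF _ fin], simp, rule that)
  define r where "r k x = of_real (1 / (2 * pi) ^ CARD('n)) * osc_op a (reg_symbol (e k) f) x 0" for k x
  obtain w where w: "integrable lborel w" and conv: "AE x in lborel. x \<in> cube \<rho> \<longrightarrow>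
      (\<forall>k. norm (r k x) \<le> w x) \<and> (\<exists>l. (\<lambda>k. r k x) \<longlonglongrightarrow> l \<and>
        ((\<lambda>t. T_op a t f x) \<longlongrightarrow> l) (at 0 within {t. \<forall>j. 0 < t $ j \<and> t $ j < 1}))"
    unfolding r_def
    using AE_convergence_sequence[where \<rho>=\<rho>, OF a f supp e(1,3) V] by blast
  have gm [measurable]: "reg_symbol (e k) f \<in> borel_measurable borel" for k
    unfolding reg_symbol_def[abs_def] by measurable
  have [measurable]: "r k \<in> borel_measurable borel" for k unfolding r_def by measurable
  define h where "h x = lim (\<lambda>k. r k x)" for x
  have [measurable]: "h \<in> borel_measurable borel" unfolding h_def by measurable
  have conv': "AE x in lborel. x \<in> cube \<rho> \<longrightarrow> (\<forall>k. norm (r k x) \<le> w x) \<and> (\<lambda>k. r k x) \<longlonglongrightarrow> h x \<and>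
        ((\<lambda>t. T_op a t f x) \<longlongrightarrow> h x) (at 0 within {t. \<forall>j. 0 < t $ j \<and> t $ j < 1})"
    using conv by eventually_elim (auto simp: h_def dest: limI)
  have wm [measurable]: "w \<in> borel_measurable borel" using w by auto
  have hint: "integrable lborel (\<lambda>x. indicator ?B x *\<^sub>R h x)"
  proof (rule Bochner_Integration.integrable_bound[OF w])
    show "AE x in lborel. norm (indicator ?B x *\<^sub>R h x) \<le> norm (w x)"
      using conv'
    proof eventually_elim
      case (elim x)
      show ?case
      proof (cases "x \<in> ?B")
        case True
        then have "x \<in> cube \<rho>" using open_cube_subset by blast
        with elim have "norm (h x) \<le> w x" by (intro tendsto_upperbound[OF tendsto_norm]) auto
        then show ?thesis using True by simp
      qed simp
    qed
  qed measurable
  have fint: "integrable lborel (\<lambda>x. indicator ?B x *\<^sub>R f x)"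
    by (rule integrable_mult_indicator[OF _ f]) simp
  let ?H = "\<lambda>x. indicator ?B x *\<^sub>R h x - indicator ?B x *\<^sub>R f x"
  have Hint: "integrable lborel ?H" by (rule Bochner_Integration.integrable_diff[OF hint fint])
  have "AE x in lborel. ?H x = 0"
  proof (rule AE_zero_if_box_integrals_zero_integrable[OF Hint])
    fix l u :: "real^'n"
    \<comment> \<open>The intersection is again a box and lies in the cube, so both convergence
      statements apply to it.\<close>
    define Q where "Q = box l u \<inter> ?B"
    obtain l' u' where Q: "Q = box l' u'" unfolding Q_def box_Int_box by blast
    have QB: "Q \<subseteq> cube \<rho>" unfolding Q_def using open_cube_subset by blast
    have [measurable]: "Q \<in> sets borel" unfolding Q by simp
    have "(\<lambda>k. LINT x:Q|lborel. r k x) \<longlonglongrightarrow> (LINT x:Q|lborel. h x)"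
      unfolding set_lebesgue_integral_def
    proof (rule integral_dominated_convergence[where w="\<lambda>x. \<bar>w x\<bar>"])
      show "integrable lborel (\<lambda>x. \<bar>w x\<bar>)" using w by simp
      show "AE x in lborel. (\<lambda>k. indicator Q x *\<^sub>R r k x) \<longlonglongrightarrow> indicator Q x *\<^sub>R h x"
        using conv' by eventually_elim (use QB in \<open>auto simp: indicator_def\<close>)
      show "AE x in lborel. norm (indicator Q x *\<^sub>R r k x) \<le> \<bar>w x\<bar>" for k
        using conv' by eventually_elim (use QB in \<open>auto simp: indicator_def intro: order_trans[OF _ abs_ge_self]\<close>)
    qed measurable
    moreover have "(\<lambda>k. LINT x:Q|lborel. r k x) \<longlonglongrightarrow> (LINT x:Q|lborel. f x)"
      unfolding r_def Q by (rule box_integral_reg_tendsto[OF f e])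
    ultimately have eq: "(LINT x:Q|lborel. h x) = (LINT x:Q|lborel. f x)" by (rule LIMSEQ_unique)
    have ind: "indicator (box l u) x *\<^sub>R (indicator ?B x *\<^sub>R v) = indicator Q x *\<^sub>R v" for x and v :: complex
      by (simp add: Q_def indicator_inter_arith)
    have "(LINT x:box l u|lborel. ?H x) = (LINT x|lborel. indicator Q x *\<^sub>R h x - indicator Q x *\<^sub>R f x)"
      unfolding set_lebesgue_integral_def by (simp only: scaleR_diff_right ind)
    also have "\<dots> = (LINT x:Q|lborel. h x) - (LINT x:Q|lborel. f x)"
      unfolding set_lebesgue_integral_def
    proof (rule Bochner_Integration.integral_diff)
      have "integrable lborel (\<lambda>x. indicator (box l u) x *\<^sub>R (indicator ?B x *\<^sub>R h x))"
        by (rule integrable_mult_indicator[OF _ hint]) simp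
      then show "integrable lborel (\<lambda>x. indicator Q x *\<^sub>R h x)" unfolding ind .
      show "integrable lborel (\<lambda>x. indicator Q x *\<^sub>R f x)" by (rule integrable_mult_indicator[OF _ f]) simp
    qed
    finally show "(LINT x:box l u|lborel. ?H x) = 0" using eq by simp
  qed
  with conv' show ?thesis
  proof eventually_elim
    case (elim x)
    show ?case
    proof
      assume x: "x \<in> ?B"
      then have "x \<in> cube \<rho>" using open_cube_subset by blast
      moreover have "h x = f x" using elim(2) x by simp
      ultimately show "((\<lambda>t. T_op a t f x) \<longlongrightarrow> f x) (at 0 within {t. \<forall>j. 0 < t $ j \<and> t $ j < 1})"
        using elim(1) by simp
    qed
  qed
qed

theorem corollary1p1:
  fixes a :: "real^'n" and f :: "real^'n \<Rightarrow> complex"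
  assumes "CARD('n) \<ge> 2"
    and "\<And>j. a $ j > 1"
    and "f \<in> sobolev (real CARD('n) / 4)"
    and "\<exists>C. compact C \<and> (AE x in lebesgue. x \<notin> C \<longrightarrow> f x = 0)"
  shows "AE x in lebesgue.
    ((\<lambda>t. T_op a t f x) \<longlongrightarrow> f x) (at 0 within {t. \<forall>j. 0 < t $ j \<and> t $ j < 1})"
proof -
  obtain f' R where f': "integrable lborel f'" and supp: "\<And>x. norm x > R \<Longrightarrow> f' x = 0"
    and ff': "AE x in lborel. f x = f' x"
    and fin: "(\<integral>\<^sup>+\<xi>. ennreal (weight \<xi> * (norm (fourier f' \<xi>))\<^sup>2) \<partial>lborel) < \<infinity>"
    by (rule sobolev_compact_support[OF assms(3,4)], rule that)
  have [measurable]: "f' \<in> borel_measurable borel" using f' by auto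
  have fm: "f \<in> borel_measurable lebesgue" using assms(3) by (auto simp: sobolev_def induces_def)
  note [measurable] = osc_kernel_measurable[OF assms(2)]
  \<comment> \<open>Changing f on a null set alters \<open>T_op\<close> at no time and no point, so
    the exceptional set of the conclusion does not depend on the time.\<close>
  have T: "T_op a t f x = T_op a t f' x" for t x
  proof -
    have k: "(\<lambda>y. kernel a t (x - y)) \<in> borel_measurable borel" unfolding kernel_def by measurable
    have "(LINT y|lebesgue. kernel a t (x - y) * f y) = (LINT y|lebesgue. kernel a t (x - y) * f' y)"
    proof (rule integral_cong_AE)
      show "(\<lambda>y. kernel a t (x - y) * f y) \<in> borel_measurable lebesgue"
        using k by (intro borel_measurable_times fm measurable_completion) simp
      show "(\<lambda>y. kernel a t (x - y) * f' y) \<in> borel_measurable lebesgue"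
        using k by (intro borel_measurable_times measurable_completion) simp_all
      show "AE y in lebesgue. kernel a t (x - y) * f y = kernel a t (x - y) * f' y"
        using AE_completion[OF ff'] by eventually_elim simp
    qed
    then show ?thesis by (simp add: T_op_def)
  qed
  let ?S = "{t::real^'n. \<forall>j. 0 < t $ j \<and> t $ j < 1}" and ?B = "\<lambda>n::nat. box (- (real n *\<^sub>R One)) (real n *\<^sub>R One) :: (real^'n) set"
  have "AE x in lborel. \<forall>n. x \<in> ?B n \<longrightarrow> ((\<lambda>t. T_op a t f' x) \<longlongrightarrow> f' x) (at 0 within ?S)"
    unfolding AE_all_countable by (intro allI AE_T_op_tendsto_cube[OF assms(2) f' supp fin])
  with ff' have "AE x in lborel. ((\<lambda>t. T_op a t f x) \<longlongrightarrow> f x) (at 0 within ?S)"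
  proof eventually_elim
    case (elim x)
    have "x \<in> (\<Union>n. ?B n)" unfolding UN_box_eq_UNIV by simp
    with elim show ?case unfolding T by auto
  qed
  then show ?thesis by (rule AE_completion)
qed

end
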